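(* Let $d\ge2$. The maximum of the average fidelity $F[\boldsymbol R]$ over all $1\to2$ learning instruments $\boldsymbol R=\{R_{ij}\}_{i,j=1}^d$ for von Neumann measurements on a $d$-dimensional Hilbert space equals $$\max_{\boldsymbol R}F[\boldsymbol R]=\frac{9d^2+16d-17}{6d^2(d^2-1)}\quad\text{if } d\ge 3,\qquad \max_{\boldsymbol R}F[\boldsymbol R]=\frac{7}{12}\quad\text{if } d=2.$$
   Context: Let $\mathcal H=\mathbb C^d$ with a fixed orthonormal basis $\{|i\rangle\}_{i=1}^d$; $^T$ denotes transposition in this basis. For $U\in SU(d)$ let $E_i^{(U)}=U|i\rangle\langle i|U^\dagger$, $i=1,\dots,d$ (a von Neumann measurement). Let $\mathcal H_A,\mathcal H_B,\mathcal H_C,\mathcal H_D$ be copies of $\mathcal H$. A $1\to2$ learning instrument is a family $\boldsymbol R=\{R_{ij}\}_{i,j=1}^d$ of positive semidefinite operators on $\mathcal H_A\otimes\mathcal H_B\otimes\mathcal H_C\otimes\mathcal H_D$ such that $$\sum_{i,j}R_{ij}=I_{ABD}\otimes\rho_C,\qquad \mathrm{Tr}[\rho_C]=1,$$ for some positive semidefinite operator $\rho_C$ on $\mathcal H_C$. (These are the Choi operators of networks in which the unknown measurement is used once on system $C$, with classical outcome encoded in $D$, before the bipartite state on $A,B$ becomes available, and a pair of outcomes $(i,j)$ is produced afterwards.) The replicated POVM on $\mathcal H_A\otimes\mathcal H_B$ is $$G_{ij}^{(U)}=\Big[\sum_{k=1}^d\langle k|_C\langle k|_D\,(U_C^\dagger\otimes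 I)\,R_{ij}\,(U_C\otimes I)\,|k\rangle_C|k\rangle_D\Big]^T,$$ where $U_C$ acts on $\mathcal H_C$ and $I$ is the identity on the other systems. The average fidelity is $$F[\boldsymbol R]=\frac1{d^2}\sum_{i,j=1}^d\int dU\;\mathrm{Tr}\big[G_{ij}^{(U)}\,(E_i^{(U)}\otimes E_j^{(U)})\big],$$ where $dU$ is the normalized Haar measure on $SU(d)$. *)

theory Defs
  imports "HOL-Analysis.Analysis"
begin

text \<open>
  The finite index type \<open>'n\<close> labels the fixed orthonormal basis, so \<open>d = CARD('n)\<close>.
  Operators are matrices in that basis (first index: row), and the basis of a tensor product is
  indexed by the product type; for \<open>A, B, C, D\<close> this is \<open>'n \<times> ('n \<times> ('n \<times> 'n))\<close>.
\<close>

type_synonym 'i operator = "complex ^ 'i ^ 'i"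

definition dagger :: "'i::finite operator \<Rightarrow> 'i operator" where
  "dagger A = (\<chi> p q. cnj (A $ q $ p))"

definition tensor :: "'i::finite operator \<Rightarrow> 'j::finite operator \<Rightarrow> ('i \<times> 'j) operator"
    (infixr "\<otimes>" 75) where
  "A \<otimes> B = (\<chi> p q. A $ fst p $ fst q * B $ snd p $ snd q)"

text \<open>Over the complex numbers, a matrix with nonnegative real quadratic form is Hermitian.\<close>

definition positive_semidefinite :: "'i::finite operator \<Rightarrow> bool" where
  "positive_semidefinite A \<longleftrightarrow>
     (\<forall>v :: complex ^ 'i. (\<Sum>p\<in>UNIV. \<Sum>q\<in>UNIV. cnj (v $ p) * A $ p $ q * v $ q) \<in> \<real>\<^sub>\<ge>\<^sub>0)"

definition special_unitary :: "'n::finite operator set" where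
  "special_unitary = {U. U ** dagger U = mat 1 \<and> dagger U ** U = mat 1 \<and> det U = 1}"

text \<open>
  The normalized Haar measure: the unique left-invariant Borel probability measure on the compact
  group \<open>SU(d)\<close>. Regularity and right-invariance are automatic.
\<close>

definition normalized_Haar_measure :: "'n::finite operator measure \<Rightarrow> bool" where
  "normalized_Haar_measure \<mu> \<longleftrightarrow>
     sets \<mu> = sets (restrict_space borel special_unitary) \<and>
     emeasure \<mu> (space \<mu>) = 1 \<and>
     (\<forall>V \<in> special_unitary. distr \<mu> \<mu> (\<lambda>U. V ** U) = \<mu>)"

definition basis_projector :: "'n::finite \<Rightarrow> 'n operator" where
  "basis_projector i = (\<chi> a b. if a = i \<and> b = i then 1 else 0)"

definition von_Neumann_effect :: "'n::finite operator \<Rightarrow> 'n \<Rightarrow> 'n operator" where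
  "von_Neumann_effect U i = U ** basis_projector i ** dagger U"

definition on_C :: "'n::finite operator \<Rightarrow> ('n \<times> 'n \<times> 'n \<times> 'n) operator" where
  "on_C X = mat 1 \<otimes> mat 1 \<otimes> X \<otimes> mat 1"

definition learning_instrument ::
    "('n::finite \<Rightarrow> 'n \<Rightarrow> ('n \<times> 'n \<times> 'n \<times> 'n) operator) \<Rightarrow> bool" where
  "learning_instrument R \<longleftrightarrow>
     (\<forall>i j. positive_semidefinite (R i j)) \<and>
     (\<exists>\<rho> :: 'n operator. positive_semidefinite \<rho> \<and> trace \<rho> = 1 \<and>
        (\<Sum>i\<in>UNIV. \<Sum>j\<in>UNIV. R i j) = on_C \<rho>)"

text \<open>The operator \<open>\<langle>k|\<^sub>C \<langle>l|\<^sub>D M |k\<rangle>\<^sub>C |l\<rangle>\<^sub>D\<close> on \<open>A \<otimes> B\<close>.\<close>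

definition sandwich_CD ::
    "'n::finite \<Rightarrow> 'n \<Rightarrow> ('n \<times> 'n \<times> 'n \<times> 'n) operator \<Rightarrow> ('n \<times> 'n) operator" where
  "sandwich_CD k l M = (\<chi> p q. M $ (fst p, snd p, k, l) $ (fst q, snd q, k, l))"

definition replicated_POVM ::
    "('n::finite \<Rightarrow> 'n \<Rightarrow> ('n \<times> 'n \<times> 'n \<times> 'n) operator) \<Rightarrow>
     'n operator \<Rightarrow> 'n \<Rightarrow> 'n \<Rightarrow> ('n \<times> 'n) operator" where
  "replicated_POVM R U i j =
     transpose (\<Sum>k\<in>UNIV. sandwich_CD k k (on_C (dagger U) ** R i j ** on_C U))"

text \<open>
  The trace below is that of a product of two positive semidefinite operators whenever \<open>R\<close> is a
  learning instrument, so it is real and taking \<open>Re\<close> only changes its type.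
\<close>

definition average_fidelity ::
    "'n::finite operator measure \<Rightarrow>
     ('n \<Rightarrow> 'n \<Rightarrow> ('n \<times> 'n \<times> 'n \<times> 'n) operator) \<Rightarrow> real" where
  "average_fidelity \<mu> R =
     1 / (real CARD('n))\<^sup>2 *
     (\<Sum>i\<in>UNIV. \<Sum>j\<in>UNIV.
        LINT U|\<mu>. Re (trace (replicated_POVM R U i j **
                            (von_Neumann_effect U i \<otimes> von_Neumann_effect U j))))"

definition is_maximum :: "real set \<Rightarrow> real \<Rightarrow> bool" where
  "is_maximum S m \<longleftrightarrow> m \<in> S \<and> (\<forall>x\<in>S. x \<le> m)"

end

theory Submission
  imports Defs "HOL-Probability.Probability"
begin

text \<open>
  For fixed outcome \<open>k\<close> stored in \<open>D\<close>, the fidelity is linear in the blocks \<open>\<langle>k|R\<^sub>i\<^sub>j|k\<rangle>\<close>, paired with the Haar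
  averages \<open>Q\<^sub>i\<^sub>j\<^sub>k\<close> of the projectors on \<open>u\<^sub>i\<^sup>* \<otimes> u\<^sub>j\<^sup>* \<otimes> u\<^sub>k\<close>, where \<open>u\<^sub>1, \<dots>, u\<^sub>d\<close> are the columns of \<open>U\<close>.
  Each \<open>Q\<^sub>i\<^sub>j\<^sub>k\<close> is a combination of six partially transposed permutation operators that depends only on
  which of \<open>i, j, k\<close> coincide: for \<open>i = j = k\<close> it is a moment of one uniformly distributed unit vector, and
  summing over a free index (the columns resolve the identity) gives the other cases.

  As a representation, \<open>A \<otimes> B \<otimes> C\<close> splits into traceless symmetric tensors, traceless antisymmetric
  tensors (absent if \<open>d = 2\<close>), and two copies of the dual of the defining representation. An invariant
  operator \<open>\<Lambda> \<ge> Q\<^sub>i\<^sub>j\<^sub>k\<close>, optimised block by block, bounds the fidelity by weak duality, since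
  \<open>\<Sum>\<^sub>i\<^sub>j Tr (\<Lambda> R\<^sub>i\<^sub>j) = Tr (\<Lambda> (I \<otimes> \<rho>))\<close>; complementary slackness yields an instrument attaining the bound.
  Positivity of the invariant operators involved is read off from averages of projectors, so no
  irreducibility argument is needed.
\<close>

section \<open>Invariance of the Haar measure\<close>

text \<open>Diagonal phases, plane rotations and column permutations need not have determinant 1,
  while the measure lives on SU(d). The integrands they are applied to are unchanged by a global
  phase of U, and this extends the invariance to all unitaries. Invariance is given on the left
  only, yet relabelling columns is a multiplication on the right, hence the detour through
  inversion. The dual optimum has one weight for each simple component and a 2 by 2 block for the
  repeated one. If k differs from i and j, the outcome vector has no part in the repeated component:
  the case i = j then fixes the symmetric weight, and three distinct outcomes fix the antisymmetric
  one. Exchanging A and B makes the block diagonal; the triple coincidence fixes its symmetric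
  entry, a vanishing determinant for i = k or j = k the other. The antisymmetric component has
  dimension d (d - 2) (d + 1) / 2 and contributes 1 / (2 d) to d times the optimum when d is at
  least 3. Its absence at d = 2 is why the optimum departs from the general formula there.\<close>

lemma dagger_nth [simp]: "dagger A $ p $ q = cnj (A $ q $ p)"
  by (simp add: dagger_def)

lemma dagger_dagger [simp]: "dagger (dagger A) = A"
  by (simp add: vec_eq_iff)

lemma dagger_mult: "dagger (A ** B) = dagger B ** dagger A"
  by (simp add: vec_eq_iff matrix_matrix_mult_def mult.commute)

lemma det_dagger: "det (dagger A) = cnj (det A)"
proof -
  have "dagger A = transpose (\<chi> p q. cnj (A $ p $ q))"
    by (simp add: vec_eq_iff transpose_def)
  then have "det (dagger A) = det (\<chi> p q. cnj (A $ p $ q))"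
    by simp
  also have "\<dots> = cnj (det A)"
    by (simp add: det_def)
  finally show ?thesis .
qed

definition unitary :: "'i::finite operator \<Rightarrow> bool" where
  "unitary U \<longleftrightarrow> U ** dagger U = mat 1 \<and> dagger U ** U = mat 1"

lemma special_unitary_iff: "U \<in> special_unitary \<longleftrightarrow> unitary U \<and> det U = 1"
  by (auto simp: special_unitary_def unitary_def)

lemma unitary_dagger: "unitary U \<Longrightarrow> unitary (dagger U)"
  by (simp add: unitary_def)

lemma unitary_mult: "unitary U \<Longrightarrow> unitary V \<Longrightarrow> unitary (U ** V)"
  unfolding unitary_def dagger_mult
  by (metis matrix_mul_assoc matrix_mul_rid)

lemma special_unitary_dagger: "U \<in> special_unitary \<Longrightarrow> dagger U \<in> special_unitary"
  by (simp add: special_unitary_iff unitary_dagger det_dagger)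

lemma special_unitary_mult:
  "U \<in> special_unitary \<Longrightarrow> V \<in> special_unitary \<Longrightarrow> U ** V \<in> special_unitary"
  by (simp add: special_unitary_iff unitary_mult det_mul)

lemma unitary_rows:
  assumes "unitary U"
  shows "(\<Sum>k\<in>UNIV. U $ a $ k * cnj (U $ b $ k)) = of_bool (a = b)"
proof -
  have "(U ** dagger U) $ a $ b = (mat 1 :: 'a operator) $ a $ b"
    using assms by (simp add: unitary_def)
  then show ?thesis
    by (simp add: matrix_matrix_mult_def mat_def of_bool_def)
qed

lemma unitary_columns:
  assumes "unitary U"
  shows "(\<Sum>a\<in>UNIV. cnj (U $ a $ i) * U $ a $ j) = of_bool (i = j)"
proof -
  have "(dagger U ** U) $ i $ j = (mat 1 :: 'a operator) $ i $ j"
    using assms by (simp add: unitary_def)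
  then show ?thesis
    by (simp add: matrix_matrix_mult_def mat_def of_bool_def)
qed

lemma unitary_entry_le_1:
  assumes "unitary U"
  shows "cmod (U $ a $ i) \<le> 1"
proof -
  have "of_real (\<Sum>k\<in>UNIV. (cmod (U $ a $ k))\<^sup>2) = (\<Sum>k\<in>UNIV. U $ a $ k * cnj (U $ a $ k))"
    by (simp only: of_real_sum complex_norm_square)
  also have "\<dots> = of_real 1"
    using unitary_rows[OF assms, of a a] by simp
  finally have "(\<Sum>k\<in>UNIV. (cmod (U $ a $ k))\<^sup>2) = 1"
    using of_real_eq_iff by blast
  moreover have "(cmod (U $ a $ i))\<^sup>2 \<le> (\<Sum>k\<in>UNIV. (cmod (U $ a $ k))\<^sup>2)"
    by (rule member_le_sum) auto
  ultimately show ?thesis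
    using power2_le_imp_le[of "cmod (U $ a $ i)" 1] by simp
qed

lemma bounded_special_unitary: "bounded (special_unitary :: 'n::finite operator set)"
proof (rule boundedI)
  fix U :: "'n operator"
  assume "U \<in> special_unitary"
  then have U: "unitary U" by (simp add: special_unitary_iff)
  have "norm U \<le> (\<Sum>a\<in>UNIV. norm (U $ a))"
    unfolding norm_vec_def by (intro L2_set_le_sum) auto
  also have "\<dots> \<le> (\<Sum>a\<in>(UNIV::'n set). \<Sum>i\<in>(UNIV::'n set). cmod (U $ a $ i))"
    unfolding norm_vec_def by (intro sum_mono L2_set_le_sum) auto
  also have "\<dots> \<le> (\<Sum>a\<in>(UNIV::'n set). \<Sum>i\<in>(UNIV::'n set). 1)"
    by (intro sum_mono unitary_entry_le_1 U)
  finally show "norm U \<le> (\<Sum>a\<in>(UNIV::'n set). \<Sum>i\<in>(UNIV::'n set). 1)" .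
qed

lemma continuous_on_matrix_mult [continuous_intros]:
  fixes f g :: "'a::topological_space \<Rightarrow> 'n::finite operator"
  assumes "continuous_on S f" "continuous_on S g"
  shows "continuous_on S (\<lambda>x. f x ** g x)"
  unfolding matrix_matrix_mult_def
  by (intro continuous_on_vec_lambda continuous_intros assms)

lemma continuous_on_dagger [continuous_intros]:
  fixes f :: "'a::topological_space \<Rightarrow> 'n::finite operator"
  assumes "continuous_on S f"
  shows "continuous_on S (\<lambda>x. dagger (f x))"
  unfolding dagger_def
  by (intro continuous_on_vec_lambda continuous_intros assms)

locale haar =
  fixes \<mu> :: "'n::finite operator measure"
  assumes haar: "normalized_Haar_measure \<mu>"
begin

lemma sets_haar: "sets \<mu> = sets (restrict_space borel special_unitary)"
  using haar by (simp add: normalized_Haar_measure_def)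

lemma space_haar [simp]: "space \<mu> = special_unitary"
  using sets_eq_imp_space_eq[OF sets_haar] by (simp add: space_restrict_space)

sublocale prob_space \<mu>
  by standard (use haar in \<open>simp add: normalized_Haar_measure_def\<close>)

lemma measurable_haar_to_borel:
  assumes "f \<in> borel_measurable borel"
  shows "f \<in> borel_measurable \<mu>"
  using measurable_restrict_space1[OF assms] measurable_cong_sets[OF sets_haar refl] by blast

lemma measurable_haar_continuous:
  fixes f :: "'n operator \<Rightarrow> 'b::topological_space"
  assumes "continuous_on UNIV f"
  shows "f \<in> borel_measurable \<mu>"
  by (intro measurable_haar_to_borel borel_measurable_continuous_onI assms)

lemma integrable_continuous:
  fixes f :: "'n operator \<Rightarrow> 'b::{banach, second_countable_topology}"
  assumes "continuous_on UNIV f"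
  shows "integrable \<mu> f"
proof -
  \<comment> \<open>\<open>f\<close> is continuous everywhere, so the closure, compact by
    boundedness alone, can stand in for SU(d).\<close>
  have "compact (closure (special_unitary :: 'n operator set))"
    using bounded_special_unitary by simp
  then have "bounded (f ` closure special_unitary)"
    using assms by (meson compact_continuous_image compact_imp_bounded continuous_on_subset subset_UNIV)
  then obtain B where "\<And>U. U \<in> closure special_unitary \<Longrightarrow> norm (f U) \<le> B"
    by (auto simp: bounded_iff)
  then have "AE U in \<mu>. norm (f U) \<le> B"
    using closure_subset by (intro AE_I2) auto
  then show ?thesis
    by (intro integrable_const_bound measurable_haar_continuous assms)
qed

lemma left_invariant:
  fixes f :: "'n operator \<Rightarrow> 'b::{banach, second_countable_topology}"
  assumes f: "continuous_on UNIV f" and V: "V \<in> special_unitary"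
  shows "(LINT U|\<mu>. f (V ** U)) = (LINT U|\<mu>. f U)"
proof -
  have *: "(\<lambda>U. V ** U) \<in> \<mu> \<rightarrow>\<^sub>M borel"
    by (intro measurable_haar_continuous continuous_intros)
  have "(\<lambda>U. V ** U) \<in> \<mu> \<rightarrow>\<^sub>M restrict_space borel special_unitary"
    by (intro measurable_restrict_space2 * ) (use V special_unitary_mult in auto)
  then have m: "(\<lambda>U. V ** U) \<in> \<mu> \<rightarrow>\<^sub>M \<mu>"
    using measurable_cong_sets[OF refl sets_haar] by blast
  have "(LINT U|\<mu>. f U) = (LINT U|distr \<mu> \<mu> (\<lambda>U. V ** U). f U)"
    using haar V by (simp add: normalized_Haar_measure_def)
  also have "\<dots> = (LINT U|\<mu>. f (V ** U))"
    by (rule integral_distr[OF m measurable_haar_continuous[OF f]])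
  finally show ?thesis ..
qed

text \<open>Integrate \<open>f (V\<^sup>\<dagger> U)\<close> over both variables: over \<open>U\<close> first this is the integral of \<open>f\<close>; over \<open>V\<close> first,
  after the substitution \<open>V \<mapsto> U V\<close>, it is the integral of \<open>f (V\<^sup>\<dagger>)\<close>.\<close>

lemma inversion_invariant:
  fixes f :: "'n operator \<Rightarrow> 'b::{banach, second_countable_topology}"
  assumes f: "continuous_on UNIV f"
  shows "(LINT U|\<mu>. f (dagger U)) = (LINT U|\<mu>. f U)"
proof -
  interpret P: pair_prob_space \<mu> \<mu> ..
  have c: "continuous_on UNIV (\<lambda>x :: 'n operator \<times> 'n operator. f (dagger (fst x) ** snd x))"
    by (intro continuous_on_compose2[OF f] continuous_intros) auto
  have g: "(\<lambda>x :: 'n operator \<times> 'n operator. f (dagger (fst x) ** snd x)) \<in> borel_measurable (borel \<Otimes>\<^sub>M borel)"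
    unfolding borel_prod by (rule borel_measurable_continuous_onI[OF c])
  have id: "(\<lambda>U. U) \<in> \<mu> \<rightarrow>\<^sub>M borel"
    by (intro measurable_haar_continuous continuous_intros)
  have "(\<lambda>x. (fst x, snd x)) \<in> \<mu> \<Otimes>\<^sub>M \<mu> \<rightarrow>\<^sub>M borel \<Otimes>\<^sub>M borel"
    by (intro measurable_Pair measurable_compose[OF measurable_fst id] measurable_compose[OF measurable_snd id])
  from measurable_compose[OF this g]
  have meas: "(\<lambda>x. f (dagger (fst x) ** snd x)) \<in> borel_measurable (\<mu> \<Otimes>\<^sub>M \<mu>)"
    by simp
  have "compact (closure (special_unitary :: 'n operator set))"
    using bounded_special_unitary by simp
  then have "bounded (f ` closure special_unitary)"
    using f by (meson compact_continuous_image compact_imp_bounded continuous_on_subset subset_UNIV)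
  then obtain B where B: "\<And>U. U \<in> closure special_unitary \<Longrightarrow> norm (f U) \<le> B"
    by (auto simp: bounded_iff)
  have int: "integrable (\<mu> \<Otimes>\<^sub>M \<mu>) (\<lambda>x. f (dagger (fst x) ** snd x))"
  proof (intro P.integrable_const_bound[of _ B] meas AE_I2)
    fix x assume "x \<in> space (\<mu> \<Otimes>\<^sub>M \<mu>)"
    then have "dagger (fst x) ** snd x \<in> special_unitary"
      by (auto simp: space_pair_measure intro!: special_unitary_mult special_unitary_dagger)
    then show "norm (f (dagger (fst x) ** snd x)) \<le> B"
      using B closure_subset by blast
  qed
  have inner: "(LINT V|\<mu>. f (dagger V ** U)) = (LINT V|\<mu>. f (dagger V))"
    if U: "U \<in> space \<mu>" for U
  proof -
    have cU: "continuous_on UNIV (\<lambda>V. f (dagger V ** U))"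
      by (intro continuous_on_compose2[OF f] continuous_intros) auto
    have "(LINT V|\<mu>. f (dagger V ** U)) = (LINT V|\<mu>. f (dagger (U ** V) ** U))"
      using left_invariant[OF cU] U by simp
    also have "\<dots> = (LINT V|\<mu>. f (dagger V))"
      using U by (simp add: dagger_mult matrix_mul_assoc[symmetric] special_unitary_iff unitary_def)
    finally show ?thesis .
  qed
  have "(LINT U|\<mu>. f (dagger U)) = (LINT U|\<mu>. LINT V|\<mu>. f (dagger V))"
    using prob_space by simp
  also have "\<dots> = (LINT U|\<mu>. LINT V|\<mu>. f (dagger V ** U))"
    by (rule Bochner_Integration.integral_cong[OF refl inner[symmetric]])
  also have "\<dots> = (LINT V|\<mu>. LINT U|\<mu>. f (dagger V ** U))"
    using P.Fubini_integral[of "\<lambda>V U. f (dagger V ** U)"] int by (simp add: case_prod_beta')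
  also have "\<dots> = (LINT V|\<mu>. LINT U|\<mu>. f U)"
    by (intro Bochner_Integration.integral_cong refl left_invariant f) (auto intro: special_unitary_dagger)
  finally show ?thesis using prob_space by simp
qed

lemma right_invariant:
  fixes f :: "'n operator \<Rightarrow> 'b::{banach, second_countable_topology}"
  assumes f: "continuous_on UNIV f" and V: "V \<in> special_unitary"
  shows "(LINT U|\<mu>. f (U ** V)) = (LINT U|\<mu>. f U)"
proof -
  have c1: "continuous_on UNIV (\<lambda>U. f (U ** V))" "continuous_on UNIV (\<lambda>U. f (dagger U))"
    by (intro continuous_on_compose2[OF f] continuous_intros; simp)+
  have "(LINT U|\<mu>. f (U ** V)) = (LINT U|\<mu>. f (dagger U ** V))"
    using inversion_invariant[OF c1(1)] by simp
  also have "\<dots> = (LINT U|\<mu>. f (dagger (dagger V ** U)))"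
    by (simp add: dagger_mult)
  also have "\<dots> = (LINT U|\<mu>. f U)"
    using left_invariant[OF c1(2) special_unitary_dagger[OF V]] inversion_invariant[OF f] by simp
  finally show ?thesis .
qed

end

section \<open>From SU(d) to arbitrary unitaries\<close>

lemma mat_mult_nth [simp]: "(mat w ** U) $ p $ q = w * U $ p $ q"
proof -
  have "(mat w ** U) $ p $ q = (\<Sum>k\<in>UNIV. if p = k then w * U $ k $ q else 0)"
    by (simp add: matrix_matrix_mult_def mat_def if_distrib[of "\<lambda>x. x * _"] cong: if_cong)
  then show ?thesis by simp
qed

lemma unitaryI: "U ** dagger U = mat 1 \<Longrightarrow> unitary U"
  by (simp add: unitary_def matrix_left_right_inverse)

lemma unitary_mat: "cmod w = 1 \<Longrightarrow> unitary (mat w)"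
  by (intro unitaryI, simp add: vec_eq_iff) (simp add: mat_def complex_norm_square[symmetric])

lemma exists_unimodular_root:
  assumes "cmod z = 1" and "n > 0"
  shows "\<exists>w. cmod w = 1 \<and> w ^ n = z"
proof (intro exI conjI)
  have "cis (Arg z / n) ^ n = cis (Arg z)"
    unfolding Complex.DeMoivre using assms by simp
  then show "cis (Arg z / n) ^ n = z"
    using assms rcis_cmod_Arg[of z] by (simp add: rcis_def)
qed simp

text \<open>Divide V by a d-th root of its determinant, which has modulus 1. Multiplication by V
  then differs from multiplication by an element of SU(d) only by a global phase.\<close>

lemma unitary_phase_decomposition:
  fixes V :: "'n::finite operator"
  assumes "unitary V"
  obtains w W where "cmod w = 1" "W \<in> special_unitary" "V = mat w ** W"
proof -
  have "det V * cnj (det V) = 1"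
    using assms by (metis det_dagger det_I det_mul unitary_def)
  then have "(cmod (det V))\<^sup>2 = 1"
    by (metis complex_norm_square of_real_eq_1_iff)
  then have "cmod (det V) = 1"
    by (simp add: power2_eq_1_iff) (metis norm_ge_zero not_one_le_zero neg_0_le_iff_le)
  then obtain w where w: "cmod w = 1" "w ^ CARD('n) = det V"
    using exists_unimodular_root[of "det V" "CARD('n)"] by auto
  define W where "W = mat (inverse w) ** V"
  have w0: "w \<noteq> 0" using w(1) by auto
  have "det (mat (inverse w) :: 'n operator) = inverse w ^ CARD('n)"
    by (subst det_diagonal) (auto simp: mat_def)
  then have "det W = 1"
    using w w0 by (simp add: W_def det_mul power_inverse)
      (metis left_inverse power_eq_0_iff)
  moreover have "unitary W"
    unfolding W_def using w by (intro unitary_mult assms unitary_mat) (simp add: norm_inverse)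
  ultimately have "W \<in> special_unitary"
    by (simp add: special_unitary_iff)
  moreover have "V = mat w ** W"
    using w0 by (simp add: W_def vec_eq_iff)
  ultimately show thesis using that w(1) by blast
qed

definition diagonal_phase :: "'n::finite \<Rightarrow> complex \<Rightarrow> 'n operator" where
  "diagonal_phase x w = (\<chi> p q. if p = q then if p = x then w else 1 else 0)"

lemma diagonal_phase_mult_nth:
  "(diagonal_phase x w ** U) $ p $ q = (if p = x then w else 1) * U $ p $ q"
proof -
  have "(diagonal_phase x w ** U) $ p $ q =
      (\<Sum>k\<in>UNIV. if p = k then (if p = x then w else 1) * U $ k $ q else 0)"
    unfolding matrix_matrix_mult_def diagonal_phase_def vec_lambda_beta
    by (intro sum.cong refl) simp
  then show ?thesis by simp
qed

lemma unitary_diagonal_phase: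
  assumes "cmod w = 1"
  shows "unitary (diagonal_phase x w)"
proof (rule unitaryI)
  have "w * cnj w = 1"
    using assms by (simp add: complex_norm_square[symmetric])
  then show "diagonal_phase x w ** dagger (diagonal_phase x w) = mat 1"
    by (simp add: vec_eq_iff diagonal_phase_mult_nth) (simp add: diagonal_phase_def mat_def)
qed

definition plane_mixing :: "'n::finite \<Rightarrow> 'n \<Rightarrow> complex \<Rightarrow> 'n operator" where
  "plane_mixing x y w = (\<chi> p q.
     if p = x then (of_bool (q = x) + w * of_bool (q = y)) / sqrt 2
     else if p = y then (of_bool (q = x) - w * of_bool (q = y)) / sqrt 2
     else of_bool (p = q))"

lemma plane_mixing_mult_nth:
  assumes "x \<noteq> y"
  shows "(plane_mixing x y w ** U) $ p $ q =
    (if p = x then (U $ x $ q + w * U $ y $ q) / sqrt 2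
     else if p = y then (U $ x $ q - w * U $ y $ q) / sqrt 2
     else U $ p $ q)"
proof -
  have *: "(\<Sum>k\<in>UNIV. (\<alpha> * of_bool (k = x) + \<beta> * of_bool (k = y)) * U $ k $ q)
      = \<alpha> * U $ x $ q + \<beta> * U $ y $ q" for \<alpha> \<beta> :: complex
    by (simp add: distrib_right sum.distrib mult.assoc sum_distrib_left[symmetric] of_bool_def
        if_distrib[of "\<lambda>x. x * _"] cong: if_cong)
  have s: "(\<Sum>k\<in>UNIV. of_bool (p = k) * U $ k $ q) = U $ p $ q"
    by (simp add: of_bool_def if_distrib[of "\<lambda>x. x * _"] cong: if_cong)
  show ?thesis
    using *[of "1 / sqrt 2" "w / sqrt 2"] *[of "1 / sqrt 2" "- w / sqrt 2"] s assms
    by (simp add: matrix_matrix_mult_def plane_mixing_def add_divide_distrib diff_divide_distrib)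
qed

lemma unitary_plane_mixing:
  assumes "x \<noteq> y" "cmod w = 1"
  shows "unitary (plane_mixing x y w)"
proof (rule unitaryI)
  have "w * cnj w = 1"
    using assms by (simp add: complex_norm_square[symmetric])
  moreover have "complex_of_real (sqrt 2) * complex_of_real (sqrt 2) = 2"
    by (simp flip: of_real_mult)
  moreover from this have "2 / complex_of_real (sqrt 2) = complex_of_real (sqrt 2)"
    by (simp add: divide_eq_eq)
  ultimately show "plane_mixing x y w ** dagger (plane_mixing x y w) = mat 1"
    using assms(1)
    by (simp add: vec_eq_iff plane_mixing_mult_nth) (auto simp: plane_mixing_def mat_def)
qed

context haar
begin

lemma unitary_invariant:
  fixes f :: "'n operator \<Rightarrow> 'b::{banach, second_countable_topology}"
  assumes f: "continuous_on UNIV f" and V: "unitary V"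
    and phase: "\<And>w U. cmod w = 1 \<Longrightarrow> f (mat w ** U) = f U"
  shows "(LINT U|\<mu>. f (V ** U)) = (LINT U|\<mu>. f U)"
proof -
  obtain w W where "cmod w = 1" "W \<in> special_unitary" "V = mat w ** W"
    using unitary_phase_decomposition[OF V] .
  then show ?thesis
    using left_invariant[OF f, of W] by (simp add: matrix_mul_assoc[symmetric] phase)
qed

lemma unitary_right_invariant:
  fixes f :: "'n operator \<Rightarrow> 'b::{banach, second_countable_topology}"
  assumes f: "continuous_on UNIV f" and V: "unitary V"
    and phase: "\<And>w U. cmod w = 1 \<Longrightarrow> f (mat w ** U) = f U"
  shows "(LINT U|\<mu>. f (U ** V)) = (LINT U|\<mu>. f U)"
proof -
  obtain w W where W: "cmod w = 1" "W \<in> special_unitary" "V = mat w ** W"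
    using unitary_phase_decomposition[OF V] .
  \<comment> \<open>The scalar matrix is central, so the phase moves to the left, where
    \<open>phase\<close> removes it.\<close>
  have "U ** V = mat w ** (U ** W)" for U :: "'n operator"
    unfolding W(3) by (simp add: vec_eq_iff matrix_matrix_mult_def[of U] sum_distrib_left mult_ac)
  then show ?thesis
    using right_invariant[OF f, of W] W by (simp add: phase)
qed

end

section \<open>Moments of one column\<close>

definition entry_weight :: "'n::finite \<Rightarrow> 'n operator \<Rightarrow> 'n \<Rightarrow> real" where
  "entry_weight k U a = (cmod (U $ a $ k))\<^sup>2"

lemma continuous_on_entry_weight [continuous_intros]:
  "continuous_on S f \<Longrightarrow> continuous_on S (\<lambda>x. entry_weight k (f x) a)"
  unfolding entry_weight_def by (intro continuous_intros)

lemma entry_weight_phase [simp]: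
  "cmod w = 1 \<Longrightarrow> entry_weight k (mat w ** U) a = entry_weight k U a"
  by (simp add: entry_weight_def norm_mult)

lemma entry_weight_plane_mixing [simp]:
  "x \<noteq> y \<Longrightarrow> z \<noteq> x \<Longrightarrow> z \<noteq> y \<Longrightarrow>
    entry_weight k (plane_mixing x y w ** U) z = entry_weight k U z"
  by (simp add: entry_weight_def plane_mixing_mult_nth)

lemma sum_entry_weight:
  assumes "U \<in> special_unitary"
  shows "(\<Sum>a\<in>UNIV. entry_weight k U a) = 1"
proof -
  have "of_real (\<Sum>a\<in>UNIV. entry_weight k U a) = (\<Sum>a\<in>UNIV. cnj (U $ a $ k) * U $ a $ k)"
    unfolding entry_weight_def of_real_sum complex_norm_square by (simp add: mult.commute)
  also have "\<dots> = of_real 1"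
    using assms by (simp add: unitary_columns special_unitary_iff)
  finally show ?thesis
    using of_real_eq_iff by blast
qed

text \<open>With \<open>z = X cnj Y\<close>, the four squared moduli are \<open>p + q\<close> plus
  or minus \<open>2 Re z\<close> or \<open>2 Im z\<close>. Odd powers of the cross terms cancel, and
  up to the third power the rest enters only through \<open>(Re z)^2 + (Im z)^2 = p q\<close>; a
  fourth power would bring in further combinations.\<close>

lemma phase_average_power:
  fixes X Y :: complex
  defines "p \<equiv> (cmod X)\<^sup>2" and "q \<equiv> (cmod Y)\<^sup>2"
  defines "A \<equiv> \<lambda>m. (\<Sum>w\<in>{1, -1, \<i>, -\<i>}. ((cmod (X + w * Y))\<^sup>2 / 2) ^ m) / 4"
  shows "A 1 = (p + q) / 2"
    and "A 2 = (p\<^sup>2 + 4 * p * q + q\<^sup>2) / 4"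
    and "A 3 = (p ^ 3 + 9 * p\<^sup>2 * q + 9 * p * q\<^sup>2 + q ^ 3) / 8"
proof -
  define r t where "r = Re X * Re Y + Im X * Im Y" and "t = Im X * Re Y - Re X * Im Y"
  have pq: "r\<^sup>2 + t\<^sup>2 = p * q"
    unfolding p_def q_def r_def t_def cmod_power2 by algebra
  have "(cmod (X + 1 * Y))\<^sup>2 = p + q + 2 * r" "(cmod (X + (-1) * Y))\<^sup>2 = p + q - 2 * r"
    "(cmod (X + \<i> * Y))\<^sup>2 = p + q + 2 * t" "(cmod (X + (- \<i>) * Y))\<^sup>2 = p + q - 2 * t"
    unfolding p_def q_def r_def t_def cmod_power2 by (simp_all, algebra+)
  moreover have "(1::complex) \<noteq> -1" "(1::complex) \<noteq> \<i>" "(1::complex) \<noteq> -\<i>" "-1 \<noteq> \<i>" "-1 \<noteq> -\<i>" "\<i> \<noteq> -\<i>"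
    by (auto simp: complex_eq_iff)
  ultimately have A: "A m = (((p + q + 2 * r) / 2) ^ m + ((p + q - 2 * r) / 2) ^ m
      + ((p + q + 2 * t) / 2) ^ m + ((p + q - 2 * t) / 2) ^ m) / 4" for m
    unfolding A_def by (simp add: add.assoc)
  show "A 1 = (p + q) / 2"
    unfolding A by (simp add: field_simps)
  show "A 2 = (p\<^sup>2 + 4 * p * q + q\<^sup>2) / 4"
    using pq unfolding A power_divide by (simp add: field_simps) algebra
  show "A 3 = (p ^ 3 + 9 * p\<^sup>2 * q + 9 * p * q\<^sup>2 + q ^ 3) / 8"
    using pq unfolding A power_divide by (simp add: field_simps) algebra
qed

context haar
begin

text \<open>Mixing the rows \<open>x, y\<close> by a Hadamard rotation and averaging over four relative phases removes all
  cross terms, which relates the mixed moments to the pure ones.\<close>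

lemma plane_average:
  fixes h :: "'n operator \<Rightarrow> real" and k :: 'n
  assumes "x \<noteq> y" and h: "continuous_on UNIV h"
    and phase: "\<And>w U. cmod w = 1 \<Longrightarrow> h (mat w ** U) = h U"
    and mixing: "\<And>w U. h (plane_mixing x y w ** U) = h U"
  defines "A \<equiv> \<lambda>m. LINT U|\<mu>. (\<Sum>w\<in>{1, -1, \<i>, -\<i>}.
      ((cmod (U $ x $ k + w * U $ y $ k))\<^sup>2 / 2) ^ m) / 4 * h U"
  shows "(LINT U|\<mu>. entry_weight k U x ^ m * h U) = A m"
    and "(LINT U|\<mu>. entry_weight k U y ^ m * h U) = A m"
proof -
  let ?f = "\<lambda>w U. ((cmod (U $ x $ k + w * U $ y $ k))\<^sup>2 / 2) ^ m * h U"
  have int: "integrable \<mu> (?f w)" for w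
    by (intro integrable_continuous continuous_intros h) auto
  have "A m = (LINT U|\<mu>. (\<Sum>w\<in>{1, -1, \<i>, -\<i>}. ?f w U / 4))"
    unfolding A_def by (simp add: sum_distrib_right sum_divide_distrib)
  also have "\<dots> = (\<Sum>w\<in>{1, -1, \<i>, -\<i>}. LINT U|\<mu>. ?f w U / 4)"
    by (intro Bochner_Integration.integral_sum Bochner_Integration.integrable_divide int)
  finally have A: "A m = (\<Sum>w\<in>{1, -1, \<i>, -\<i>}. (LINT U|\<mu>. ?f w U) / 4)"
    by simp
  have card: "card {1, -1, \<i>, -\<i>} = 4"
    by (auto simp: complex_eq_iff card_insert_if)
  have inv: "(LINT U|\<mu>. entry_weight k (plane_mixing x y w ** U) a ^ m * h U)
      = (LINT U|\<mu>. entry_weight k U a ^ m * h U)" if "w \<in> {1, -1, \<i>, -\<i>}" for w a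
  proof -
    have "continuous_on UNIV (\<lambda>U. entry_weight k U a ^ m * h U)"
      by (intro continuous_intros h)
    moreover have "unitary (plane_mixing x y w)"
      using that \<open>x \<noteq> y\<close> by (intro unitary_plane_mixing) auto
    ultimately show ?thesis
      using unitary_invariant[of "\<lambda>U. entry_weight k U a ^ m * h U" "plane_mixing x y w"]
      by (simp add: mixing phase)
  qed
  have ew: "entry_weight k (plane_mixing x y w ** U) x = (cmod (U $ x $ k + w * U $ y $ k))\<^sup>2 / 2"
    "entry_weight k (plane_mixing x y w ** U) y = (cmod (U $ x $ k + (- w) * U $ y $ k))\<^sup>2 / 2" for w U
    using \<open>x \<noteq> y\<close> by (auto simp: entry_weight_def plane_mixing_mult_nth norm_divide power_divide)
  show "(LINT U|\<mu>. entry_weight k U x ^ m * h U) = A m"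
    unfolding A using inv[of _ x] card by (simp add: ew del: sum.insert)
  have "(LINT U|\<mu>. ?f w U) = (LINT U|\<mu>. entry_weight k U y ^ m * h U)" if "w \<in> {1, -1, \<i>, -\<i>}" for w
    using inv[of "- w" y] that by (auto simp: ew)
  then show "(LINT U|\<mu>. entry_weight k U y ^ m * h U) = A m"
    unfolding A using card by (simp del: sum.insert)
qed

lemma integrable_entry_weight [simp]:
  "integrable \<mu> (\<lambda>U. entry_weight k U a)"
  "integrable \<mu> (\<lambda>U. entry_weight k U a * entry_weight k U b)"
  "integrable \<mu> (\<lambda>U. entry_weight k U a * entry_weight k U b * entry_weight k U c)"
  by (intro integrable_continuous continuous_intros)+

text \<open>\<open>h\<close> is a spectator: in the uses it is constant or depends on other rows.
  The plane average with m = 1 gives equal means. With m = 2, inserting the equality of the two pure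
  moments into \<open>(p^2 + 4 p q + q^2) / 4\<close> leaves the pure moment equal to twice the
  mixed one.\<close>

lemma plane_average_consequences:
  fixes h :: "'n operator \<Rightarrow> real" and k :: 'n
  assumes xy: "x \<noteq> y" and h: "continuous_on UNIV h"
    and phase: "\<And>w U. cmod w = 1 \<Longrightarrow> h (mat w ** U) = h U"
    and mixing: "\<And>w U. h (plane_mixing x y w ** U) = h U"
  shows "(LINT U|\<mu>. entry_weight k U x * h U) = (LINT U|\<mu>. entry_weight k U y * h U)"
    and "(LINT U|\<mu>. (entry_weight k U x)\<^sup>2 * h U) = (LINT U|\<mu>. (entry_weight k U y)\<^sup>2 * h U)"
    and "(LINT U|\<mu>. (entry_weight k U x)\<^sup>2 * h U)
      = 2 * (LINT U|\<mu>. entry_weight k U x * entry_weight k U y * h U)"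
proof -
  note pa = plane_average[OF xy h phase mixing, where k = k]
  show "(LINT U|\<mu>. entry_weight k U x * h U) = (LINT U|\<mu>. entry_weight k U y * h U)"
    using pa[where m = 1] by simp
  show e: "(LINT U|\<mu>. (entry_weight k U x)\<^sup>2 * h U) = (LINT U|\<mu>. (entry_weight k U y)\<^sup>2 * h U)"
    using pa[where m = 2] by simp
  have int: "integrable \<mu> (\<lambda>U. (entry_weight k U x)\<^sup>2 * h U)"
    "integrable \<mu> (\<lambda>U. (entry_weight k U y)\<^sup>2 * h U)"
    "integrable \<mu> (\<lambda>U. entry_weight k U x * entry_weight k U y * h U)"
    by (intro integrable_continuous continuous_intros h)+
  have pt: "(\<Sum>w\<in>{1, -1, \<i>, -\<i>}. ((cmod (U $ x $ k + w * U $ y $ k))\<^sup>2 / 2)\<^sup>2) / 4 * h U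
      = ((entry_weight k U x)\<^sup>2 * h U) / 4 + entry_weight k U x * entry_weight k U y * h U
         + ((entry_weight k U y)\<^sup>2 * h U) / 4" for U
    unfolding phase_average_power(2) entry_weight_def[symmetric] by (simp add: field_simps)
  have "(LINT U|\<mu>. (entry_weight k U x)\<^sup>2 * h U) =
      (LINT U|\<mu>. ((entry_weight k U x)\<^sup>2 * h U) / 4 + entry_weight k U x * entry_weight k U y * h U
         + ((entry_weight k U y)\<^sup>2 * h U) / 4)"
    using pa(1)[where m = 2] by (simp only: pt)
  also have "\<dots> = (LINT U|\<mu>. (entry_weight k U x)\<^sup>2 * h U) / 4
      + (LINT U|\<mu>. entry_weight k U x * entry_weight k U y * h U)
      + (LINT U|\<mu>. (entry_weight k U y)\<^sup>2 * h U) / 4"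
    using int by simp
  finally show "(LINT U|\<mu>. (entry_weight k U x)\<^sup>2 * h U)
      = 2 * (LINT U|\<mu>. entry_weight k U x * entry_weight k U y * h U)"
    using e by simp
qed

text \<open>A column has norm 1, so summing out one weight lowers the degree. These linear equations
  fix the absolute size of the moments, of which the plane average only gives ratios.\<close>

lemma moment_marginal:
  fixes h :: "'n operator \<Rightarrow> real"
  assumes "continuous_on UNIV h"
  shows "(\<Sum>x\<in>UNIV. LINT U|\<mu>. h U * entry_weight k U x) = (LINT U|\<mu>. h U)"
proof -
  have "integrable \<mu> (\<lambda>U. h U * entry_weight k U x)" for x
    by (intro integrable_continuous continuous_intros assms)
  then have "(\<Sum>x\<in>UNIV. LINT U|\<mu>. h U * entry_weight k U x)
      = (LINT U|\<mu>. (\<Sum>x\<in>UNIV. h U * entry_weight k U x))"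
    by (simp add: Bochner_Integration.integral_sum)
  also have "\<dots> = (LINT U|\<mu>. h U)"
    by (intro Bochner_Integration.integral_cong) (auto simp: sum_entry_weight simp flip: sum_distrib_left)
  finally show ?thesis .
qed

lemma moment1: "(LINT U|\<mu>. entry_weight k U a) = 1 / CARD('n)"
proof -
  have "(LINT U|\<mu>. entry_weight k U x) = (LINT U|\<mu>. entry_weight k U a)" for x
    using plane_average_consequences(1)[of x a "\<lambda>_. 1" k] by (cases "x = a") auto
  then have "(\<Sum>x\<in>UNIV. LINT U|\<mu>. entry_weight k U x) = (\<Sum>x\<in>(UNIV::'n set). LINT U|\<mu>. entry_weight k U a)"
    by (intro sum.cong refl)
  moreover have "(\<Sum>x\<in>UNIV. LINT U|\<mu>. entry_weight k U x) = 1"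
    using moment_marginal[of "\<lambda>_. 1" k] prob_space by simp
  ultimately show ?thesis
    by (simp add: field_simps)
qed

lemma moment2:
  "(LINT U|\<mu>. entry_weight k U a * entry_weight k U b)
    = (1 + of_bool (a = b)) / (real CARD('n) * (CARD('n) + 1))"
proof -
  let ?n = "real CARD('n)" and ?m = "\<lambda>a b. LINT U|\<mu>. entry_weight k U a * entry_weight k U b"
  have off: "?m a b = ?m a a / 2" if "a \<noteq> b" for a b
    using plane_average_consequences(3)[of a b "\<lambda>_. 1" k] that by (simp add: power2_eq_square)
  have "?m a a = 2 / (?n * (?n + 1))" for a
  proof -
    have "1 / ?n = (\<Sum>b\<in>UNIV. ?m a b)"
      using moment_marginal[of "\<lambda>U. entry_weight k U a" k] moment1 by (simp add: continuous_intros)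
    also have "\<dots> = ?m a a + (\<Sum>b\<in>UNIV - {a}. ?m a b)"
      by (simp add: sum.remove)
    also have "(\<Sum>b\<in>UNIV - {a}. ?m a b) = (\<Sum>b\<in>UNIV - {a}. ?m a a / 2)"
      by (intro sum.cong refl off) auto
    also have "\<dots> = (?n - 1) * (?m a a / 2)"
      by (simp add: card_Diff_singleton of_nat_diff)
    finally have "?m a a * (?n * (?n + 1)) = 2"
      by (simp add: field_simps)
    moreover have "?n * (?n + 1) > 0"
      by (simp add: add_pos_pos)
    ultimately show ?thesis
      by (metis nonzero_eq_divide_eq less_irrefl)
  qed
  then show ?thesis
    using off[of a b] by (cases "a = b") simp_all
qed

text \<open>The weights of a Haar column are uniformly distributed on the simplex. The numerator is
  the order of the stabiliser of the triple (a, b, c) in the symmetric group: 6, 2 or 1.\<close>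

lemma moment3:
  assumes "CARD('n) \<ge> 2"
  shows "(LINT U|\<mu>. entry_weight k U a * entry_weight k U b * entry_weight k U c)
    = (1 + of_bool (a = b) + of_bool (b = c) + of_bool (a = c) + 2 * of_bool (a = b \<and> b = c))
      / (real CARD('n) * (CARD('n) + 1) * (CARD('n) + 2))"
proof -
  let ?n = "real CARD('n)"
  let ?m = "\<lambda>a b c. LINT U|\<mu>. entry_weight k U a * entry_weight k U b * entry_weight k U c"
  have n: "?n \<ge> 2" using assms by simp
  have sym: "?m a b c = ?m b a c" "?m a b c = ?m a c b" for a b c
    by (simp_all add: mult_ac)
  have marginal: "(\<Sum>c\<in>UNIV. ?m a b c) = (1 + of_bool (a = b)) / (?n * (?n + 1))" for a b
    using moment_marginal[of "\<lambda>U. entry_weight k U a * entry_weight k U b" k] moment2[of k a b]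
    by (simp add: continuous_intros)
  have third: "?m a a b = ?m a a b'" if "b \<noteq> a" "b' \<noteq> a" for a b b'
  proof -
    have c: "continuous_on UNIV (\<lambda>U. entry_weight k U a * entry_weight k U a)"
      by (intro continuous_intros)
    show ?thesis
      using plane_average_consequences(1)[OF _ c, of b b' k] that
      by (cases "b = b'") (simp_all add: mult_ac)
  qed
  have marginal': "?m a a a + (?n - 1) * ?m a a b = 2 / (?n * (?n + 1))" if "b \<noteq> a" for a b
  proof -
    have "(\<Sum>c\<in>UNIV - {a}. ?m a a c) = (\<Sum>c\<in>UNIV - {a}. ?m a a b)"
      by (intro sum.cong refl third) (use that in auto)
    also have "\<dots> = (?n - 1) * ?m a a b"
      by (simp add: card_Diff_singleton of_nat_diff)
    finally show ?thesis
      using marginal[of a a] by (simp add: sum.remove[of UNIV a])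
  qed
  have cube: "?m a a a = 3 * ?m a a b" if "a \<noteq> b" for a b
  proof -
    have p3: "entry_weight k U a ^ 3 = entry_weight k U a * entry_weight k U a * entry_weight k U a" for U a
      by (simp add: power3_eq_cube)
    have e: "?m a a a = ?m b b b"
      using plane_average[OF that, of "\<lambda>_. 1" k 3] by (simp add: p3)
    let ?w = "entry_weight k"
    have "(\<Sum>w\<in>{1, -1, \<i>, -\<i>}. ((cmod (U $ a $ k + w * U $ b $ k))\<^sup>2 / 2) ^ 3) / 4 * 1
      = (?w U a * ?w U a * ?w U a + 9 * (?w U a * ?w U a * ?w U b)
        + 9 * (?w U b * ?w U b * ?w U a) + ?w U b * ?w U b * ?w U b) / 8" for U
      unfolding phase_average_power(3) entry_weight_def[symmetric]
      by (simp add: power2_eq_square power3_eq_cube mult_ac)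
    then have "?m a a a = (LINT U|\<mu>. (?w U a * ?w U a * ?w U a + 9 * (?w U a * ?w U a * ?w U b)
        + 9 * (?w U b * ?w U b * ?w U a) + ?w U b * ?w U b * ?w U b) / 8)"
      using plane_average(1)[OF that, of "\<lambda>_. 1" k 3] by (simp only: p3 mult_1_right continuous_on_const)
    also have "\<dots> = (?m a a a + 9 * ?m a a b + 9 * ?m b b a + ?m b b b) / 8"
      by simp
    finally have "6 * ?m a a a = 9 * ?m a a b + 9 * ?m b b a"
      using e by simp
    \<comment> \<open>\<open>marginal'\<close> is used for \<open>a\<close> and for
      \<open>b\<close>: the pure moments agree, hence so do their complements.\<close>
    moreover have "(?n - 1) * ?m a a b = (?n - 1) * ?m b b a"
      using marginal'[OF that] marginal'[OF that[symmetric]] e by linarith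
    ultimately show ?thesis
      using n by simp
  qed
  have aab: "?m a a b = 2 / (?n * (?n + 1) * (?n + 2))" if "a \<noteq> b" for a b
  proof -
    have "?m a a b * (?n + 2) = 2 / (?n * (?n + 1))"
      using marginal'[of b a] cube[of a b] that by (simp add: algebra_simps)
    moreover have "?n + 2 \<noteq> 0"
      using n by simp
    ultimately have "?m a a b = 2 / (?n * (?n + 1)) / (?n + 2)"
      by (rule eq_divide_imp[rotated])
    then show ?thesis
      by (simp only: divide_divide_eq_left)
  qed
  have aaa: "?m a a a = 6 / (?n * (?n + 1) * (?n + 2))" for a
  proof -
    have "(UNIV :: 'n set) \<noteq> {a}"
    proof
      assume "(UNIV :: 'n set) = {a}"
      then have "CARD('n) = card {a}" by simp
      then show False using assms by simp
    qed
    then have "\<exists>b. b \<notin> {a}"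
      by (metis UNIV_eq_I)
    then obtain b where "a \<noteq> b" by fastforce
    then show ?thesis
      using cube[of a b] aab[of a b] by simp
  qed
  have abc: "?m a b c = 1 / (?n * (?n + 1) * (?n + 2))" if "a \<noteq> b" "b \<noteq> c" "a \<noteq> c" for a b c
  proof -
    have "continuous_on UNIV (\<lambda>U. entry_weight k U c)"
      by (intro continuous_intros)
    from plane_average_consequences(3)[OF _ this, of a b k] show ?thesis
      using aab[of a c] that by (simp add: power2_eq_square)
  qed
  consider "a = b" "b = c" | "a = b" "b \<noteq> c" | "a \<noteq> b" "b = c" | "a \<noteq> b" "a = c" | "a \<noteq> b" "b \<noteq> c" "a \<noteq> c"
    by blast
  then show ?thesis
  proof cases
    case 1
    then show ?thesis using aaa[of a] by (simp add: add.commute)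
  next
    case 2
    then show ?thesis using aab[of a c] by (simp add: add.commute)
  next
    case 3
    have "?m a b b = ?m b b a"
      by (simp only: sym(1)[of a b b] sym(2)[of b a b])
    then show ?thesis using aab[of b a] 3 by (simp add: add.commute)
  next
    case 4
    have "?m a b a = ?m a a b"
      by (simp only: sym(2)[of a b a])
    then show ?thesis using aab[of a b] 4 by (simp add: add.commute)
  next
    case 5
    then show ?thesis using abc[of a b c] by (simp add: add.commute)
  qed
qed

end

section \<open>Moments of complex entries, matched by multisets of row indices\<close>

lemma exists_phase_minus_one:
  assumes "m \<noteq> (n::nat)"
  obtains w where "cmod w = 1" "w ^ m * cnj w ^ n = -1"
proof
  let ?t = "pi / (real m - real n)"
  have "cis ?t ^ m * cnj (cis ?t) ^ n = cis (m * ?t + n * (- ?t))"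
    by (simp add: Complex.DeMoivre cis_cnj cis_mult)
  also have "m * ?t + n * (- ?t) = (real m - real n) * ?t"
    by (simp only: left_diff_distrib)
  also have "\<dots> = pi"
    using assms by simp
  finally show "cis ?t ^ m * cnj (cis ?t) ^ n = -1"
    by simp
qed simp

lemma continuous_on_prod_mset:
  fixes f :: "'a::topological_space \<Rightarrow> 'b \<Rightarrow> 'c::real_normed_field"
  assumes "\<And>x. continuous_on S (\<lambda>y. f y x)"
  shows "continuous_on S (\<lambda>y. \<Prod>x\<in>#A. f y x)"
  by (induction A) (auto intro!: continuous_intros assms)

lemma prod_mset_distinguished:
  "(\<Prod>x\<in>#A. if x = a then w else 1) = w ^ count A a" for w :: "'a::comm_monoid_mult"
  by (induction A) auto

lemma mset_pair_eq_iff: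
  "{#a, b#} = {#a', b'#} \<longleftrightarrow> a = a' \<and> b = b' \<or> a = b' \<and> b = a'" (is "?L \<longleftrightarrow> ?R")
proof
  show "?L \<Longrightarrow> ?R" by (auto simp: add_eq_conv_diff)
  show "?R \<Longrightarrow> ?L" by (elim disjE conjE; hypsubst; simp add: add_mset_commute)
qed

lemma mset_triple_eq_iff:
  "{#a, b, c#} = {#a', b', c'#} \<longleftrightarrow> a = a' \<and> b = b' \<and> c = c' \<or> a = b' \<and> b = a' \<and> c = c'
     \<or> a = a' \<and> b = c' \<and> c = b' \<or> a = c' \<and> b = b' \<and> c = a'
     \<or> a = b' \<and> b = c' \<and> c = a' \<or> a = c' \<and> b = a' \<and> c = b'" (is "?L \<longleftrightarrow> ?R")
proof
  show "?L \<Longrightarrow> ?R"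
    by (cases "a = a'"; cases "a = b'"; cases "a = c'"; auto simp: add_eq_conv_diff)
  show "?R \<Longrightarrow> ?L" by (elim disjE conjE; hypsubst; simp add: add_mset_commute)
qed

text \<open>The permutations carrying one triple to the other form a coset of the stabiliser, whose
  order is the numerator in \<open>moment3\<close>.\<close>

lemma number_of_triple_matchings:
  assumes "{#a, b, c#} = {#a', b', c'#}"
  shows "of_bool (a = a' \<and> b = b' \<and> c = c') + of_bool (a = b' \<and> b = a' \<and> c = c')
     + of_bool (a = a' \<and> b = c' \<and> c = b') + of_bool (a = c' \<and> b = b' \<and> c = a')
     + of_bool (a = b' \<and> b = c' \<and> c = a') + of_bool (a = c' \<and> b = a' \<and> c = b')
   = (1 + of_bool (a = b) + of_bool (b = c) + of_bool (a = c) + 2 * of_bool (a = b \<and> b = c) :: complex)"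
proof -
  have "\<exists>x y z. a' = x \<and> b' = y \<and> c' = z \<and>
      (x, y, z) \<in> {(a, b, c), (b, a, c), (a, c, b), (c, b, a), (c, a, b), (b, c, a)}"
    using assms unfolding mset_triple_eq_iff by blast
  then show ?thesis
    apply (elim exE conjE insertE emptyE)
    apply (simp_all only: prod.inject)
    apply (simp_all only: simp_thms eq_commute[of b a] eq_commute[of c a] eq_commute[of c b])
    apply (cases "a = b"; cases "b = c"; cases "a = c"; simp)+
    done
qed

context haar
begin

text \<open>Some row index occurs with different multiplicities in A and B, and multiplying that row
  by a suitable phase turns the integrand into its negative. Equal sizes make the integrand
  insensitive to a global phase, so that this diagonal unitary leaves the integral
  unchanged.\<close>

lemma moment_unbalanced:
  assumes "size A = size B" "A \<noteq> B"
  shows "(LINT U|\<mu>. (\<Prod>x\<in>#A. U $ x $ k) * (\<Prod>x\<in>#B. cnj (U $ x $ k))) = 0"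
proof -
  let ?f = "\<lambda>U :: 'n operator. (\<Prod>x\<in>#A. U $ x $ k) * (\<Prod>x\<in>#B. cnj (U $ x $ k))"
  obtain a where "count A a \<noteq> count B a"
    using assms(2) by (auto simp: multiset_eq_iff)
  then obtain w where w: "cmod w = 1" "w ^ count A a * cnj w ^ count B a = -1"
    using exists_phase_minus_one by blast
  have cont: "continuous_on UNIV ?f"
    by (intro continuous_intros continuous_on_prod_mset)
  have phase: "?f (mat z ** U) = ?f U" if "cmod z = 1" for z U
  proof -
    have "?f (mat z ** U) = (z * cnj z) ^ size B * ?f U"
      using assms(1) by (simp add: prod_mset.distrib prod_mset_constant power_mult_distrib mult_ac)
    also have "z * cnj z = 1"
      using that by (simp add: complex_norm_square[symmetric])
    finally show ?thesis by simp
  qed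
  have "cnj (if x = a then w else 1) = (if x = a then cnj w else 1)" for x
    by simp
  then have "?f (diagonal_phase a w ** U) = (w ^ count A a * cnj w ^ count B a) * ?f U" for U
    by (simp add: diagonal_phase_mult_nth prod_mset.distrib prod_mset_distinguished mult_ac
        del: if_cancel cong del: if_weak_cong)
  then have "(LINT U|\<mu>. ?f (diagonal_phase a w ** U)) = - (LINT U|\<mu>. ?f U)"
    using w(2) by simp
  then show ?thesis
    using unitary_invariant[OF cont unitary_diagonal_phase[OF w(1), of a] phase] by simp
qed

lemma moment_balanced:
  assumes "A = B"
  shows "(LINT U|\<mu>. (\<Prod>x\<in>#A. U $ x $ k) * (\<Prod>x\<in>#B. cnj (U $ x $ k)))
    = of_real (LINT U|\<mu>. (\<Prod>x\<in>#A. entry_weight k U x))"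
proof -
  have "(\<Prod>x\<in>#A. U $ x $ k) * (\<Prod>x\<in>#A. cnj (U $ x $ k)) = of_real (\<Prod>x\<in>#A. entry_weight k U x)" for U
  proof (induction A)
    case (add x A)
    have "U $ x $ k * cnj (U $ x $ k) = of_real (entry_weight k U x)"
      by (simp only: entry_weight_def complex_norm_square)
    then show ?case
      using add by (simp add: mult_ac)
  qed simp
  then show ?thesis
    using assms by simp
qed

lemma moment1_entries:
  "(LINT U|\<mu>. U $ a $ k * cnj (U $ a' $ k)) = of_bool (a = a') / of_nat CARD('n)"
proof (cases "a = a'")
  case True
  then show ?thesis
    using moment_balanced[of "{#a#}" "{#a'#}" k] moment1[of k a] by simp
next
  case False
  then show ?thesis
    using moment_unbalanced[of "{#a#}" "{#a'#}" k] by simp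
qed

lemma moment2_entries:
  "(LINT U|\<mu>. U $ a $ k * U $ b $ k * (cnj (U $ a' $ k) * cnj (U $ b' $ k)))
    = (of_bool (a = a' \<and> b = b') + of_bool (a = b' \<and> b = a')) / (of_nat CARD('n) * (of_nat CARD('n) + 1))"
  (is "?I = ?num / _")
proof (cases "{#a, b#} = {#a', b'#}")
  case False
  then have "\<not> (a = a' \<and> b = b')" "\<not> (a = b' \<and> b = a')"
    using mset_pair_eq_iff[of a b a' b'] by argo+
  then have "?num = 0"
    by (simp only: of_bool_eq add_0_left)
  moreover have "?I = 0"
    using moment_unbalanced[OF _ False, of k] by simp
  ultimately show ?thesis
    by (simp only: div_0)
next
  case True
  then have num: "?num = complex_of_real (1 + of_bool (a = b))"
    unfolding mset_pair_eq_iff by (cases "a = b"; elim disjE conjE; hypsubst; simp)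
  have "?I = of_real (LINT U|\<mu>. entry_weight k U a * entry_weight k U b)"
    using moment_balanced[OF True, of k] by simp
  also have "\<dots> = complex_of_real (1 + of_bool (a = b)) / (of_nat CARD('n) * (of_nat CARD('n) + 1))"
    unfolding moment2 by simp
  finally show ?thesis
    unfolding num .
qed

lemma moment3_entries:
  assumes "CARD('n) \<ge> 2"
  shows "(LINT U|\<mu>. U $ a $ k * (U $ b $ k * U $ c $ k) * (cnj (U $ a' $ k) * (cnj (U $ b' $ k) * cnj (U $ c' $ k))))
    = (of_bool (a = a' \<and> b = b' \<and> c = c') + of_bool (a = b' \<and> b = a' \<and> c = c')
     + of_bool (a = a' \<and> b = c' \<and> c = b') + of_bool (a = c' \<and> b = b' \<and> c = a')
     + of_bool (a = b' \<and> b = c' \<and> c = a') + of_bool (a = c' \<and> b = a' \<and> c = b'))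
     / (of_nat CARD('n) * (of_nat CARD('n) + 1) * (of_nat CARD('n) + 2))"
  (is "?I = ?num / _")
proof (cases "{#a, b, c#} = {#a', b', c'#}")
  case False
  then have "\<not> (a = a' \<and> b = b' \<and> c = c')" "\<not> (a = b' \<and> b = a' \<and> c = c')"
    "\<not> (a = a' \<and> b = c' \<and> c = b')" "\<not> (a = c' \<and> b = b' \<and> c = a')"
    "\<not> (a = b' \<and> b = c' \<and> c = a')" "\<not> (a = c' \<and> b = a' \<and> c = b')"
    using mset_triple_eq_iff[of a b c a' b' c'] by argo+
  then have "?num = 0"
    by (simp only: of_bool_eq add_0_left)
  moreover have "?I = 0"
    using moment_unbalanced[OF _ False, of k] by simp
  ultimately show ?thesis
    by (simp only: div_0)
next
  case True
  have num: "?num = complex_of_real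
      (1 + of_bool (a = b) + of_bool (b = c) + of_bool (a = c) + 2 * of_bool (a = b \<and> b = c))"
    unfolding number_of_triple_matchings[OF True] by simp
  have "?I = of_real (LINT U|\<mu>. entry_weight k U a * entry_weight k U b * entry_weight k U c)"
    using moment_balanced[OF True, of k] by (simp add: mult.assoc)
  also have "\<dots> = complex_of_real
      (1 + of_bool (a = b) + of_bool (b = c) + of_bool (a = c) + 2 * of_bool (a = b \<and> b = c))
      / (of_nat CARD('n) * (of_nat CARD('n) + 1) * (of_nat CARD('n) + 2))"
    unfolding moment3[OF assms] by (simp add: add.commute)
  finally show ?thesis
    unfolding num .
qed

end

section \<open>Averages of the outcome projectors\<close>

text \<open>The vector whose projector is \<open>(E\<^sub>i \<otimes> E\<^sub>j)\<^sup>T \<otimes> E\<^sub>k\<close> for the measurement defined by \<open>U\<close>.\<close>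

definition outcome_vector :: "'n::finite operator \<Rightarrow> 'n \<Rightarrow> 'n \<Rightarrow> 'n \<Rightarrow> complex ^ ('n \<times> 'n \<times> 'n)" where
  "outcome_vector U i j k = (\<chi> p. cnj (U $ fst p $ i) * cnj (U $ fst (snd p) $ j) * U $ snd (snd p) $ k)"

lemma outcome_vector_nth [simp]:
  "outcome_vector U i j k $ (a, b, c) = cnj (U $ a $ i) * cnj (U $ b $ j) * U $ c $ k"
  by (simp add: outcome_vector_def)

lemma continuous_on_outcome_vector [continuous_intros]:
  "continuous_on S f \<Longrightarrow> continuous_on S (\<lambda>x. outcome_vector (f x) i j k $ p)"
  unfolding outcome_vector_def by (simp add: continuous_intros)

text \<open>The commutant of \<open>U\<^sup>* \<otimes> U\<^sup>* \<otimes> U\<close> is spanned by the permutation operators of three systems,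
  partially transposed on the third one.\<close>

definition invariant_op :: "real \<Rightarrow> real \<Rightarrow> real \<Rightarrow> real \<Rightarrow> real \<Rightarrow> real \<Rightarrow> ('n::finite \<times> 'n \<times> 'n) operator" where
  "invariant_op x1 x2 x3 x4 x5 x6 = (\<chi> p q. case (p, q) of ((a, b, c), (a', b', c')) \<Rightarrow>
     of_real x1 * of_bool (a = a' \<and> b = b' \<and> c = c') + of_real x2 * of_bool (a = b' \<and> b = a' \<and> c = c')
   + of_real x3 * of_bool (a = c \<and> a' = c' \<and> b = b') + of_real x4 * of_bool (b = c \<and> b' = c' \<and> a = a')
   + of_real x5 * of_bool (a = c \<and> b' = c' \<and> b = a') + of_real x6 * of_bool (b = c \<and> a' = c' \<and> a = b'))"

lemma invariant_op_nth:
  "invariant_op x1 x2 x3 x4 x5 x6 $ (a, b, c) $ (a', b', c') =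
     of_real x1 * of_bool (a = a' \<and> b = b' \<and> c = c') + of_real x2 * of_bool (a = b' \<and> b = a' \<and> c = c')
   + of_real x3 * of_bool (a = c \<and> a' = c' \<and> b = b') + of_real x4 * of_bool (b = c \<and> b' = c' \<and> a = a')
   + of_real x5 * of_bool (a = c \<and> b' = c' \<and> b = a') + of_real x6 * of_bool (b = c \<and> a' = c' \<and> a = b')"
  by (simp add: invariant_op_def)

section \<open>Relabelling of columns and marginals over one outcome\<close>

definition permutation_matrix :: "('n \<Rightarrow> 'n) \<Rightarrow> 'n::finite operator" where
  "permutation_matrix \<pi> = (\<chi> a b. of_bool (a = \<pi> b))"

lemma mult_permutation_matrix_nth:
  "(U ** permutation_matrix \<pi>) $ a $ i = U $ a $ \<pi> i"
proof -
  have "(U ** permutation_matrix \<pi>) $ a $ i = (\<Sum>k\<in>UNIV. if k = \<pi> i then U $ a $ k else 0)"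
    unfolding matrix_matrix_mult_def by (auto simp: permutation_matrix_def intro!: sum.cong)
  then show ?thesis by simp
qed

lemma unitary_permutation_matrix:
  assumes "inj \<pi>"
  shows "unitary (permutation_matrix \<pi>)"
proof -
  have "dagger (permutation_matrix \<pi>) ** permutation_matrix \<pi> = mat 1"
    using assms
    by (simp add: vec_eq_iff mult_permutation_matrix_nth)
      (auto simp: permutation_matrix_def mat_def inj_eq)
  then show ?thesis
    by (simp add: unitary_def matrix_left_right_inverse)
qed

context haar
begin

definition outcome_op :: "'n \<Rightarrow> 'n \<Rightarrow> 'n \<Rightarrow> ('n \<times> 'n \<times> 'n) operator" where
  "outcome_op i j k = (\<chi> p q. LINT U|\<mu>. outcome_vector U i j k $ p * cnj (outcome_vector U i j k $ q))"

text \<open>A permutation matrix can have determinant -1; invariance under global phases covers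
  this.\<close>

lemma column_permutation_invariant:
  fixes f :: "'n operator \<Rightarrow> complex"
  assumes "continuous_on UNIV f" "inj \<pi>" "\<And>w U. cmod w = 1 \<Longrightarrow> f (mat w ** U) = f U"
  shows "(LINT U|\<mu>. f (\<chi> a i. U $ a $ \<pi> i)) = (LINT U|\<mu>. f U)"
proof -
  have "(\<chi> a i. U $ a $ \<pi> i) = U ** permutation_matrix \<pi>" for U :: "'n operator"
    by (simp add: vec_eq_iff mult_permutation_matrix_nth)
  then show ?thesis
    using unitary_right_invariant[OF assms(1) unitary_permutation_matrix[OF assms(2)] assms(3)] by simp
qed

lemma outcome_op_permute:
  assumes "inj \<pi>"
  shows "outcome_op (\<pi> i) (\<pi> j) (\<pi> k) = outcome_op i j k"
proof -
  have phase: "w * cnj w = 1" if "cmod w = 1" for w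
    using that by (simp add: complex_norm_square[symmetric])
  have "(LINT U|\<mu>. outcome_vector U (\<pi> i) (\<pi> j) (\<pi> k) $ p * cnj (outcome_vector U (\<pi> i) (\<pi> j) (\<pi> k) $ q))
      = (LINT U|\<mu>. outcome_vector U i j k $ p * cnj (outcome_vector U i j k $ q))" for p q
  proof -
    let ?f = "\<lambda>U. outcome_vector U i j k $ p * cnj (outcome_vector U i j k $ q)"
    have "continuous_on UNIV ?f"
      by (intro continuous_intros)
    moreover have "?f (mat w ** U) = ?f U" if "cmod w = 1" for w U
      using phase[OF that] unfolding outcome_vector_def
      by (simp only: mat_mult_nth vec_lambda_beta complex_cnj_mult complex_cnj_cnj) algebra
    ultimately show ?thesis
      using column_permutation_invariant[of ?f, OF _ assms] by (simp add: outcome_vector_def)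
  qed
  then show ?thesis
    by (simp add: outcome_op_def)
qed

text \<open>Up to a Kronecker symbol, this is what \<open>outcome_op\<close> becomes when one of its
  three columns is summed out by completeness.\<close>

definition pair_moment :: "'n \<Rightarrow> 'n \<Rightarrow> 'n \<Rightarrow> 'n \<Rightarrow> 'n \<Rightarrow> 'n \<Rightarrow> complex" where
  "pair_moment j k a a' b b' = (LINT U|\<mu>. U $ a $ j * cnj (U $ a' $ j) * (U $ b $ k * cnj (U $ b' $ k)))"

lemma pair_moment_permute:
  assumes "inj \<pi>"
  shows "pair_moment (\<pi> j) (\<pi> k) a a' b b' = pair_moment j k a a' b b'"
proof -
  have phase: "w * cnj w = 1" if "cmod w = 1" for w
    using that by (simp add: complex_norm_square[symmetric])
  let ?f = "\<lambda>U :: 'n operator. U $ a $ j * cnj (U $ a' $ j) * (U $ b $ k * cnj (U $ b' $ k))"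
  have "continuous_on UNIV ?f"
    by (intro continuous_intros)
  moreover have "?f (mat w ** U) = ?f U" if "cmod w = 1" for w U
    using phase[OF that]
      by (simp only: mat_mult_nth complex_cnj_mult complex_cnj_cnj) algebra
  ultimately show ?thesis
    using column_permutation_invariant[of ?f, OF _ assms] by (simp add: pair_moment_def)
qed

lemma sum_over_rows:
  fixes h :: "'n operator \<Rightarrow> complex"
  assumes h: "continuous_on UNIV h"
  shows "(\<Sum>k\<in>UNIV. LINT U|\<mu>. h U * (U $ a $ k * cnj (U $ b $ k))) = of_bool (a = b) * (LINT U|\<mu>. h U)"
proof -
  have "integrable \<mu> (\<lambda>U. h U * (U $ a $ k * cnj (U $ b $ k)))" for k
    by (intro integrable_continuous continuous_intros h)
  then have "(\<Sum>k\<in>UNIV. LINT U|\<mu>. h U * (U $ a $ k * cnj (U $ b $ k)))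
      = (LINT U|\<mu>. (\<Sum>k\<in>UNIV. h U * (U $ a $ k * cnj (U $ b $ k))))"
    by (simp add: Bochner_Integration.integral_sum)
  also have "\<dots> = (LINT U|\<mu>. of_bool (a = b) * h U)"
    by (intro Bochner_Integration.integral_cong refl)
      (simp add: unitary_rows special_unitary_iff flip: sum_distrib_left)
  finally show ?thesis by simp
qed

lemma sum_outcome_op_1:
  "(\<Sum>i\<in>UNIV. outcome_op i j k $ (a, b, c) $ (a', b', c')) = of_bool (a = a') * pair_moment j k b' b c c'"
proof -
  let ?h = "\<lambda>U :: 'n operator. U $ b' $ j * cnj (U $ b $ j) * (U $ c $ k * cnj (U $ c' $ k))"
  have "continuous_on UNIV ?h"
    by (intro continuous_intros)
  from sum_over_rows[OF this, of a' a] show ?thesis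
    by (simp add: outcome_op_def pair_moment_def mult_ac eq_commute)
qed

lemma sum_outcome_op_2:
  "(\<Sum>j\<in>UNIV. outcome_op i j k $ (a, b, c) $ (a', b', c')) = of_bool (b = b') * pair_moment i k a' a c c'"
proof -
  let ?h = "\<lambda>U :: 'n operator. U $ a' $ i * cnj (U $ a $ i) * (U $ c $ k * cnj (U $ c' $ k))"
  have "continuous_on UNIV ?h"
    by (intro continuous_intros)
  from sum_over_rows[OF this, of b' b] show ?thesis
    by (simp add: outcome_op_def pair_moment_def mult_ac eq_commute)
qed

lemma sum_outcome_op_3:
  "(\<Sum>k\<in>UNIV. outcome_op i j k $ (a, b, c) $ (a', b', c')) = of_bool (c = c') * pair_moment i j a' a b' b"
proof -
  let ?h = "\<lambda>U :: 'n operator. U $ a' $ i * cnj (U $ a $ i) * (U $ b' $ j * cnj (U $ b $ j))"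
  have "continuous_on UNIV ?h"
    by (intro continuous_intros)
  from sum_over_rows[OF this, of c c'] show ?thesis
    by (simp add: outcome_op_def pair_moment_def mult_ac)
qed

lemma sum_pair_moment:
  "(\<Sum>k\<in>UNIV. pair_moment j k a a' b b') = of_bool (b = b') * (of_bool (a = a') / of_nat CARD('n))"
proof -
  have "continuous_on UNIV (\<lambda>U :: 'n operator. U $ a $ j * cnj (U $ a' $ j))"
    by (intro continuous_intros)
  from sum_over_rows[OF this] show ?thesis
    by (simp add: pair_moment_def moment1_entries)
qed

lemma pair_moment_same:
  "pair_moment k k a a' b b' = (of_bool (a = a' \<and> b = b') + of_bool (a = b' \<and> b = a')) / (of_nat CARD('n) * (of_nat CARD('n) + 1))"
proof -
  have "pair_moment k k a a' b b' = (LINT U|\<mu>. U $ a $ k * U $ b $ k * (cnj (U $ a' $ k) * cnj (U $ b' $ k)))"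
    unfolding pair_moment_def by (intro Bochner_Integration.integral_cong refl) (simp only: mult_ac)
  then show ?thesis
    unfolding moment2_entries by simp
qed

end

section \<open>Outcome averages by coincidence pattern\<close>

lemma sum_eq_except_one:
  fixes f :: "'n::finite \<Rightarrow> 'b::real_vector"
  assumes "\<And>x. x \<noteq> i \<Longrightarrow> f x = y"
  shows "(\<Sum>x\<in>UNIV. f x) = f i + (real CARD('n) - 1) *\<^sub>R y"
proof -
  have "(\<Sum>x\<in>UNIV. f x) = f i + (\<Sum>x\<in>UNIV - {i}. f x)"
    by (simp add: sum.remove)
  also have "(\<Sum>x\<in>UNIV - {i}. f x) = (\<Sum>x\<in>UNIV - {i}. y)"
    by (intro sum.cong refl assms) auto
  finally show ?thesis
    by (simp add: sum_constant_scaleR card_Diff_singleton of_nat_diff)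
qed

lemma sum_eq_except_two:
  fixes f :: "'n::finite \<Rightarrow> 'b::real_vector"
  assumes "i \<noteq> j" "\<And>x. x \<noteq> i \<Longrightarrow> x \<noteq> j \<Longrightarrow> f x = y"
  shows "(\<Sum>x\<in>UNIV. f x) = f i + f j + (real CARD('n) - 2) *\<^sub>R y"
proof -
  have "(\<Sum>x\<in>UNIV. f x) = f i + (f j + (\<Sum>x\<in>UNIV - {i} - {j}. f x))"
    using assms(1) by (simp add: sum.remove[of UNIV i] sum.remove[of "UNIV - {i}" j])
  also have "(\<Sum>x\<in>UNIV - {i} - {j}. f x) = (\<Sum>x\<in>UNIV - {i} - {j}. y)"
    by (intro sum.cong refl assms) auto
  also have "\<dots> = real (CARD('n) - 2) *\<^sub>R y"
    using assms(1) by (simp add: sum_constant_scaleR card_Diff_singleton card_Diff_subset numeral_2_eq_2)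
  also have "real (CARD('n) - 2) = real CARD('n) - 2"
    using card_mono[of UNIV "{i, j}"] assms(1) by (subst of_nat_diff) auto
  finally show ?thesis by simp
qed

lemmas sum_eq_except_complex =
  sum_eq_except_one[where 'b = complex, unfolded scaleR_conv_of_real of_real_diff of_real_of_nat_eq of_real_1]
  sum_eq_except_two[where 'b = complex, unfolded scaleR_conv_of_real of_real_diff of_real_of_nat_eq of_real_numeral]

text \<open>\<open>d (d + 1) (d + 2)\<close> normalises the third moments of one column, and
  \<open>d - 1\<close> counts the values left for an outcome once one is excluded.\<close>

definition moment_scale :: "real \<Rightarrow> real" where
  "moment_scale d = 1 / ((d - 1) * d * (d + 1) * (d + 2))"

text \<open>\<open>T\<close> is an entry for three equal outcomes and \<open>Y\<close> the same
  entry with one outcome changed. Summing over that outcome counts \<open>Y\<close> with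
  multiplicity \<open>N - 1\<close> and yields a second moment of one column, \<open>u\<close> being
  its two matching patterns.\<close>

lemma solve_marginal_equation:
  fixes x1 x2 x3 x4 x5 x6 Y T :: complex
  assumes "N \<ge> 2"
    and "T = (x1 + x2 + x3 + x4 + x5 + x6) / (of_nat N * (of_nat N + 1) * (of_nat N + 2))"
    and "T + (of_nat N - 1) * Y = u / (of_nat N * (of_nat N + 1))"
  shows "Y = of_real (moment_scale N) * ((of_nat N + 2) * u - (x1 + x2 + x3 + x4 + x5 + x6))"
proof -
  have nz: "of_nat N \<noteq> (0::complex)" "of_nat N - 1 \<noteq> (0::complex)" "of_nat N + 1 \<noteq> (0::complex)" "of_nat N + 2 \<noteq> (0::complex)"
    using assms(1) by (auto simp: complex_eq_iff)
  define n :: complex where "n = of_nat N"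
  have "(n - 1) * Y = u / (n * (n + 1)) - (x1 + x2 + x3 + x4 + x5 + x6) / (n * (n + 1) * (n + 2))"
    using assms(2,3) unfolding n_def by (simp add: eq_diff_eq add.commute)
  also have "\<dots> = ((n + 2) * u - (x1 + x2 + x3 + x4 + x5 + x6)) / (n * (n + 1) * (n + 2))"
    using nz unfolding n_def[symmetric] by (simp add: diff_divide_distrib)
  finally have "Y = ((n + 2) * u - (x1 + x2 + x3 + x4 + x5 + x6)) / (n * (n + 1) * (n + 2)) / (n - 1)"
    using nz unfolding n_def[symmetric] by (simp add: eq_divide_eq mult_ac)
  moreover have "complex_of_real (moment_scale N) = 1 / ((n - 1) * n * (n + 1) * (n + 2))"
    by (simp add: moment_scale_def n_def)
  ultimately show ?thesis
    unfolding n_def[symmetric] by (simp add: mult_ac)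
qed

lemma of_bool_mult_quotient:
  "of_bool P * ((of_bool Q + of_bool R) / (m :: complex)) = (of_bool (P \<and> Q) + of_bool (P \<and> R)) / m"
  by (cases P) simp_all

lemma operator_eqI:
  fixes X Y :: "('a::finite \<times> 'a \<times> 'a) operator"
  assumes "\<And>a b c a' b' c'. X $ (a, b, c) $ (a', b', c') = Y $ (a, b, c) $ (a', b', c')"
  shows "X = Y"
  using assms by (simp add: vec_eq_iff split_paired_all)

locale haar_ge_2 = haar \<mu> for \<mu> :: "'n::finite operator measure" +
  assumes card_ge_2: "CARD('n) \<ge> 2"
begin

lemma pair_moment_distinct:
  assumes "j \<noteq> k"
  shows "pair_moment j k a a' b b' = (of_nat CARD('n) * of_bool (a = a' \<and> b = b') - of_bool (a = b' \<and> b = a'))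
    / (of_nat CARD('n) * (of_nat CARD('n) + 1) * (of_nat CARD('n) - 1))"
proof -
  define n :: complex where "n = of_nat CARD('n)"
  have nz: "n \<noteq> 0" "n - 1 \<noteq> 0" "n + 1 \<noteq> 0"
    using card_ge_2 by (auto simp: complex_eq_iff n_def)
  have "pair_moment j x a a' b b' = pair_moment j k a a' b b'" if "x \<noteq> j" for x
    using pair_moment_permute[of "Transposition.transpose x k" j k] that assms
    by (simp add: transpose_def)
  then have "(\<Sum>x\<in>UNIV. pair_moment j x a a' b b') = pair_moment j j a a' b b' + (n - 1) * pair_moment j k a a' b b'"
    unfolding n_def by (rule sum_eq_except_complex(1)[of j "\<lambda>x. pair_moment j x a a' b b'"])
  moreover have "of_bool (b = b') * (of_bool (a = a') / n) = of_bool (a = a' \<and> b = b') / n"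
    by (simp add: of_bool_conj)
  ultimately have "of_bool (a = a' \<and> b = b') / n = (of_bool (a = a' \<and> b = b') + of_bool (a = b' \<and> b = a')) / (n * (n + 1)) + (n - 1) * pair_moment j k a a' b b'"
    unfolding sum_pair_moment pair_moment_same n_def[symmetric] by simp
  moreover have "Y = (n * x - y) / (n * (n + 1) * (n - 1))" if "x / n = (x + y) / (n * (n + 1)) + (n - 1) * Y" for x y Y
  proof -
    have "(n - 1) * Y = x / n - (x + y) / (n * (n + 1))"
      using that by simp
    also have "x / n = (n + 1) * x / (n * (n + 1))"
      using nz by simp
    also have "(n + 1) * x / (n * (n + 1)) - (x + y) / (n * (n + 1)) = (n * x - y) / (n * (n + 1))"
      by (simp add: algebra_simps flip: diff_divide_distrib)
    finally show ?thesis
      using nz by (simp add: eq_divide_eq mult_ac)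
  qed
  ultimately show ?thesis
    unfolding n_def[symmetric] by blast
qed

lemma outcome_op_same_nth:
  "outcome_op k k k $ (a, b, c) $ (a', b', c') =
    (of_bool (a = a' \<and> b = b' \<and> c = c') + of_bool (a = b' \<and> b = a' \<and> c = c')
   + of_bool (a = c \<and> a' = c' \<and> b = b') + of_bool (b = c \<and> b' = c' \<and> a = a')
   + of_bool (a = c \<and> b' = c' \<and> b = a') + of_bool (b = c \<and> a' = c' \<and> a = b'))
     / (of_nat CARD('n) * (of_nat CARD('n) + 1) * (of_nat CARD('n) + 2))"
proof -
  have "outcome_op k k k $ (a, b, c) $ (a', b', c') =
     (LINT U|\<mu>. U $ c $ k * (U $ a' $ k * U $ b' $ k) * (cnj (U $ c' $ k) * (cnj (U $ a $ k) * cnj (U $ b $ k))))"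
    unfolding outcome_op_def vec_lambda_beta outcome_vector_nth complex_cnj_mult complex_cnj_cnj
    by (intro Bochner_Integration.integral_cong refl) (simp only: mult_ac)
  also have "\<dots> = (of_bool (c = c' \<and> a' = a \<and> b' = b) + of_bool (c = a \<and> a' = c' \<and> b' = b)
     + of_bool (c = c' \<and> a' = b \<and> b' = a) + of_bool (c = b \<and> a' = a \<and> b' = c')
     + of_bool (c = a \<and> a' = b \<and> b' = c') + of_bool (c = b \<and> a' = c' \<and> b' = a))
     / (of_nat CARD('n) * (of_nat CARD('n) + 1) * (of_nat CARD('n) + 2))"
    by (rule moment3_entries[OF card_ge_2])
  also have "(c = c' \<and> a' = a \<and> b' = b) = (a = a' \<and> b = b' \<and> c = c')" by blast
  also have "(c = c' \<and> a' = b \<and> b' = a) = (a = b' \<and> b = a' \<and> c = c')" by blast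
  also have "(c = a \<and> a' = c' \<and> b' = b) = (a = c \<and> a' = c' \<and> b = b')" by blast
  also have "(c = b \<and> a' = a \<and> b' = c') = (b = c \<and> b' = c' \<and> a = a')" by blast
  also have "(c = a \<and> a' = b \<and> b' = c') = (a = c \<and> b' = c' \<and> b = a')" by blast
  also have "(c = b \<and> a' = c' \<and> b' = a) = (b = c \<and> a' = c' \<and> a = b')" by blast
  finally show ?thesis
    by (simp only: add_ac)
qed

lemma outcome_op_same:
  "outcome_op k k k = (let s = moment_scale CARD('n) * (real CARD('n) - 1) in invariant_op s s s s s s)"
proof (rule operator_eqI)
  fix a b c a' b' c' :: 'n
  define n :: complex where "n = of_nat CARD('n)"
  have nz: "n - 1 \<noteq> 0"
    using card_ge_2 by (auto simp: complex_eq_iff n_def)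
  have s: "of_real (moment_scale CARD('n) * (real CARD('n) - 1)) = 1 / (n * (n + 1) * (n + 2))"
  proof -
    have "of_real (moment_scale CARD('n) * (real CARD('n) - 1)) = (n - 1) / ((n - 1) * (n * (n + 1) * (n + 2)))"
      by (simp add: moment_scale_def n_def mult_ac)
    also have "\<dots> = 1 / (n * (n + 1) * (n + 2))"
      using nz by simp
    finally show ?thesis .
  qed
  show "outcome_op k k k $ (a, b, c) $ (a', b', c') =
    (let s = moment_scale CARD('n) * (real CARD('n) - 1) in invariant_op s s s s s s) $ (a, b, c) $ (a', b', c')"
    unfolding Let_def invariant_op_nth outcome_op_same_nth n_def[symmetric] s
    by (simp only: times_divide_eq_left mult_1_left add_divide_distrib)
qed

text \<open>Sum over the outcome that stands alone: completeness leaves a second moment of one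
  column, and by relabelling columns all terms except the fully coincident one agree.\<close>

lemma outcome_op_two_equal:
  assumes "i \<noteq> k"
  defines "d \<equiv> real CARD('n)"
  defines "s \<equiv> moment_scale d"
  shows "outcome_op i i k = invariant_op (s * (d + 1)) (s * (d + 1)) (-s) (-s) (-s) (-s)" (is ?A)
    and "outcome_op k i k = invariant_op (s * (d + 1)) (-s) (s * (d + 1)) (-s) (-s) (-s)" (is ?B)
    and "outcome_op i k k = invariant_op (s * (d + 1)) (-s) (-s) (s * (d + 1)) (-s) (-s)" (is ?C)
proof -
  define n :: complex where "n = of_nat CARD('n)"
  define S :: complex where "S = of_real s"
  have S: "S = of_real (moment_scale CARD('n))"
    by (simp add: S_def s_def d_def)
  have Sn: "complex_of_real (s * (d + 1)) = S * (n + 1)" "complex_of_real (- s) = - S"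
    by (simp_all add: S_def n_def d_def)
  have expand_A: "S * ((n + 2) * (x1 + x2) - (x1 + x2 + x3 + x4 + x5 + x6))
     = S * (n + 1) * x1 + S * (n + 1) * x2 + - S * x3 + - S * x4 + - S * x5 + - S * x6" for x1 x2 x3 x4 x5 x6
    by algebra
  have expand_B: "S * ((n + 2) * (x1 + x3) - (x1 + x2 + x3 + x4 + x5 + x6))
     = S * (n + 1) * x1 + - S * x2 + S * (n + 1) * x3 + - S * x4 + - S * x5 + - S * x6" for x1 x2 x3 x4 x5 x6
    by algebra
  have expand_C: "S * ((n + 2) * (x1 + x4) - (x1 + x2 + x3 + x4 + x5 + x6))
     = S * (n + 1) * x1 + - S * x2 + - S * x3 + S * (n + 1) * x4 + - S * x5 + - S * x6" for x1 x2 x3 x4 x5 x6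
    by algebra
  show ?A
  proof (rule operator_eqI, goal_cases)
    case (1 a b c a' b' c')
    have conj: "(c = c' \<and> a' = a \<and> b' = b) = (a = a' \<and> b = b' \<and> c = c')"
      "(c = c' \<and> a' = b \<and> b' = a) = (a = b' \<and> b = a' \<and> c = c')"
      by blast+
    have "outcome_op i i x = outcome_op i i k" if "x \<noteq> i" for x
      using outcome_op_permute[of "Transposition.transpose x k" i i k] that assms(1)
      by (simp add: transpose_def)
    then have "(\<Sum>x\<in>UNIV. outcome_op i i x $ (a, b, c) $ (a', b', c')) = outcome_op i i i $ (a, b, c) $ (a', b', c')
        + (of_nat CARD('n) - 1) * outcome_op i i k $ (a, b, c) $ (a', b', c')"
      by (intro sum_eq_except_complex(1)[of i "\<lambda>x. outcome_op i i x $ (a, b, c) $ (a', b', c')"]) simp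
    then have eq: "outcome_op i i i $ (a, b, c) $ (a', b', c')
        + (of_nat CARD('n) - 1) * outcome_op i i k $ (a, b, c) $ (a', b', c')
        = (of_bool (a = a' \<and> b = b' \<and> c = c') + of_bool (a = b' \<and> b = a' \<and> c = c')) / (of_nat CARD('n) * (of_nat CARD('n) + 1))"
      unfolding sum_outcome_op_3 pair_moment_same of_bool_mult_quotient conj
      by (rule sym)
    note Y = solve_marginal_equation[OF card_ge_2 outcome_op_same_nth[of i a b c a' b' c'] eq]
    show ?case
      unfolding Y invariant_op_nth Sn S[symmetric] n_def[symmetric]
      by (rule expand_A)
  qed
  show ?B
  proof (rule operator_eqI, goal_cases)
    case (1 a b c a' b' c')
    have conj: "(b = b' \<and> a' = a \<and> c = c') = (a = a' \<and> b = b' \<and> c = c')"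
      "(b = b' \<and> a' = c' \<and> c = a) = (a = c \<and> a' = c' \<and> b = b')"
      by blast+
    have "outcome_op k x k = outcome_op k i k" if "x \<noteq> k" for x
      using outcome_op_permute[of "Transposition.transpose x i" k i k] that assms(1)
      by (simp add: transpose_def)
    then have "(\<Sum>x\<in>UNIV. outcome_op k x k $ (a, b, c) $ (a', b', c')) = outcome_op k k k $ (a, b, c) $ (a', b', c')
        + (of_nat CARD('n) - 1) * outcome_op k i k $ (a, b, c) $ (a', b', c')"
      by (intro sum_eq_except_complex(1)[of k "\<lambda>x. outcome_op k x k $ (a, b, c) $ (a', b', c')"]) simp
    then have eq: "outcome_op k k k $ (a, b, c) $ (a', b', c')
        + (of_nat CARD('n) - 1) * outcome_op k i k $ (a, b, c) $ (a', b', c')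
        = (of_bool (a = a' \<and> b = b' \<and> c = c') + of_bool (a = c \<and> a' = c' \<and> b = b')) / (of_nat CARD('n) * (of_nat CARD('n) + 1))"
      unfolding sum_outcome_op_2 pair_moment_same of_bool_mult_quotient conj
      by (rule sym)
    note Y = solve_marginal_equation[OF card_ge_2 outcome_op_same_nth[of k a b c a' b' c'] eq]
    show ?case
      unfolding Y invariant_op_nth Sn S[symmetric] n_def[symmetric]
      by (rule expand_B)
  qed
  show ?C
  proof (rule operator_eqI, goal_cases)
    case (1 a b c a' b' c')
    have conj: "(a = a' \<and> b' = b \<and> c = c') = (a = a' \<and> b = b' \<and> c = c')"
      "(a = a' \<and> b' = c' \<and> c = b) = (b = c \<and> b' = c' \<and> a = a')"
      by blast+
    have "outcome_op x k k = outcome_op i k k" if "x \<noteq> k" for x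
      using outcome_op_permute[of "Transposition.transpose x i" i k k] that assms(1)
      by (simp add: transpose_def)
    then have "(\<Sum>x\<in>UNIV. outcome_op x k k $ (a, b, c) $ (a', b', c')) = outcome_op k k k $ (a, b, c) $ (a', b', c')
        + (of_nat CARD('n) - 1) * outcome_op i k k $ (a, b, c) $ (a', b', c')"
      by (intro sum_eq_except_complex(1)[of k "\<lambda>x. outcome_op x k k $ (a, b, c) $ (a', b', c')"]) simp
    then have eq: "outcome_op k k k $ (a, b, c) $ (a', b', c')
        + (of_nat CARD('n) - 1) * outcome_op i k k $ (a, b, c) $ (a', b', c')
        = (of_bool (a = a' \<and> b = b' \<and> c = c') + of_bool (b = c \<and> b' = c' \<and> a = a')) / (of_nat CARD('n) * (of_nat CARD('n) + 1))"
      unfolding sum_outcome_op_1 pair_moment_same of_bool_mult_quotient conj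
      by (rule sym)
    note Y = solve_marginal_equation[OF card_ge_2 outcome_op_same_nth[of k a b c a' b' c'] eq]
    show ?case
      unfolding Y invariant_op_nth Sn S[symmetric] n_def[symmetric]
      by (rule expand_C)
  qed
qed

end

text \<open>\<open>P\<close> and \<open>Q\<close> are the terms in which the summed outcome meets
  one of the two fixed, distinct outcomes; the other \<open>N - 2\<close> terms all equal
  \<open>Y\<close>. The right-hand side of the equation is a moment of two different
  columns.\<close>

lemma solve_distinct_equation:
  fixes x1 x2 x3 x4 x5 x6 Y P Q :: complex
  assumes "N \<ge> 3"
  defines "s \<equiv> moment_scale (real N)"
  assumes P: "P = of_real (s * (real N + 1)) * x1 + of_real (s * (real N + 1)) * x2 + of_real (-s) * x3
      + of_real (-s) * x4 + of_real (-s) * x5 + of_real (-s) * x6"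
    and Q: "Q = of_real (s * (real N + 1)) * x1 + of_real (-s) * x2 + of_real (s * (real N + 1)) * x3
      + of_real (-s) * x4 + of_real (-s) * x5 + of_real (-s) * x6"
    and eq: "P + Q + (of_nat N - 2) * Y = (of_nat N * x1 - x4) / (of_nat N * (of_nat N + 1) * (of_nat N - 1))"
  defines "t \<equiv> s / (real N - 2)"
  shows "Y = of_real (t * ((real N)\<^sup>2 - 2)) * x1 + of_real (- (t * N)) * x2 + of_real (- (t * N)) * x3
      + of_real (- (t * N)) * x4 + of_real (2 * t) * x5 + of_real (2 * t) * x6"
proof -
  define n :: complex where "n = of_nat N"
  have nz: "n \<noteq> 0" "n - 1 \<noteq> 0" "n + 1 \<noteq> 0" "n + 2 \<noteq> 0" "n - 2 \<noteq> 0"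
    using assms(1) by (auto simp: complex_eq_iff n_def)
  define S :: complex where "S = of_real s"
  define T :: complex where "T = of_real t"
  have S: "S = 1 / ((n - 1) * n * (n + 1) * (n + 2))"
    by (simp add: moment_scale_def n_def s_def S_def)
  have T: "T * (n - 2) = S"
    using nz by (simp add: T_def t_def S_def n_def)
  have "(n * x1 - x4) / (n * (n + 1) * (n - 1)) = S * (n + 2) * (n * x1 - x4)"
    using nz unfolding S by (simp add: divide_simps)
  moreover have of: "complex_of_real (s * (real N + 1)) = S * (n + 1)" "complex_of_real (- s) = - S"
    by (simp_all add: S_def n_def)
  ultimately have "(n - 2) * Y = S * ((n\<^sup>2 - 2) * x1 - n * (x2 + x3 + x4) + 2 * (x5 + x6))"
    using P Q eq unfolding n_def[symmetric] of by algebra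
  then have "(n - 2) * Y = (n - 2) * (T * ((n\<^sup>2 - 2) * x1 - n * (x2 + x3 + x4) + 2 * (x5 + x6)))"
    unfolding T[symmetric] by (simp only: mult_ac)
  then have "Y = T * ((n\<^sup>2 - 2) * x1 - n * (x2 + x3 + x4) + 2 * (x5 + x6))"
    using nz by simp
  moreover have "complex_of_real (t * ((real N)\<^sup>2 - 2)) = T * (n\<^sup>2 - 2)" "complex_of_real (- (t * N)) = - (T * n)"
    "complex_of_real (2 * t) = 2 * T"
    by (simp_all add: T_def n_def)
  moreover have "T * ((n\<^sup>2 - 2) * x1 - n * (x2 + x3 + x4) + 2 * (x5 + x6)) = T * (n\<^sup>2 - 2) * x1
      + - (T * n) * x2 + - (T * n) * x3 + - (T * n) * x4 + 2 * T * x5 + 2 * T * x6"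
    by algebra
  ultimately show ?thesis
    by (simp only:)
qed

lemma trace_mult: "trace (A ** B) = (\<Sum>p\<in>UNIV. \<Sum>q\<in>UNIV. A $ p $ q * B $ q $ p)"
  by (simp add: trace_def matrix_matrix_mult_def)

section \<open>Invariant positive operators\<close>

definition outer :: "complex ^ 'i::finite \<Rightarrow> 'i operator" where
  "outer v = (\<chi> p q. v $ p * cnj (v $ q))"

lemma trace_outer_mult:
  "trace (outer v ** R) = (\<Sum>p\<in>UNIV. \<Sum>q\<in>UNIV. cnj (v $ p) * R $ p $ q * v $ q)"
  unfolding trace_mult outer_def by (subst sum.swap) (simp add: mult_ac)

text \<open>The dual cone of the positive semidefinite matrices, which is the same cone. In this
  form sums and Haar averages of projectors are positive by linearity, and weak duality applies
  without factorising a matrix.\<close>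

definition trace_positive :: "'i::finite operator \<Rightarrow> bool" where
  "trace_positive M \<longleftrightarrow> (\<forall>R. positive_semidefinite R \<longrightarrow> trace (M ** R) \<in> \<real>\<^sub>\<ge>\<^sub>0)"

lemma trace_positiveD: "trace_positive M \<Longrightarrow> positive_semidefinite R \<Longrightarrow> trace (M ** R) \<in> \<real>\<^sub>\<ge>\<^sub>0"
  by (simp add: trace_positive_def)

lemma trace_positive_0: "trace_positive 0"
  by (simp add: trace_positive_def trace_def)

lemma trace_positive_outer: "trace_positive (outer v)"
  unfolding trace_positive_def trace_outer_mult positive_semidefinite_def by blast

lemma trace_positive_add:
  assumes "trace_positive A" "trace_positive B"
  shows "trace_positive (A + B)"
proof -
  have "trace ((A + B) ** R) = trace (A ** R) + trace (B ** R)" for R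
    by (simp add: trace_mult distrib_right sum.distrib)
  then show ?thesis
    using assms by (simp add: trace_positive_def nonneg_Reals_add_I)
qed

lemma trace_positive_sum:
  assumes "\<And>x. x \<in> S \<Longrightarrow> trace_positive (f x)"
  shows "trace_positive (\<Sum>x\<in>S. f x)"
  using assms by (induction S rule: infinite_finite_induct) (auto intro: trace_positive_add trace_positive_0)

lemma positive_semidefinite_outer: "positive_semidefinite (outer v)"
  unfolding positive_semidefinite_def
proof
  fix w
  have "(\<Sum>p\<in>UNIV. \<Sum>q\<in>UNIV. cnj (w $ p) * outer v $ p $ q * w $ q)
      = (\<Sum>p\<in>UNIV. cnj (w $ p) * v $ p) * cnj (\<Sum>q\<in>UNIV. cnj (w $ q) * v $ q)"
    unfolding outer_def cnj_sum sum_product by (simp add: mult_ac)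
  also have "\<dots> \<in> \<real>\<^sub>\<ge>\<^sub>0"
    unfolding complex_norm_square[symmetric] by simp
  finally show "(\<Sum>p\<in>UNIV. \<Sum>q\<in>UNIV. cnj (w $ p) * outer v $ p $ q * w $ q) \<in> \<real>\<^sub>\<ge>\<^sub>0" .
qed

lemma trace_positive_imp_positive_semidefinite:
  assumes "trace_positive M"
  shows "positive_semidefinite M"
  unfolding positive_semidefinite_def
proof
  fix v
  have "(\<Sum>p\<in>UNIV. \<Sum>q\<in>UNIV. cnj (v $ p) * M $ p $ q * v $ q) = trace (M ** outer v)"
    unfolding trace_mult outer_def by (simp add: mult_ac)
  then show "(\<Sum>p\<in>UNIV. \<Sum>q\<in>UNIV. cnj (v $ p) * M $ p $ q * v $ q) \<in> \<real>\<^sub>\<ge>\<^sub>0"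
    using trace_positiveD[OF assms positive_semidefinite_outer] by simp
qed

lemma invariant_op_add:
  "invariant_op x1 x2 x3 x4 x5 x6 + invariant_op y1 y2 y3 y4 y5 y6
    = invariant_op (x1 + y1) (x2 + y2) (x3 + y3) (x4 + y4) (x5 + y5) (x6 + y6)"
  by (rule operator_eqI) (simp only: vector_add_component invariant_op_nth of_real_add distrib_right add_ac)

lemma invariant_op_swap:
  "invariant_op x1 x2 x3 x4 x5 x6 $ (a, b, c) $ (b', a', c') = invariant_op x2 x1 x5 x6 x3 x4 $ (a, b, c) $ (a', b', c')"
  by (simp only: invariant_op_nth add_ac)

lemma trace_positive_invariant_op_scale:
  assumes "trace_positive (invariant_op x1 x2 x3 x4 x5 x6 :: ('n::finite \<times> 'n \<times> 'n) operator)" "c \<ge> 0"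
  shows "trace_positive (invariant_op (c * x1) (c * x2) (c * x3) (c * x4) (c * x5) (c * x6) :: ('n \<times> 'n \<times> 'n) operator)"
proof -
  have "invariant_op (c * x1) (c * x2) (c * x3) (c * x4) (c * x5) (c * x6) $ p $ q
     = of_real c * invariant_op x1 x2 x3 x4 x5 x6 $ p $ q" for p q :: "'n \<times> 'n \<times> 'n"
    by (cases p; cases q) (simp only: invariant_op_nth of_real_mult distrib_left mult.assoc)
  then have "trace (invariant_op (c * x1) (c * x2) (c * x3) (c * x4) (c * x5) (c * x6) ** R)
     = of_real c * trace (invariant_op x1 x2 x3 x4 x5 x6 ** R)" for R :: "('n \<times> 'n \<times> 'n) operator"
    by (simp add: trace_mult mult.assoc flip: sum_distrib_left)
  then show ?thesis
    using assms by (simp add: trace_positive_def nonneg_Reals_mult_I)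
qed

text \<open>The vectors \<open>y |\<Phi>\<^sub>A\<^sub>C\<rangle>|x\<rangle>\<^sub>B + z |\<Phi>\<^sub>B\<^sub>C\<rangle>|x\<rangle>\<^sub>A\<close> with \<open>\<Phi>\<close> the unnormalised maximally entangled vector.\<close>

definition entangled_vector :: "real \<Rightarrow> real \<Rightarrow> 'n::finite \<Rightarrow> complex ^ ('n \<times> 'n \<times> 'n)" where
  "entangled_vector y z x = (\<chi> p. case p of (a, b, c) \<Rightarrow>
     of_real y * of_bool (a = c \<and> b = x) + of_real z * of_bool (b = c \<and> a = x))"

text \<open>The coefficients are those of the rank-one form given by \<open>(y, z)\<close> on the
  two-dimensional multiplicity space of the dual representation.\<close>

lemma sum_outer_entangled_vector:
  "(\<Sum>x\<in>UNIV. outer (entangled_vector y z x)) = invariant_op 0 0 (y\<^sup>2) (z\<^sup>2) (y * z) (y * z)"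
proof (rule operator_eqI, goal_cases)
  case (1 a b c a' b' c')
  have *: "(\<Sum>x\<in>UNIV. of_bool (P \<and> u = x) * of_bool (Q \<and> v = x)) = (of_bool (P \<and> Q \<and> u = v) :: complex)"
    for P Q and u v :: 'a
  proof -
    have "(\<Sum>x\<in>UNIV. of_bool (P \<and> u = x) * of_bool (Q \<and> v = x)) =
        (\<Sum>x\<in>UNIV. if x = u then of_bool (P \<and> Q \<and> u = v) else 0 :: complex)"
      by (intro sum.cong refl) auto
    then show ?thesis by simp
  qed
  have cnj_of_bool: "cnj (of_bool P) = of_bool P" for P
    by (cases P) simp_all
  have bilinear: "(\<Sum>x\<in>UNIV. (y' * f x + z' * g x) * (y' * f' x + z' * g' x)) =
      y'\<^sup>2 * (\<Sum>x\<in>UNIV. f x * f' x) + z'\<^sup>2 * (\<Sum>x\<in>UNIV. g x * g' x)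
      + y' * z' * (\<Sum>x\<in>UNIV. f x * g' x) + y' * z' * (\<Sum>x\<in>UNIV. g x * f' x)"
    for y' z' :: complex and f f' g g' :: "'a \<Rightarrow> complex"
    by (simp add: sum_distrib_left sum.distrib[symmetric] algebra_simps power2_eq_square)
  show ?case
    unfolding invariant_op_nth sum_component outer_def entangled_vector_def vec_lambda_beta prod.case
      complex_cnj_add complex_cnj_mult complex_cnj_complex_of_real cnj_of_bool bilinear *
    by simp
qed

context haar
begin

lemma trace_integral_outer:
  fixes \<phi> :: "'n operator \<Rightarrow> complex ^ 'i::finite"
  assumes "\<And>p. continuous_on UNIV (\<lambda>U. \<phi> U $ p)"
  defines "M \<equiv> \<chi> p q. LINT U|\<mu>. \<phi> U $ p * cnj (\<phi> U $ q)"
  shows "integrable \<mu> (\<lambda>U. trace (outer (\<phi> U) ** R))"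
    and "trace (M ** R) = (LINT U|\<mu>. trace (outer (\<phi> U) ** R))"
proof -
  have int: "integrable \<mu> (\<lambda>U. \<phi> U $ p * cnj (\<phi> U $ q) * R $ q $ p)" for p q
    by (intro integrable_continuous continuous_intros assms)
  show "integrable \<mu> (\<lambda>U. trace (outer (\<phi> U) ** R))"
    unfolding trace_mult outer_def vec_lambda_beta
    by (intro Bochner_Integration.integrable_sum int)
  show "trace (M ** R) = (LINT U|\<mu>. trace (outer (\<phi> U) ** R))"
    unfolding M_def trace_mult outer_def vec_lambda_beta
    using int by (simp add: Bochner_Integration.integral_sum Bochner_Integration.integrable_sum)
qed

lemma trace_positive_integral:
  fixes \<phi> :: "'n operator \<Rightarrow> complex ^ 'i::finite"
  assumes "\<And>p. continuous_on UNIV (\<lambda>U. \<phi> U $ p)"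
  shows "trace_positive (\<chi> p q. LINT U|\<mu>. \<phi> U $ p * cnj (\<phi> U $ q))"
  unfolding trace_positive_def trace_integral_outer(2)[OF assms]
proof (intro allI impI)
  fix R :: "'i operator"
  assume R: "positive_semidefinite R"
  have pos: "trace (outer (\<phi> U) ** R) \<in> \<real>\<^sub>\<ge>\<^sub>0" for U
    using trace_positiveD[OF trace_positive_outer R] .
  have "Re (LINT U|\<mu>. trace (outer (\<phi> U) ** R)) = (LINT U|\<mu>. Re (trace (outer (\<phi> U) ** R)))"
    "Im (LINT U|\<mu>. trace (outer (\<phi> U) ** R)) = (LINT U|\<mu>. Im (trace (outer (\<phi> U) ** R)))"
    using trace_integral_outer(1)[OF assms, of R] by simp_all
  moreover have "(LINT U|\<mu>. Re (trace (outer (\<phi> U) ** R))) \<ge> 0"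
    using pos by (intro Bochner_Integration.integral_nonneg) (auto simp: complex_nonneg_Reals_iff)
  moreover have "(LINT U|\<mu>. Im (trace (outer (\<phi> U) ** R))) = 0"
    using pos by (simp add: complex_nonneg_Reals_iff)
  ultimately show "(LINT U|\<mu>. trace (outer (\<phi> U) ** R)) \<in> \<real>\<^sub>\<ge>\<^sub>0"
    by (simp add: complex_nonneg_Reals_iff)
qed

end

lemma trace_positive_entangled:
  "trace_positive (invariant_op 0 0 (y\<^sup>2) (z\<^sup>2) (y * z) (y * z))"
  unfolding sum_outer_entangled_vector[symmetric]
  by (intro trace_positive_sum trace_positive_outer)

text \<open>For general d the projector on the traceless antisymmetric tensors, times
  \<open>2 (d - 1)\<close>, has coefficients \<open>d - 1, -(d - 1), -1, -1, 1, 1\<close>. At d = 2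
  these are the coefficients here, and that space is trivial.\<close>

lemma invariant_op_antisymmetric_eq_0:
  assumes "CARD('n::finite) = 2"
  shows "invariant_op 1 (-1) (-1) (-1) 1 1 = (0 :: ('n \<times> 'n \<times> 'n) operator)"
proof (rule operator_eqI)
  fix a b c a' b' c' :: 'n
  obtain x y :: 'n where xy: "UNIV = {x, y}" "x \<noteq> y"
    using assms by (auto simp: card_2_iff)
  have "z = x \<or> z = y" for z
    using xy by (metis UNIV_I insertE singletonD)
  then have "a = x \<or> a = y" "b = x \<or> b = y" "c = x \<or> c = y" "a' = x \<or> a' = y" "b' = x \<or> b' = y" "c' = x \<or> c' = y"
    by auto
  then show "invariant_op 1 (-1) (-1) (-1) 1 1 $ (a, b, c) $ (a', b', c') = 0 $ (a, b, c) $ (a', b', c')"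
    unfolding invariant_op_nth using xy(2) by (elim disjE; hypsubst; simp)
qed

context haar_ge_2
begin

lemma outcome_op_distinct:
  assumes "i \<noteq> j" "i \<noteq> k" "j \<noteq> k"
  defines "d \<equiv> real CARD('n)"
  defines "t \<equiv> moment_scale d / (d - 2)"
  shows "outcome_op i j k = invariant_op (t * (d\<^sup>2 - 2)) (- (t * d)) (- (t * d)) (- (t * d)) (2 * t) (2 * t)"
proof (rule operator_eqI, goal_cases)
  case (1 a b c a' b' c')
  have N: "CARD('n) \<ge> 3"
    using card_mono[of UNIV "{i, j, k}"] assms(1-3) by simp
  have conj: "(a = a' \<and> b' = b \<and> c = c') = (a = a' \<and> b = b' \<and> c = c')"
      "(a = a' \<and> b' = c' \<and> c = b) = (b = c \<and> b' = c' \<and> a = a')"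
    by blast+
  have mq: "of_bool P * ((n * of_bool Q - of_bool R) / (m :: complex)) = (n * of_bool (P \<and> Q) - of_bool (P \<and> R)) / m"
    for P Q R n m
    by (cases P) simp_all
  have "outcome_op x j k = outcome_op i j k" if "x \<noteq> j" "x \<noteq> k" for x
    using outcome_op_permute[of "Transposition.transpose x i" i j k] that assms(1-3)
    by (simp add: transpose_def)
  then have "(\<Sum>x\<in>UNIV. outcome_op x j k $ (a, b, c) $ (a', b', c')) = outcome_op j j k $ (a, b, c) $ (a', b', c')
     + outcome_op k j k $ (a, b, c) $ (a', b', c')
     + (of_nat CARD('n) - 2) * outcome_op i j k $ (a, b, c) $ (a', b', c')"
    by (intro sum_eq_except_complex(2)[of j k "\<lambda>x. outcome_op x j k $ (a, b, c) $ (a', b', c')"] assms) simp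
  then have eq: "outcome_op j j k $ (a, b, c) $ (a', b', c') + outcome_op k j k $ (a, b, c) $ (a', b', c')
     + (of_nat CARD('n) - 2) * outcome_op i j k $ (a, b, c) $ (a', b', c')
     = (of_nat CARD('n) * of_bool (a = a' \<and> b = b' \<and> c = c') - of_bool (b = c \<and> b' = c' \<and> a = a'))
        / (of_nat CARD('n) * (of_nat CARD('n) + 1) * (of_nat CARD('n) - 1))"
    unfolding sum_outcome_op_1 pair_moment_distinct[OF assms(3)] mq conj by (rule sym)
  note P = arg_cong[OF outcome_op_two_equal(1)[OF assms(3)], of "\<lambda>X. X $ (a, b, c) $ (a', b', c')", unfolded invariant_op_nth]
  note Q = arg_cong[OF outcome_op_two_equal(2)[OF assms(3)], of "\<lambda>X. X $ (a, b, c) $ (a', b', c')", unfolded invariant_op_nth]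
  show ?case
    unfolding invariant_op_nth t_def d_def by (rule solve_distinct_equation[OF N P Q eq])
qed

lemma trace_positive_outcome_op: "trace_positive (outcome_op i j k)"
  unfolding outcome_op_def by (intro trace_positive_integral continuous_intros)

lemma moment_scale_pos: "moment_scale CARD('n) > 0"
  using card_ge_2 by (simp add: moment_scale_def)

text \<open>For i different from k, \<open>outcome_vector U i i k\<close> is symmetric in A, B and
  contracts to 0 on AC and on BC. Its average is therefore supported on the traceless symmetric
  tensors; the operator is \<open>2 (d + 1)\<close> times their projector.\<close>

lemma trace_positive_symmetric:
  defines "d \<equiv> real CARD('n)"
  shows "trace_positive (invariant_op (d + 1) (d + 1) (-1) (-1) (-1) (-1) :: ('n \<times> 'n \<times> 'n) operator)"
proof -
  obtain i k :: 'n where "i \<noteq> k"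
    using card_ge_2 card_le_Suc0_iff_eq[of "UNIV :: 'n set"] by (metis UNIV_I finite not_less_eq_eq numeral_2_eq_2)
  from trace_positive_outcome_op[of i i k, unfolded outcome_op_two_equal(1)[OF this]]
  show ?thesis
    using trace_positive_invariant_op_scale[of _ _ _ _ _ _ "1 / moment_scale d"] moment_scale_pos
    by (fastforce simp: d_def)
qed

text \<open>For \<open>d \<ge> 3\<close> this is, up to a factor, the average of the projectors on the antisymmetrised outcome
  vectors with three distinct outcomes.\<close>

lemma trace_positive_antisymmetric:
  defines "d \<equiv> real CARD('n)"
  shows "trace_positive (invariant_op (d - 1) (- (d - 1)) (-1) (-1) 1 1 :: ('n \<times> 'n \<times> 'n) operator)"
proof (cases "CARD('n) = 2")
  case True
  then show ?thesis
    using invariant_op_antisymmetric_eq_0[OF True] by (simp add: d_def trace_positive_0)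
next
  case False
  then have N: "CARD('n) \<ge> 3"
    using card_ge_2 by simp
  then obtain T :: "'n set" where "card T = 3"
    using obtain_subset_with_card_n by metis
  then obtain i j k :: 'n where ijk: "i \<noteq> j" "i \<noteq> k" "j \<noteq> k"
    by (auto simp: card_3_iff)
  define t where "t = moment_scale d / (d - 2)"
  have t: "t > 0"
    using N moment_scale_pos by (simp add: t_def d_def)
  let ?\<phi> = "\<lambda>U. outcome_vector U i j k - outcome_vector U j i k"
  have "trace_positive (\<chi> p q. LINT U|\<mu>. ?\<phi> U $ p * cnj (?\<phi> U $ q))"
    by (intro trace_positive_integral) (simp add: continuous_intros)
  also have "(\<chi> p q. LINT U|\<mu>. ?\<phi> U $ p * cnj (?\<phi> U $ q)) =
    (invariant_op (2 * t * (d + 2) * (d - 1)) (2 * t * (d + 2) * - (d - 1)) (2 * t * (d + 2) * -1)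
       (2 * t * (d + 2) * -1) (2 * t * (d + 2) * 1) (2 * t * (d + 2) * 1) :: ('n \<times> 'n \<times> 'n) operator)"
  proof (rule operator_eqI, goal_cases)
    case (1 a b c a' b' c')
    let ?X = "invariant_op (t * (d\<^sup>2 - 2)) (- (t * d)) (- (t * d)) (- (t * d)) (2 * t) (2 * t) :: ('n \<times> 'n \<times> 'n) operator"
    have X: "outcome_op i j k = ?X" "outcome_op j i k = ?X"
      using outcome_op_distinct[of i j k] outcome_op_distinct[of j i k] ijk by (simp_all add: t_def d_def)
    have int: "integrable \<mu> (\<lambda>U. outcome_vector U i j k $ p * cnj (outcome_vector U i' j' k $ q))" for i j i' j' p q
      by (intro integrable_continuous continuous_intros)
    \<comment> \<open>Exchanging A and B exchanges the first two outcomes, so each cross term is an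
      average for a single outcome triple with \<open>a'\<close> and \<open>b'\<close>
      interchanged.\<close>
    have "(LINT U|\<mu>. ?\<phi> U $ (a, b, c) * cnj (?\<phi> U $ (a', b', c'))) =
       (LINT U|\<mu>. outcome_vector U i j k $ (a, b, c) * cnj (outcome_vector U i j k $ (a', b', c'))
         + outcome_vector U j i k $ (a, b, c) * cnj (outcome_vector U j i k $ (a', b', c'))
         - outcome_vector U i j k $ (a, b, c) * cnj (outcome_vector U i j k $ (b', a', c'))
         - outcome_vector U j i k $ (a, b, c) * cnj (outcome_vector U j i k $ (b', a', c')))"
      by (intro Bochner_Integration.integral_cong refl) (simp add: algebra_simps)
    also have "\<dots> = outcome_op i j k $ (a, b, c) $ (a', b', c') + outcome_op j i k $ (a, b, c) $ (a', b', c')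
        - outcome_op i j k $ (a, b, c) $ (b', a', c') - outcome_op j i k $ (a, b, c) $ (b', a', c')"
      unfolding outcome_op_def vec_lambda_beta using int by (simp del: outcome_vector_nth)
    also have "\<dots> = 2 * (?X $ (a, b, c) $ (a', b', c') - ?X $ (a, b, c) $ (b', a', c'))"
      unfolding X by simp
    also have "\<dots> = invariant_op (2 * t * (d + 2) * (d - 1)) (2 * t * (d + 2) * - (d - 1)) (2 * t * (d + 2) * -1)
       (2 * t * (d + 2) * -1) (2 * t * (d + 2) * 1) (2 * t * (d + 2) * 1) $ (a, b, c) $ (a', b', c')"
    proof -
      have e: "2 * ((of_real (t * (d\<^sup>2 - 2)) * x1 + of_real (- (t * d)) * x2 + of_real (- (t * d)) * x3
          + of_real (- (t * d)) * x4 + of_real (2 * t) * x5 + of_real (2 * t) * x6)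
        - (of_real (- (t * d)) * x1 + of_real (t * (d\<^sup>2 - 2)) * x2 + of_real (2 * t) * x3
          + of_real (2 * t) * x4 + of_real (- (t * d)) * x5 + of_real (- (t * d)) * x6))
        = of_real (2 * t * (d + 2) * (d - 1)) * x1 + of_real (2 * t * (d + 2) * - (d - 1)) * x2
          + of_real (2 * t * (d + 2) * -1) * x3 + of_real (2 * t * (d + 2) * -1) * x4
          + of_real (2 * t * (d + 2) * 1) * x5 + of_real (2 * t * (d + 2) * 1) * x6" for x1 x2 x3 x4 x5 x6 :: complex
        by (simp add: algebra_simps power2_eq_square)
      show ?thesis
        unfolding invariant_op_swap[of _ _ _ _ _ _ a b c b' a' c'] unfolding invariant_op_nth by (rule e)
    qed
    finally show ?case by simp
  qed
  finally have *: "trace_positive (invariant_op (2 * t * (d + 2) * (d - 1)) (2 * t * (d + 2) * - (d - 1)) (2 * t * (d + 2) * -1)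
       (2 * t * (d + 2) * -1) (2 * t * (d + 2) * 1) (2 * t * (d + 2) * 1) :: ('n \<times> 'n \<times> 'n) operator)" .
  have r: "2 * t * (d + 2) > 0"
    using t by (simp add: d_def)
  then have cancel: "1 / (2 * t * (d + 2)) * (2 * t * (d + 2) * x) = x" for x
    by (metis less_irrefl mult.assoc mult_1 nonzero_eq_divide_eq)
  show ?thesis
    using trace_positive_invariant_op_scale[OF *, of "1 / (2 * t * (d + 2))"] r
    unfolding cancel by simp
qed

end

section \<open>The fidelity in terms of the outcome averages\<close>

lemma sum_UNIV_prod:
  fixes f :: "'a::finite \<times> 'b::finite \<Rightarrow> 'c::comm_monoid_add"
  shows "(\<Sum>p\<in>UNIV. f p) = (\<Sum>a\<in>UNIV. \<Sum>b\<in>UNIV. f (a, b))"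
  by (simp add: sum.cartesian_product flip: UNIV_Times_UNIV)

lemma on_C_nth:
  "on_C X $ (a, b, c, k) $ (a', b', c', k') = of_bool (a = a') * (of_bool (b = b') * (of_bool (k = k') * X $ c $ c'))"
  by (simp add: on_C_def tensor_def mat_def)

lemma sum_of_bool_mult [simp]:
  fixes f :: "'a::finite \<Rightarrow> 'b::semiring_1"
  shows "(\<Sum>x\<in>UNIV. of_bool (y = x) * f x) = f y" "(\<Sum>x\<in>UNIV. of_bool (x = y) * f x) = f y"
proof -
  have "(\<Sum>x\<in>UNIV. of_bool (x = y) * f x) = (\<Sum>x\<in>UNIV. if x = y then f x else 0)"
    by (intro sum.cong) auto
  then show "(\<Sum>x\<in>UNIV. of_bool (x = y) * f x) = f y"
    by simp
  then show "(\<Sum>x\<in>UNIV. of_bool (y = x) * f x) = f y"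
    by (simp add: eq_commute)
qed

lemma on_C_mult_nth:
  "(on_C X ** Y) $ (a, b, c, k) $ q = (\<Sum>c'\<in>UNIV. X $ c $ c' * Y $ (a, b, c', k) $ q)"
proof -
  have "(on_C X ** Y) $ (a, b, c, k) $ q = (\<Sum>a'\<in>UNIV. of_bool (a = a') * (\<Sum>b'\<in>UNIV. of_bool (b = b') *
      (\<Sum>c'\<in>UNIV. \<Sum>k'\<in>UNIV. of_bool (k = k') * (X $ c $ c' * Y $ (a', b', c', k') $ q))))"
    unfolding matrix_matrix_mult_def vec_lambda_beta sum_UNIV_prod on_C_nth sum_distrib_left
    by (simp only: mult.assoc)
  then show ?thesis by simp
qed

lemma mult_on_C_nth:
  "(Y ** on_C X) $ q $ (a, b, c, k) = (\<Sum>c'\<in>UNIV. Y $ q $ (a, b, c', k) * X $ c' $ c)"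
proof -
  have "(Y ** on_C X) $ q $ (a, b, c, k) = (\<Sum>a'\<in>UNIV. of_bool (a' = a) * (\<Sum>b'\<in>UNIV. of_bool (b' = b) *
      (\<Sum>c'\<in>UNIV. \<Sum>k'\<in>UNIV. of_bool (k' = k) * (Y $ q $ (a', b', c', k') * X $ c' $ c))))"
    unfolding matrix_matrix_mult_def vec_lambda_beta sum_UNIV_prod on_C_nth sum_distrib_left
    by (simp only: mult_ac)
  then show ?thesis by simp
qed

lemma von_Neumann_effect_nth: "von_Neumann_effect U i $ a $ b = U $ a $ i * cnj (U $ b $ i)"
proof -
  have "(U ** basis_projector i) $ a $ c = (\<Sum>x\<in>UNIV. of_bool (x = i) * (of_bool (c = i) * U $ a $ x))" for c
    unfolding matrix_matrix_mult_def basis_projector_def vec_lambda_beta by (intro sum.cong refl) auto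
  then have "von_Neumann_effect U i $ a $ b = (\<Sum>c\<in>UNIV. of_bool (c = i) * (U $ a $ i * cnj (U $ b $ c)))"
    by (simp add: von_Neumann_effect_def matrix_matrix_mult_def[of "U ** basis_projector i"] mult.assoc)
  then show ?thesis by simp
qed

definition D_block :: "('n::finite \<times> 'n \<times> 'n \<times> 'n) operator \<Rightarrow> 'n \<Rightarrow> ('n \<times> 'n \<times> 'n) operator" where
  "D_block X k = (\<chi> p q. X $ (fst p, fst (snd p), snd (snd p), k) $ (fst q, fst (snd q), snd (snd q), k))"

lemma D_block_nth [simp]: "D_block X k $ (a, b, c) $ (a', b', c') = X $ (a, b, c, k) $ (a', b', c', k)"
  by (simp add: D_block_def)

text \<open>Moving the transpose onto the effects conjugates the columns of U on A and B, while U
  applied to the k-th basis vector of C is its k-th column. Only the diagonal blocks in D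
  enter.\<close>

lemma trace_replicated_POVM:
  "trace (replicated_POVM R U i j ** (von_Neumann_effect U i \<otimes> von_Neumann_effect U j))
    = (\<Sum>k\<in>UNIV. trace (outer (outcome_vector U i j k) ** D_block (R i j) k))"
proof -
  let ?F = "\<lambda>k q c p c'. U $ fst q $ i * (U $ snd q $ j * (cnj (U $ c $ k) *
      (R i j $ (fst q, snd q, c, k) $ (fst p, snd p, c', k) *
        (cnj (U $ fst p $ i) * (cnj (U $ snd p $ j) * U $ c' $ k)))))"
  have sandwich: "sandwich_CD k k (on_C (dagger U) ** R i j ** on_C U) $ q $ p
      = (\<Sum>c'\<in>UNIV. \<Sum>c\<in>UNIV. cnj (U $ c $ k) * (R i j $ (fst q, snd q, c, k) $ (fst p, snd p, c', k) * U $ c' $ k))" for k p q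
    unfolding sandwich_CD_def vec_lambda_beta mult_on_C_nth on_C_mult_nth dagger_nth sum_distrib_right
    by (simp only: mult.assoc)
  have "trace (replicated_POVM R U i j ** (von_Neumann_effect U i \<otimes> von_Neumann_effect U j))
      = (\<Sum>p\<in>UNIV. \<Sum>q\<in>UNIV. \<Sum>k\<in>UNIV. \<Sum>c'\<in>UNIV. \<Sum>c\<in>UNIV. ?F k q c p c')"
    unfolding trace_mult replicated_POVM_def transpose_def vec_lambda_beta sum_component sandwich tensor_def
      von_Neumann_effect_nth sum_distrib_right
    by (simp only: mult_ac)
  also have "\<dots> = (\<Sum>q\<in>UNIV. \<Sum>p\<in>UNIV. \<Sum>k\<in>UNIV. \<Sum>c'\<in>UNIV. \<Sum>c\<in>UNIV. ?F k q c p c')"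
    by (rule sum.swap)
  also have "\<dots> = (\<Sum>q\<in>UNIV. \<Sum>k\<in>UNIV. \<Sum>p\<in>UNIV. \<Sum>c'\<in>UNIV. \<Sum>c\<in>UNIV. ?F k q c p c')"
    by (intro sum.cong refl sum.swap)
  also have "\<dots> = (\<Sum>k\<in>UNIV. \<Sum>q\<in>UNIV. \<Sum>p\<in>UNIV. \<Sum>c'\<in>UNIV. \<Sum>c\<in>UNIV. ?F k q c p c')"
    by (rule sum.swap)
  also have "\<dots> = (\<Sum>k\<in>UNIV. \<Sum>q\<in>UNIV. \<Sum>p\<in>UNIV. \<Sum>c\<in>UNIV. \<Sum>c'\<in>UNIV. ?F k q c p c')"
    by (intro sum.cong refl sum.swap)
  also have "\<dots> = (\<Sum>k\<in>UNIV. \<Sum>q\<in>UNIV. \<Sum>c\<in>UNIV. \<Sum>p\<in>UNIV. \<Sum>c'\<in>UNIV. ?F k q c p c')"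
    by (intro sum.cong refl sum.swap)
  also have "\<dots> = (\<Sum>k\<in>UNIV. trace (outer (outcome_vector U i j k) ** D_block (R i j) k))"
    unfolding trace_outer_mult sum_UNIV_prod fst_conv snd_conv D_block_nth outcome_vector_nth
      complex_cnj_mult complex_cnj_cnj
    by (simp only: mult_ac)
  finally show ?thesis .
qed

lemma (in haar) average_fidelity_eq:
  "average_fidelity \<mu> R = 1 / (real CARD('n))\<^sup>2 *
     (\<Sum>k\<in>UNIV. \<Sum>i\<in>UNIV. \<Sum>j\<in>UNIV. Re (trace (outcome_op i j k ** D_block (R i j) k)))"
proof -
  have c: "continuous_on UNIV (\<lambda>U. outcome_vector U i j k $ p)" for i j k :: 'n and p
    by (intro continuous_intros)
  have "(LINT U|\<mu>. Re (trace (replicated_POVM R U i j ** (von_Neumann_effect U i \<otimes> von_Neumann_effect U j))))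
      = (\<Sum>k\<in>UNIV. Re (trace (outcome_op i j k ** D_block (R i j) k)))" for i j
    unfolding trace_replicated_POVM outcome_op_def trace_integral_outer(2)[OF c]
    using trace_integral_outer(1)[OF c] by (simp add: Bochner_Integration.integral_sum)
  then have "average_fidelity \<mu> R = 1 / (real CARD('n))\<^sup>2 *
     (\<Sum>i\<in>UNIV. \<Sum>j\<in>UNIV. \<Sum>k\<in>UNIV. Re (trace (outcome_op i j k ** D_block (R i j) k)))"
    by (simp only: average_fidelity_def)
  also have "(\<Sum>i\<in>UNIV. \<Sum>j\<in>UNIV. \<Sum>k\<in>UNIV. Re (trace (outcome_op i j k ** D_block (R i j) k)))
     = (\<Sum>i\<in>UNIV. \<Sum>k\<in>UNIV. \<Sum>j\<in>UNIV. Re (trace (outcome_op i j k ** D_block (R i j) k)))"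
    by (intro sum.cong refl sum.swap)
  also have "\<dots> = (\<Sum>k\<in>UNIV. \<Sum>i\<in>UNIV. \<Sum>j\<in>UNIV. Re (trace (outcome_op i j k ** D_block (R i j) k)))"
    by (rule sum.swap)
  finally show ?thesis .
qed

lemma positive_semidefinite_D_block:
  assumes "positive_semidefinite X"
  shows "positive_semidefinite (D_block X k)"
  unfolding positive_semidefinite_def
proof
  fix v :: "complex ^ ('a \<times> 'a \<times> 'a)"
  \<comment> \<open>\<open>v\<close> extended by zero to the other values of D.\<close>
  define w :: "complex ^ ('a \<times> 'a \<times> 'a \<times> 'a)" where
    "w = (\<chi> p. of_bool (k = snd (snd (snd p))) * v $ (fst p, fst (snd p), fst (snd (snd p))))"
  have w: "cnj (w $ (a, b, c, l)) * X $ (a, b, c, l) $ (a', b', c', l') * w $ (a', b', c', l') = of_bool (k = l) *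
      (of_bool (k = l') * (cnj (v $ (a, b, c)) * X $ (a, b, c, l) $ (a', b', c', l') * v $ (a', b', c')))"
    for a b c l a' b' c' l'
    by (cases "k = l"; cases "k = l'") (simp_all add: w_def)
  have "(\<Sum>p\<in>UNIV. \<Sum>q\<in>UNIV. cnj (w $ p) * X $ p $ q * w $ q) =
    (\<Sum>a\<in>UNIV. \<Sum>b\<in>UNIV. \<Sum>c\<in>UNIV. \<Sum>l\<in>UNIV. of_bool (k = l) * (\<Sum>a'\<in>UNIV. \<Sum>b'\<in>UNIV. \<Sum>c'\<in>UNIV.
       \<Sum>l'\<in>UNIV. of_bool (k = l') * (cnj (v $ (a, b, c)) * X $ (a, b, c, l) $ (a', b', c', l') * v $ (a', b', c'))))"
    unfolding sum_UNIV_prod sum_distrib_left w by (rule refl)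
  also have "\<dots> = (\<Sum>p\<in>UNIV. \<Sum>q\<in>UNIV. cnj (v $ p) * D_block X k $ p $ q * v $ q)"
    unfolding sum_of_bool_mult sum_UNIV_prod D_block_nth by (rule refl)
  finally have eq: "(\<Sum>p\<in>UNIV. \<Sum>q\<in>UNIV. cnj (w $ p) * X $ p $ q * w $ q) =
    (\<Sum>p\<in>UNIV. \<Sum>q\<in>UNIV. cnj (v $ p) * D_block X k $ p $ q * v $ q)" .
  show "(\<Sum>p\<in>UNIV. \<Sum>q\<in>UNIV. cnj (v $ p) * D_block X k $ p $ q * v $ q) \<in> \<real>\<^sub>\<ge>\<^sub>0"
    unfolding eq[symmetric] using assms unfolding positive_semidefinite_def by (rule spec)
qed

section \<open>Traces of invariant operators and instruments diagonal in D\<close>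

lemma partial_trace_invariant_op:
  fixes c c' :: "'n::finite"
  shows "(\<Sum>a\<in>UNIV. \<Sum>b\<in>UNIV. invariant_op x1 x2 x3 x4 x5 x6 $ (a, b, c) $ (a, b, c')) =
    of_real ((real CARD('n))\<^sup>2 * x1 + real CARD('n) * (x2 + x3 + x4) + x5 + x6) * of_bool (c = c')"
proof (cases "c = c'")
  case False
  then have "invariant_op x1 x2 x3 x4 x5 x6 $ (a, b, c) $ (a, b, c') = 0" for a b
    unfolding invariant_op_nth by (auto simp: of_bool_def)
  then show ?thesis using False by simp
next
  case True
  have "invariant_op x1 x2 x3 x4 x5 x6 $ (a, b, c) $ (a, b, c) =
     of_real x1 + of_bool (a = b) * of_real x2 + of_bool (a = c) * of_real x3 + of_bool (b = c) * of_real x4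
      + of_bool (a = c) * (of_bool (b = c) * of_real x5) + of_bool (a = c) * (of_bool (b = c) * of_real x6)" for a b
    unfolding invariant_op_nth by (auto simp: of_bool_def)
  then show ?thesis
    using True by (simp add: sum.distrib power2_eq_square algebra_simps flip: sum_distrib_left)
qed

text \<open>Tracing an invariant operator over A and B leaves a multiple of the identity on C. So
  \<open>\<rho>\<close> enters only through its trace, and a dual bound is uniform over all
  instruments.\<close>

lemma trace_invariant_op_mult_on_C:
  "trace (invariant_op x1 x2 x3 x4 x5 x6 ** D_block (on_C \<rho>) k) =
    of_real ((real CARD('n::finite))\<^sup>2 * x1 + real CARD('n) * (x2 + x3 + x4) + x5 + x6) * trace (\<rho> :: 'n operator)"
proof -
  let ?M = "invariant_op x1 x2 x3 x4 x5 x6 :: ('n \<times> 'n \<times> 'n) operator"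
  have "trace (?M ** D_block (on_C \<rho>) k) = (\<Sum>a\<in>UNIV. \<Sum>b\<in>UNIV. \<Sum>c\<in>UNIV. \<Sum>a'\<in>UNIV. of_bool (a' = a) *
     (\<Sum>b'\<in>UNIV. of_bool (b' = b) * (\<Sum>c'\<in>UNIV. ?M $ (a, b, c) $ (a', b', c') * \<rho> $ c' $ c)))"
    unfolding trace_mult sum_UNIV_prod D_block_nth on_C_nth sum_distrib_left
    by (simp add: mult_ac)
  also have "\<dots> = (\<Sum>a\<in>UNIV. \<Sum>b\<in>UNIV. \<Sum>c\<in>UNIV. \<Sum>c'\<in>UNIV. ?M $ (a, b, c) $ (a, b, c') * \<rho> $ c' $ c)"
    by simp
  also have "\<dots> = (\<Sum>a\<in>UNIV. \<Sum>c\<in>UNIV. \<Sum>b\<in>UNIV. \<Sum>c'\<in>UNIV. ?M $ (a, b, c) $ (a, b, c') * \<rho> $ c' $ c)"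
    by (intro sum.cong refl sum.swap)
  also have "\<dots> = (\<Sum>c\<in>UNIV. \<Sum>a\<in>UNIV. \<Sum>b\<in>UNIV. \<Sum>c'\<in>UNIV. ?M $ (a, b, c) $ (a, b, c') * \<rho> $ c' $ c)"
    by (rule sum.swap)
  also have "\<dots> = (\<Sum>c\<in>UNIV. \<Sum>a\<in>UNIV. \<Sum>c'\<in>UNIV. \<Sum>b\<in>UNIV. ?M $ (a, b, c) $ (a, b, c') * \<rho> $ c' $ c)"
    by (intro sum.cong refl sum.swap)
  also have "\<dots> = (\<Sum>c\<in>UNIV. \<Sum>c'\<in>UNIV. (\<Sum>a\<in>UNIV. \<Sum>b\<in>UNIV. ?M $ (a, b, c) $ (a, b, c')) * \<rho> $ c' $ c)"
    unfolding sum_distrib_right by (intro sum.cong refl sum.swap)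
  finally show ?thesis
    unfolding partial_trace_invariant_op
    by (simp add: mult.assoc trace_def flip: sum_distrib_left)
qed

text \<open>The fidelity sees only the diagonal blocks in D, so an optimal instrument can be sought
  among those that treat D as a classical register.\<close>

definition D_diagonal :: "('n::finite \<Rightarrow> ('n \<times> 'n \<times> 'n) operator) \<Rightarrow> ('n \<times> 'n \<times> 'n \<times> 'n) operator" where
  "D_diagonal M = (\<chi> p q. case (p, q) of ((a, b, c, k), (a', b', c', k')) \<Rightarrow>
     of_bool (k = k') * M k $ (a, b, c) $ (a', b', c'))"

lemma D_diagonal_nth:
  "D_diagonal M $ (a, b, c, k) $ (a', b', c', k') = of_bool (k = k') * M k $ (a, b, c) $ (a', b', c')"
  by (simp add: D_diagonal_def)

lemma D_block_D_diagonal: "D_block (D_diagonal M) k = M k"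
  by (rule operator_eqI) (simp add: D_diagonal_nth)

lemma sum_nonneg_Reals:
  assumes "\<And>x. x \<in> A \<Longrightarrow> f x \<in> (\<real>\<^sub>\<ge>\<^sub>0 :: complex set)"
  shows "(\<Sum>x\<in>A. f x) \<in> \<real>\<^sub>\<ge>\<^sub>0"
  using assms by (induction A rule: infinite_finite_induct) (auto intro: nonneg_Reals_add_I)

lemma positive_semidefinite_D_diagonal:
  assumes "\<And>k. positive_semidefinite (M k)"
  shows "positive_semidefinite (D_diagonal M)"
  unfolding positive_semidefinite_def
proof
  fix v :: "complex ^ ('a \<times> 'a \<times> 'a \<times> 'a)"
  define w where "w k = (\<chi> p. v $ (fst p, fst (snd p), snd (snd p), k))" for k
  let ?G = "\<lambda>a b c k. \<Sum>q\<in>UNIV. cnj (w k $ (a, b, c)) * M k $ (a, b, c) $ q * w k $ q"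
  have e: "cnj (v $ (a, b, c, k)) * D_diagonal M $ (a, b, c, k) $ (a', b', c', k') * v $ (a', b', c', k')
      = of_bool (k = k') * (cnj (v $ (a, b, c, k)) * M k $ (a, b, c) $ (a', b', c') * v $ (a', b', c', k'))"
    for a b c k a' b' c' k'
    unfolding D_diagonal_nth by (simp only: mult_ac)
  have "(\<Sum>p\<in>UNIV. \<Sum>q\<in>UNIV. cnj (v $ p) * D_diagonal M $ p $ q * v $ q)
     = (\<Sum>a\<in>UNIV. \<Sum>b\<in>UNIV. \<Sum>c\<in>UNIV. \<Sum>k\<in>UNIV. ?G a b c k)"
    unfolding sum_UNIV_prod e sum_of_bool_mult w_def vec_lambda_beta fst_conv snd_conv by (rule refl)
  also have "\<dots> = (\<Sum>a\<in>UNIV. \<Sum>b\<in>UNIV. \<Sum>k\<in>UNIV. \<Sum>c\<in>UNIV. ?G a b c k)"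
    by (intro sum.cong refl sum.swap)
  also have "\<dots> = (\<Sum>a\<in>UNIV. \<Sum>k\<in>UNIV. \<Sum>b\<in>UNIV. \<Sum>c\<in>UNIV. ?G a b c k)"
    by (intro sum.cong refl sum.swap)
  also have "\<dots> = (\<Sum>k\<in>UNIV. \<Sum>a\<in>UNIV. \<Sum>b\<in>UNIV. \<Sum>c\<in>UNIV. ?G a b c k)"
    by (rule sum.swap)
  also have "\<dots> = (\<Sum>k\<in>UNIV. \<Sum>p\<in>UNIV. \<Sum>q\<in>UNIV. cnj (w k $ p) * M k $ p $ q * w k $ q)"
    by (simp only: sum_UNIV_prod)
  also have "\<dots> \<in> \<real>\<^sub>\<ge>\<^sub>0"
    by (rule sum_nonneg_Reals) (use assms in \<open>simp add: positive_semidefinite_def\<close>)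
  finally show "(\<Sum>p\<in>UNIV. \<Sum>q\<in>UNIV. cnj (v $ p) * D_diagonal M $ p $ q * v $ q) \<in> \<real>\<^sub>\<ge>\<^sub>0" .
qed

lemma sum_triple_product:
  "(\<Sum>a\<in>A. \<Sum>b\<in>B. \<Sum>c\<in>C. f a * (g b * h c)) = sum f A * (sum g B * (sum h C :: 'a::comm_semiring_1))"
  unfolding sum_distrib_left[symmetric] sum_distrib_right[symmetric] by (rule refl)

text \<open>Orthonormality of the columns turns each of the six patterns into Kronecker symbols of
  the outcomes. The value is thus the same for every U, and its Haar average is immediate.\<close>

lemma trace_outcome_invariant_op:
  assumes "unitary U"
  shows "trace (outer (outcome_vector U i j k) ** invariant_op x1 x2 x3 x4 x5 x6) =
    of_real (x1 + of_bool (i = j) * x2 + of_bool (i = k) * x3 + of_bool (j = k) * x4 + of_bool (i = j \<and> j = k) * (x5 + x6))"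
proof -
  let ?F = "\<lambda>a b c a' b' c'. U $ a $ i * (U $ b $ j * (cnj (U $ c $ k) * (cnj (U $ a' $ i) * (cnj (U $ b' $ j) * U $ c' $ k))))"
  let ?T = "\<lambda>P. \<Sum>a\<in>UNIV. \<Sum>b\<in>UNIV. \<Sum>c\<in>UNIV. \<Sum>a'\<in>UNIV. \<Sum>b'\<in>UNIV. \<Sum>c'\<in>UNIV. of_bool (P a b c a' b' c') * ?F a b c a' b' c'"
  have n: "(\<Sum>a\<in>UNIV. U $ a $ i * cnj (U $ a $ j)) = of_bool (i = j)" for i j
    using unitary_columns[OF assms, of j i] by (simp add: mult.commute eq_commute)
  have of_bool: "of_bool P = complex_of_real (of_bool P)" for P
    by (cases P) simp_all
  have T1: "?T (\<lambda>a b c a' b' c'. a = a' \<and> b = b' \<and> c = c') = 1"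
  proof -
    have "?T (\<lambda>a b c a' b' c'. a = a' \<and> b = b' \<and> c = c') = (\<Sum>a\<in>UNIV. \<Sum>b\<in>UNIV. \<Sum>c\<in>UNIV.
      \<Sum>a'\<in>UNIV. of_bool (a = a') * (\<Sum>b'\<in>UNIV. of_bool (b = b') * (\<Sum>c'\<in>UNIV. of_bool (c = c') * ?F a b c a' b' c')))"
      unfolding sum_distrib_left of_bool_conj mult.assoc by (rule refl)
    also have "\<dots> = (\<Sum>a\<in>UNIV. \<Sum>b\<in>UNIV. \<Sum>c\<in>UNIV. ?F a b c a b c)"
      unfolding sum_of_bool_mult by (rule refl)
    also have "\<dots> = (\<Sum>a\<in>UNIV. \<Sum>b\<in>UNIV. \<Sum>c\<in>UNIV. (U $ a $ i * cnj (U $ a $ i)) * ((U $ b $ j * cnj (U $ b $ j)) * (U $ c $ k * cnj (U $ c $ k))))"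
      by (simp only: mult_ac)
    finally show ?thesis unfolding sum_triple_product n by simp
  qed
  have T2: "?T (\<lambda>a b c a' b' c'. a = b' \<and> b = a' \<and> c = c') = of_bool (i = j)"
  proof -
    have "?T (\<lambda>a b c a' b' c'. a = b' \<and> b = a' \<and> c = c') = (\<Sum>a\<in>UNIV. \<Sum>b\<in>UNIV. \<Sum>c\<in>UNIV.
      \<Sum>a'\<in>UNIV. of_bool (b = a') * (\<Sum>b'\<in>UNIV. of_bool (a = b') * (\<Sum>c'\<in>UNIV. of_bool (c = c') * ?F a b c a' b' c')))"
      unfolding sum_distrib_left of_bool_conj by (simp only: mult_ac)
    also have "\<dots> = (\<Sum>a\<in>UNIV. \<Sum>b\<in>UNIV. \<Sum>c\<in>UNIV. ?F a b c b a c)"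
      unfolding sum_of_bool_mult by (rule refl)
    also have "\<dots> = (\<Sum>a\<in>UNIV. \<Sum>b\<in>UNIV. \<Sum>c\<in>UNIV. (U $ a $ i * cnj (U $ a $ j)) * ((U $ b $ j * cnj (U $ b $ i)) * (U $ c $ k * cnj (U $ c $ k))))"
      by (simp only: mult_ac)
    finally show ?thesis unfolding sum_triple_product n by (cases "i = j") simp_all
  qed
  have T3: "?T (\<lambda>a b c a' b' c'. a = c \<and> a' = c' \<and> b = b') = of_bool (i = k)"
  proof -
    have "?T (\<lambda>a b c a' b' c'. a = c \<and> a' = c' \<and> b = b') = (\<Sum>a\<in>UNIV. \<Sum>b\<in>UNIV. \<Sum>c\<in>UNIV. of_bool (a = c) *
      (\<Sum>a'\<in>UNIV. \<Sum>b'\<in>UNIV. of_bool (b = b') * (\<Sum>c'\<in>UNIV. of_bool (a' = c') * ?F a b c a' b' c')))"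
      unfolding sum_distrib_left of_bool_conj by (simp only: mult_ac)
    also have "\<dots> = (\<Sum>a\<in>UNIV. \<Sum>b\<in>UNIV. \<Sum>a'\<in>UNIV. ?F a b a a' b a')"
      unfolding sum_of_bool_mult by (rule refl)
    also have "\<dots> = (\<Sum>a\<in>UNIV. \<Sum>b\<in>UNIV. \<Sum>c\<in>UNIV. (U $ a $ i * cnj (U $ a $ k)) * ((U $ b $ j * cnj (U $ b $ j)) * (U $ c $ k * cnj (U $ c $ i))))"
      by (simp only: mult_ac)
    finally show ?thesis unfolding sum_triple_product n by (cases "i = k") simp_all
  qed
  have T4: "?T (\<lambda>a b c a' b' c'. b = c \<and> b' = c' \<and> a = a') = of_bool (j = k)"
  proof -
    have "?T (\<lambda>a b c a' b' c'. b = c \<and> b' = c' \<and> a = a') = (\<Sum>a\<in>UNIV. \<Sum>b\<in>UNIV. \<Sum>c\<in>UNIV. of_bool (b = c) *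
      (\<Sum>a'\<in>UNIV. of_bool (a = a') * (\<Sum>b'\<in>UNIV. \<Sum>c'\<in>UNIV. of_bool (b' = c') * ?F a b c a' b' c')))"
      unfolding sum_distrib_left of_bool_conj by (simp only: mult_ac)
    also have "\<dots> = (\<Sum>a\<in>UNIV. \<Sum>b\<in>UNIV. \<Sum>b'\<in>UNIV. ?F a b b a b' b')"
      unfolding sum_of_bool_mult by (rule refl)
    also have "\<dots> = (\<Sum>a\<in>UNIV. \<Sum>b\<in>UNIV. \<Sum>c\<in>UNIV. (U $ a $ i * cnj (U $ a $ i)) * ((U $ b $ j * cnj (U $ b $ k)) * (U $ c $ k * cnj (U $ c $ j))))"
      by (simp only: mult_ac)
    finally show ?thesis unfolding sum_triple_product n by (cases "j = k") simp_all
  qed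
  have T5: "?T (\<lambda>a b c a' b' c'. a = c \<and> b' = c' \<and> b = a') = of_bool (i = j \<and> j = k)"
  proof -
    have "?T (\<lambda>a b c a' b' c'. a = c \<and> b' = c' \<and> b = a') = (\<Sum>a\<in>UNIV. \<Sum>b\<in>UNIV. \<Sum>c\<in>UNIV. of_bool (a = c) *
      (\<Sum>a'\<in>UNIV. of_bool (b = a') * (\<Sum>b'\<in>UNIV. \<Sum>c'\<in>UNIV. of_bool (b' = c') * ?F a b c a' b' c')))"
      unfolding sum_distrib_left of_bool_conj by (simp only: mult_ac)
    also have "\<dots> = (\<Sum>a\<in>UNIV. \<Sum>b\<in>UNIV. \<Sum>b'\<in>UNIV. ?F a b a b b' b')"
      unfolding sum_of_bool_mult by (rule refl)
    also have "\<dots> = (\<Sum>a\<in>UNIV. \<Sum>b\<in>UNIV. \<Sum>c\<in>UNIV. (U $ a $ i * cnj (U $ a $ k)) * ((U $ b $ j * cnj (U $ b $ i)) * (U $ c $ k * cnj (U $ c $ j))))"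
      by (simp only: mult_ac)
    also have "\<dots> = of_bool (i = k \<and> j = i \<and> k = j)"
      unfolding sum_triple_product n of_bool_conj by (rule refl)
    also have "(i = k \<and> j = i \<and> k = j) = (i = j \<and> j = k)"
      by blast
    finally show ?thesis .
  qed
  have T6: "?T (\<lambda>a b c a' b' c'. b = c \<and> a' = c' \<and> a = b') = of_bool (i = j \<and> j = k)"
  proof -
    have "?T (\<lambda>a b c a' b' c'. b = c \<and> a' = c' \<and> a = b') = (\<Sum>a\<in>UNIV. \<Sum>b\<in>UNIV. \<Sum>c\<in>UNIV. of_bool (b = c) *
      (\<Sum>a'\<in>UNIV. \<Sum>b'\<in>UNIV. of_bool (a = b') * (\<Sum>c'\<in>UNIV. of_bool (a' = c') * ?F a b c a' b' c')))"
      unfolding sum_distrib_left of_bool_conj by (simp only: mult_ac)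
    also have "\<dots> = (\<Sum>a\<in>UNIV. \<Sum>b\<in>UNIV. \<Sum>a'\<in>UNIV. ?F a b b a' a a')"
      unfolding sum_of_bool_mult by (rule refl)
    also have "\<dots> = (\<Sum>a\<in>UNIV. \<Sum>b\<in>UNIV. \<Sum>c\<in>UNIV. (U $ a $ i * cnj (U $ a $ j)) * ((U $ b $ j * cnj (U $ b $ k)) * (U $ c $ k * cnj (U $ c $ i))))"
      by (simp only: mult_ac)
    also have "\<dots> = of_bool (i = j \<and> j = k \<and> k = i)"
      unfolding sum_triple_product n of_bool_conj by (rule refl)
    also have "(i = j \<and> j = k \<and> k = i) = (i = j \<and> j = k)"
      by blast
    finally show ?thesis .
  qed
  have "trace (outer (outcome_vector U i j k) ** invariant_op x1 x2 x3 x4 x5 x6) =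
      of_real x1 * ?T (\<lambda>a b c a' b' c'. a = a' \<and> b = b' \<and> c = c') + of_real x2 * ?T (\<lambda>a b c a' b' c'. a = b' \<and> b = a' \<and> c = c')
    + of_real x3 * ?T (\<lambda>a b c a' b' c'. a = c \<and> a' = c' \<and> b = b') + of_real x4 * ?T (\<lambda>a b c a' b' c'. b = c \<and> b' = c' \<and> a = a')
    + of_real x5 * ?T (\<lambda>a b c a' b' c'. a = c \<and> b' = c' \<and> b = a') + of_real x6 * ?T (\<lambda>a b c a' b' c'. b = c \<and> a' = c' \<and> a = b')"
    unfolding trace_outer_mult sum_UNIV_prod outcome_vector_nth invariant_op_nth complex_cnj_mult complex_cnj_cnj
      sum_distrib_left sum.distrib[symmetric] distrib_left distrib_right
    by (simp only: mult_ac)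
  then show ?thesis
    unfolding T1 T2 T3 T4 T5 T6 unfolding of_bool 
    by (simp only: of_real_add of_real_mult mult_1_left mult_1_right ring_distribs mult_ac add_ac)
qed

section \<open>The dual bound and an optimal instrument\<close>

lemma invariant_op_cong:
  "x1 = y1 \<Longrightarrow> x2 = y2 \<Longrightarrow> x3 = y3 \<Longrightarrow> x4 = y4 \<Longrightarrow> x5 = y5 \<Longrightarrow> x6 = y6 \<Longrightarrow>
    invariant_op x1 x2 x3 x4 x5 x6 = invariant_op y1 y2 y3 y4 y5 y6"
  by (simp only:)

lemma invariant_op_scaleR:
  "c *\<^sub>R invariant_op x1 x2 x3 x4 x5 x6
    = invariant_op (c * x1) (c * x2) (c * x3) (c * x4) (c * x5) (c * x6)"
  by (rule operator_eqI, simp only: vector_scaleR_component invariant_op_nth)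
    (simp only: scaleR_conv_of_real of_real_mult distrib_left mult.assoc)

text \<open>The row i = k has one exceptional entry, at j = k; every other row has two, at j = i and
  j = k.\<close>

lemma sum_pattern:
  fixes A B C D E :: "'b::real_vector" and k :: "'n::finite"
  assumes "CARD('n) \<ge> 2"
  shows "(\<Sum>i\<in>UNIV. \<Sum>j\<in>UNIV. if i = j then (if i = k then A else B) else if i = k then C else if j = k then D else E)
    = A + (real CARD('n) - 1) *\<^sub>R (B + C + D) + ((real CARD('n) - 1) * (real CARD('n) - 2)) *\<^sub>R E"
    (is "(\<Sum>i\<in>UNIV. \<Sum>j\<in>UNIV. ?f i j) = _")
proof -
  let ?n = "real CARD('n)"
  have k: "(\<Sum>j\<in>UNIV. ?f k j) = A + (?n - 1) *\<^sub>R C"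
    using sum_eq_except_one[of k "\<lambda>j. ?f k j" C] by simp
  have "(\<Sum>j\<in>UNIV. ?f i j) = B + D + (?n - 2) *\<^sub>R E" if "i \<noteq> k" for i
    using sum_eq_except_two[of i k "\<lambda>j. ?f i j" E] that by simp
  then have "(\<Sum>i\<in>UNIV. \<Sum>j\<in>UNIV. ?f i j) = (\<Sum>j\<in>UNIV. ?f k j) + (?n - 1) *\<^sub>R (B + D + (?n - 2) *\<^sub>R E)"
    by (intro sum_eq_except_one[of k "\<lambda>i. \<Sum>j\<in>UNIV. ?f i j"])
  then show ?thesis
    unfolding k by (simp add: scaleR_right_distrib)
qed

lemma trace_add_mult: "trace ((A + B) ** R) = trace (A ** R) + trace (B ** R)"
  by (simp add: trace_mult distrib_right sum.distrib)

context haar_ge_2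
begin

text \<open>\<open>\<alpha>\<close> and \<open>\<beta>\<close> weight the traceless symmetric and
  antisymmetric tensors. Two rank-one terms suffice for the rest, since a positive form on a
  two-dimensional multiplicity space has rank at most 2.\<close>

lemma trace_positive_cone:
  defines "d \<equiv> real CARD('n)"
  assumes "\<alpha> \<ge> 0" "\<beta> \<ge> 0" "\<gamma> \<ge> 0" "\<delta> \<ge> 0"
  shows "trace_positive (invariant_op (\<alpha> * (d + 1) + \<beta> * (d - 1)) (\<alpha> * (d + 1) - \<beta> * (d - 1))
    (- \<alpha> - \<beta> + \<gamma> * y\<^sup>2 + \<delta> * y'\<^sup>2) (- \<alpha> - \<beta> + \<gamma> * z\<^sup>2 + \<delta> * z'\<^sup>2)
    (- \<alpha> + \<beta> + \<gamma> * (y * z) + \<delta> * (y' * z')) (- \<alpha> + \<beta> + \<gamma> * (y * z) + \<delta> * (y' * z')) :: ('n \<times> 'n \<times> 'n) operator)"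
    (is "trace_positive ?M")
proof -
  have "trace_positive (\<alpha> *\<^sub>R invariant_op (d + 1) (d + 1) (-1) (-1) (-1) (-1) + \<beta> *\<^sub>R invariant_op (d - 1) (- (d - 1)) (-1) (-1) 1 1
     + \<gamma> *\<^sub>R invariant_op 0 0 (y\<^sup>2) (z\<^sup>2) (y * z) (y * z) + \<delta> *\<^sub>R invariant_op 0 0 (y'\<^sup>2) (z'\<^sup>2) (y' * z') (y' * z')
      :: ('n \<times> 'n \<times> 'n) operator)"
    unfolding invariant_op_scaleR d_def
    by (intro trace_positive_add trace_positive_invariant_op_scale trace_positive_symmetric
        trace_positive_antisymmetric trace_positive_entangled assms)
  also have "\<alpha> *\<^sub>R invariant_op (d + 1) (d + 1) (-1) (-1) (-1) (-1) + \<beta> *\<^sub>R invariant_op (d - 1) (- (d - 1)) (-1) (-1) 1 1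
     + \<gamma> *\<^sub>R invariant_op 0 0 (y\<^sup>2) (z\<^sup>2) (y * z) (y * z) + \<delta> *\<^sub>R invariant_op 0 0 (y'\<^sup>2) (z'\<^sup>2) (y' * z') (y' * z') = ?M"
    unfolding invariant_op_scaleR invariant_op_add by (rule invariant_op_cong) (simp_all add: algebra_simps)
  finally show ?thesis .
qed

text \<open>The weight of the antisymmetric traceless tensors in the dual optimum. For \<open>d = 2\<close> there are none,
  and any sufficiently large weight would do.\<close>

definition dual_weight :: real where
  "dual_weight = (let d = real CARD('n) in
     if CARD('n) = 2 then moment_scale d * (d + 2) / (2 * (d - 1)) else moment_scale d * (d + 2) / (2 * (d - 2)))"

text \<open>On the two copies of the dual representation, spanned by the vectors \<open>e\<^sub>x\<close> and \<open>f\<^sub>x\<close> maximally entangled on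
  \<open>AC\<close> and \<open>BC\<close>, the dual operator is diagonal in the basis \<open>e\<^sub>x \<plusminus> f\<^sub>x\<close>, with coefficients \<open>u\<close> and \<open>v\<close>: \<open>u\<close> is the least
  value dominating the case \<open>i = j = k\<close>, and then \<open>v\<close> the least one dominating \<open>i = k \<noteq> j\<close>.\<close>

definition dual_op :: "('n \<times> 'n \<times> 'n) operator" where
  "dual_op = (let d = real CARD('n); s = moment_scale d; l = dual_weight;
       u = 1 / (d * (d + 1)\<^sup>2); v = 1 / (3 * d * (d - 1)\<^sup>2) in
     invariant_op (s * (d + 1) + l * (d - 1)) (s * (d + 1) - l * (d - 1))
       (- s - l + u + v) (- s - l + u + v) (- s + l + u - v) (- s + l + u - v))"

lemma outcome_op_dominated: "\<exists>D. trace_positive D \<and> outcome_op i j k + D = dual_op"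
proof -
  define d where "d = real CARD('n)"
  \<comment> \<open>A common factor: \<open>moment_scale d\<close> and both coefficients of the 2 by
    2 block are polynomials in d times \<open>\<tau>\<close>, so comparing coefficients becomes a
    matter of ring identities.\<close>
  define \<tau> where "\<tau> = 1 / (3 * d * (d\<^sup>2 - 1)\<^sup>2 * (d + 2))"
  have d: "d \<ge> 2"
    using card_ge_2 by (simp add: d_def)
  have sq: "d\<^sup>2 - 1 = (d - 1) * (d + 1)"
    by (simp add: algebra_simps power2_eq_square)
  have \<tau>: "\<tau> > 0"
    using d unfolding \<tau>_def sq by simp
  have s: "moment_scale d = 3 * \<tau> * (d\<^sup>2 - 1)"
    using d unfolding moment_scale_def \<tau>_def sq by (simp add: divide_simps power2_eq_square)
  have u: "1 / (d * (d + 1)\<^sup>2) = 3 * \<tau> * (d + 2) * (d - 1)\<^sup>2"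
    using d unfolding \<tau>_def sq by (simp add: divide_simps power2_eq_square)
  have v: "1 / (3 * d * (d - 1)\<^sup>2) = \<tau> * (d + 2) * (d + 1)\<^sup>2"
    using d unfolding \<tau>_def sq by (simp add: divide_simps power2_eq_square)
  define l where "l = dual_weight"
  have l2: "l = 3 * \<tau> * (d + 2) * (d + 1) / 2" if "CARD('n) = 2"
    using that unfolding l_def dual_weight_def Let_def d_def[symmetric] s sq using d by (simp add: divide_simps)
  have l3: "l * (2 * (d - 2)) = 3 * \<tau> * (d\<^sup>2 - 1) * (d + 2)" if "CARD('n) \<noteq> 2"
    using that card_ge_2 unfolding l_def dual_weight_def Let_def d_def[symmetric] s by (simp add: d_def)
  \<comment> \<open>The bound is the antisymmetric weight
    \<open>moment_scale d * (d + 2) / (2 * (d - 1))\<close> of the averages in which k meets exactly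
    one of i, j. It is attained for d = 2.\<close>
  have l_ge: "l \<ge> 3 * \<tau> * (d + 2) * (d + 1) / 2"
  proof (cases "CARD('n) = 2")
    case False
    then have d3: "d - 2 > 0"
      using card_ge_2 by (simp add: d_def)
    have "l * (2 * (d - 2)) = 3 * \<tau> * (d + 2) * (d + 1) / 2 * (2 * (d - 2)) + 3 * \<tau> * (d + 2) * (d + 1)"
      unfolding l3[OF False] sq by (simp add: field_simps)
    moreover have "3 * \<tau> * (d + 2) * (d + 1) \<ge> 0"
      using \<tau> d by simp
    ultimately have "3 * \<tau> * (d + 2) * (d + 1) / 2 * (2 * (d - 2)) \<le> l * (2 * (d - 2))"
      by linarith
    then show ?thesis
      using d3 by (simp add: mult_le_cancel_right)
  qed (simp add: l2)
  have l0: "l \<ge> 0"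
    using l_ge \<tau> d by (smt (verit) divide_nonneg_pos mult_nonneg_nonneg)
  have dual: "dual_op = invariant_op (3 * \<tau> * (d\<^sup>2 - 1) * (d + 1) + l * (d - 1)) (3 * \<tau> * (d\<^sup>2 - 1) * (d + 1) - l * (d - 1))
     (- (3 * \<tau> * (d\<^sup>2 - 1)) - l + 3 * \<tau> * (d + 2) * (d - 1)\<^sup>2 + \<tau> * (d + 2) * (d + 1)\<^sup>2)
     (- (3 * \<tau> * (d\<^sup>2 - 1)) - l + 3 * \<tau> * (d + 2) * (d - 1)\<^sup>2 + \<tau> * (d + 2) * (d + 1)\<^sup>2)
     (- (3 * \<tau> * (d\<^sup>2 - 1)) + l + 3 * \<tau> * (d + 2) * (d - 1)\<^sup>2 - \<tau> * (d + 2) * (d + 1)\<^sup>2)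
     (- (3 * \<tau> * (d\<^sup>2 - 1)) + l + 3 * \<tau> * (d + 2) * (d - 1)\<^sup>2 - \<tau> * (d + 2) * (d + 1)\<^sup>2)"
    unfolding dual_op_def Let_def l_def[symmetric] d_def[symmetric] s u v by (rule refl)
  note cone = trace_positive_cone[folded d_def]
  consider "i = j" "j = k" | "i = j" "j \<noteq> k" | "i = k" "j \<noteq> k" | "j = k" "i \<noteq> k" | "i \<noteq> j" "i \<noteq> k" "j \<noteq> k"
    by blast
  then show ?thesis
  proof cases
    case 1
    \<comment> \<open>The outcome vector is symmetric in A, B, so the term along
      \<open>e_x - f_x\<close> survives in full, while the one along \<open>e_x + f_x\<close>
      cancels by the choice of its coefficient in \<open>dual_op\<close>.\<close>
    have "trace_positive (invariant_op (6 * \<tau> * (d - 1) * (d + 1) + l * (d - 1)) (6 * \<tau> * (d - 1) * (d + 1) - l * (d - 1))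
       (- (6 * \<tau> * (d - 1)) - l + \<tau> * (d + 2) * (d + 1)\<^sup>2 * 1\<^sup>2 + 0 * 0\<^sup>2) (- (6 * \<tau> * (d - 1)) - l + \<tau> * (d + 2) * (d + 1)\<^sup>2 * (-1)\<^sup>2 + 0 * 0\<^sup>2)
       (- (6 * \<tau> * (d - 1)) + l + \<tau> * (d + 2) * (d + 1)\<^sup>2 * (1 * (-1)) + 0 * (0 * 0))
       (- (6 * \<tau> * (d - 1)) + l + \<tau> * (d + 2) * (d + 1)\<^sup>2 * (1 * (-1)) + 0 * (0 * 0)) :: ('n \<times> 'n \<times> 'n) operator)"
      (is "trace_positive ?D")
      using \<tau> d l0 by (intro cone) auto
    moreover have "outcome_op i j k + ?D = dual_op"
      unfolding 1 outcome_op_same Let_def d_def[symmetric] s dual invariant_op_add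
      by (rule invariant_op_cong) (simp_all add: algebra_simps power2_eq_square)
    ultimately show ?thesis by blast
  next
    case 2
    \<comment> \<open>The average is exactly the symmetric traceless part of \<open>dual_op\<close>;
      all other parts remain as slack.\<close>
    have "trace_positive (invariant_op (0 * (d + 1) + l * (d - 1)) (0 * (d + 1) - l * (d - 1))
       (- 0 - l + 3 * \<tau> * (d + 2) * (d - 1)\<^sup>2 * 1\<^sup>2 + \<tau> * (d + 2) * (d + 1)\<^sup>2 * 1\<^sup>2)
       (- 0 - l + 3 * \<tau> * (d + 2) * (d - 1)\<^sup>2 * 1\<^sup>2 + \<tau> * (d + 2) * (d + 1)\<^sup>2 * (-1)\<^sup>2)
       (- 0 + l + 3 * \<tau> * (d + 2) * (d - 1)\<^sup>2 * (1 * 1) + \<tau> * (d + 2) * (d + 1)\<^sup>2 * (1 * (-1)))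
       (- 0 + l + 3 * \<tau> * (d + 2) * (d - 1)\<^sup>2 * (1 * 1) + \<tau> * (d + 2) * (d + 1)\<^sup>2 * (1 * (-1))) :: ('n \<times> 'n \<times> 'n) operator)"
      (is "trace_positive ?D")
      using \<tau> d l0 by (intro cone) auto
    moreover have "outcome_op i j k + ?D = dual_op"
      unfolding 2(1) outcome_op_two_equal(1)[OF 2(2)] d_def[symmetric] s dual invariant_op_add
      by (rule invariant_op_cong) (simp_all add: algebra_simps power2_eq_square)
    ultimately show ?thesis by blast
  next
    case 3
    \<comment> \<open>For the second coefficient of the block to be least, the slack there must be
      singular. It is a multiple of the rank-one form of \<open>(d - 2) e_x + (2 d - 1) f_x\<close>;
      since \<open>e_x\<close> and \<open>f_x\<close> have squared norm d and inner product 1, the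
      orthogonal direction is \<open>2 e_x - f_x\<close>.\<close>
    let ?\<alpha> = "3 * \<tau> * (d - 1) * (d + 2) / 2" and ?\<beta> = "l - 3 * \<tau> * (d + 2) * (d + 1) / 2"
    have "trace_positive (invariant_op (?\<alpha> * (d + 1) + ?\<beta> * (d - 1)) (?\<alpha> * (d + 1) - ?\<beta> * (d - 1))
       (- ?\<alpha> - ?\<beta> + (d + 2) * \<tau> * (d - 2)\<^sup>2 + 0 * 0\<^sup>2) (- ?\<alpha> - ?\<beta> + (d + 2) * \<tau> * (2 * d - 1)\<^sup>2 + 0 * 0\<^sup>2)
       (- ?\<alpha> + ?\<beta> + (d + 2) * \<tau> * ((d - 2) * (2 * d - 1)) + 0 * (0 * 0))
       (- ?\<alpha> + ?\<beta> + (d + 2) * \<tau> * ((d - 2) * (2 * d - 1)) + 0 * (0 * 0)) :: ('n \<times> 'n \<times> 'n) operator)"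
      (is "trace_positive ?D")
      using \<tau> d l_ge by (intro cone) auto
    moreover have "outcome_op i j k + ?D = dual_op"
      unfolding 3(1) outcome_op_two_equal(2)[OF 3(2)] d_def[symmetric] s dual invariant_op_add
      by (rule invariant_op_cong) (simp_all add: field_simps power2_eq_square)
    ultimately show ?thesis by blast
  next
    case 4
    let ?\<alpha> = "3 * \<tau> * (d - 1) * (d + 2) / 2" and ?\<beta> = "l - 3 * \<tau> * (d + 2) * (d + 1) / 2"
    have "trace_positive (invariant_op (?\<alpha> * (d + 1) + ?\<beta> * (d - 1)) (?\<alpha> * (d + 1) - ?\<beta> * (d - 1))
       (- ?\<alpha> - ?\<beta> + (d + 2) * \<tau> * (2 * d - 1)\<^sup>2 + 0 * 0\<^sup>2) (- ?\<alpha> - ?\<beta> + (d + 2) * \<tau> * (d - 2)\<^sup>2 + 0 * 0\<^sup>2)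
       (- ?\<alpha> + ?\<beta> + (d + 2) * \<tau> * ((2 * d - 1) * (d - 2)) + 0 * (0 * 0))
       (- ?\<alpha> + ?\<beta> + (d + 2) * \<tau> * ((2 * d - 1) * (d - 2)) + 0 * (0 * 0)) :: ('n \<times> 'n \<times> 'n) operator)"
      (is "trace_positive ?D")
      using \<tau> d l_ge by (intro cone) auto
    moreover have "outcome_op i j k + ?D = dual_op"
      unfolding 4(1) outcome_op_two_equal(3)[OF 4(2)] d_def[symmetric] s dual invariant_op_add
      by (rule invariant_op_cong) (simp_all add: field_simps power2_eq_square)
    ultimately show ?thesis by blast
  next
    case 5
    have N: "CARD('n) \<ge> 3"
      using card_mono[of UNIV "{i, j, k}"] 5 by simp
    define t where "t = 3 * \<tau> * (d\<^sup>2 - 1) / (d - 2)"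
    have t: "t * (d - 2) = 3 * \<tau> * (d\<^sup>2 - 1)"
      using N by (simp add: t_def d_def)
    have "l * (2 * (d - 2)) = t * (d - 2) * (d + 2)"
      using l3 N unfolding t by simp
    also have "\<dots> = (t * (d + 2) / 2) * (2 * (d - 2))"
      by (simp add: algebra_simps)
    finally have "l * (2 * (d - 2)) = (t * (d + 2) / 2) * (2 * (d - 2))" .
    then have l: "l = t * (d + 2) / 2"
      using N by (simp add: d_def)
    have t0: "t \<ge> 0"
      using \<tau> d unfolding t_def sq by simp
    \<comment> \<open>The antisymmetric part is used up, which is the origin of
      \<open>dual_weight\<close>. The symmetric part keeps half its weight, and the 2 by 2 block is
      untouched because the outcome vector contracts to 0 on AC and BC.\<close>
    have "trace_positive (invariant_op (t * (d - 2) / 2 * (d + 1) + 0 * (d - 1)) (t * (d - 2) / 2 * (d + 1) - 0 * (d - 1))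
       (- (t * (d - 2) / 2) - 0 + 3 * \<tau> * (d + 2) * (d - 1)\<^sup>2 * 1\<^sup>2 + \<tau> * (d + 2) * (d + 1)\<^sup>2 * 1\<^sup>2)
       (- (t * (d - 2) / 2) - 0 + 3 * \<tau> * (d + 2) * (d - 1)\<^sup>2 * 1\<^sup>2 + \<tau> * (d + 2) * (d + 1)\<^sup>2 * (-1)\<^sup>2)
       (- (t * (d - 2) / 2) + 0 + 3 * \<tau> * (d + 2) * (d - 1)\<^sup>2 * (1 * 1) + \<tau> * (d + 2) * (d + 1)\<^sup>2 * (1 * (-1)))
       (- (t * (d - 2) / 2) + 0 + 3 * \<tau> * (d + 2) * (d - 1)\<^sup>2 * (1 * 1) + \<tau> * (d + 2) * (d + 1)\<^sup>2 * (1 * (-1))) :: ('n \<times> 'n \<times> 'n) operator)"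
      (is "trace_positive ?D")
      using \<tau> d t0 by (intro cone) auto
    moreover have "outcome_op i j k = invariant_op (t * (d\<^sup>2 - 2)) (- (t * d)) (- (t * d)) (- (t * d)) (2 * t) (2 * t)"
      unfolding outcome_op_distinct[OF 5] d_def[symmetric] s t_def by (rule refl)
    then have "outcome_op i j k + ?D = dual_op"
      unfolding dual t[symmetric] l by (simp only: invariant_op_add) (rule invariant_op_cong; simp add: field_simps power2_eq_square)
    ultimately show ?thesis by blast
  qed
qed


section \<open>Weak duality and the upper bound\<close>

definition optimal_value :: real where
  "optimal_value = (let d = real CARD('n) in
     if CARD('n) = 2 then 7 / 12 else (9 * d\<^sup>2 + 16 * d - 17) / (6 * d\<^sup>2 * (d\<^sup>2 - 1)))"

text \<open>The symmetric part contributes \<open>1 / d\<close>, the antisymmetric part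
  \<open>1 / (2 d)\<close> if d is at least 3, and the two eigendirections of the block
  \<open>2 / (d (d + 1))\<close> and \<open>2 / (3 d (d - 1))\<close>. The dimension factor
  \<open>d - 2\<close> removes the antisymmetric term at d = 2.\<close>

lemma trace_dual_op:
  "trace (dual_op ** D_block (on_C \<rho>) k) = of_real (real CARD('n) * optimal_value) * trace \<rho>"
proof -
  define d where "d = real CARD('n)"
  define s where "s = moment_scale d"
  define l where "l = dual_weight"
  define u where "u = 1 / (d * (d + 1)\<^sup>2)"
  define v where "v = 1 / (3 * d * (d - 1)\<^sup>2)"
  have d: "d \<ge> 2"
    using card_ge_2 by (simp add: d_def)
  have dual: "dual_op = invariant_op (s * (d + 1) + l * (d - 1)) (s * (d + 1) - l * (d - 1))
       (- s - l + u + v) (- s - l + u + v) (- s + l + u - v) (- s + l + u - v)"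
    unfolding dual_op_def Let_def s_def l_def u_def v_def d_def by (rule refl)
  have sq: "d\<^sup>2 - 1 = (d - 1) * (d + 1)"
    by (simp add: algebra_simps power2_eq_square)
  have "d\<^sup>2 * (s * (d + 1) + l * (d - 1)) + d * ((s * (d + 1) - l * (d - 1)) + (- s - l + u + v) + (- s - l + u + v))
       + (- s + l + u - v) + (- s + l + u - v)
     = s * ((d - 1) * (d + 1) * (d + 2)) + l * ((d - 1) * (d - 2) * (d + 1)) + u * (2 * (d + 1)) + v * (2 * (d - 1))"
    by (simp add: algebra_simps power2_eq_square)
  also have "s * ((d - 1) * (d + 1) * (d + 2)) = 1 / d"
    using d by (simp add: s_def moment_scale_def)
  also have "u * (2 * (d + 1)) = 2 / (d * (d + 1))"
    using d by (simp add: u_def power2_eq_square divide_simps)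
  also have "v * (2 * (d - 1)) = 2 / (3 * d * (d - 1))"
    using d by (simp add: v_def power2_eq_square divide_simps)
  also have "1 / d + l * ((d - 1) * (d - 2) * (d + 1)) + 2 / (d * (d + 1)) + 2 / (3 * d * (d - 1)) = d * optimal_value"
  proof (cases "CARD('n) = 2")
    case True
    then have "d = 2" by (simp add: d_def)
    then show ?thesis
      using True by (simp add: optimal_value_def)
  next
    case False
    then have d3: "d > 2"
      using card_ge_2 by (simp add: d_def)
    have "l * ((d - 1) * (d - 2) * (d + 1)) = 1 / (2 * d)"
      using False d3 unfolding l_def dual_weight_def Let_def d_def[symmetric] moment_scale_def
      by (simp add: divide_simps)
    moreover have "1 / d + 1 / (2 * d) + 2 / (d * (d + 1)) + 2 / (3 * d * (d - 1)) = d * ((9 * d\<^sup>2 + 16 * d - 17) / (6 * d\<^sup>2 * (d\<^sup>2 - 1)))"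
      using d3 unfolding sq by (simp add: divide_simps power2_eq_square) (simp add: algebra_simps)
    ultimately show ?thesis
      using False by (simp add: optimal_value_def d_def Let_def)
  qed
  finally show ?thesis
    unfolding dual trace_invariant_op_mult_on_C d_def[symmetric]
    by (rule arg_cong[where f = "\<lambda>x. of_real x * trace \<rho>"])
qed

lemma trace_mult_D_block_sum:
  "trace (M ** D_block (\<Sum>x\<in>A. X x) k) = (\<Sum>x\<in>A. trace (M ** D_block (X x) k))"
proof -
  have "D_block (X + Y) k = D_block X k + D_block Y k" "D_block 0 k = 0" for X Y
    by (simp_all add: D_block_def vec_eq_iff)
  then have "trace (M ** D_block 0 k) = 0" "trace (M ** D_block (X + Y) k) = trace (M ** D_block X k) + trace (M ** D_block Y k)" for X Y
    unfolding trace_mult by (simp_all add: distrib_left sum.distrib)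
  from sum_comp_morphism[of "\<lambda>X. trace (M ** D_block X k)", OF this, of X A] show ?thesis
    by (simp add: o_def)
qed

text \<open>Every D-block of \<open>on_C \<rho>\<close> carries the same \<open>\<rho>\<close> of
  trace 1, so each k contributes at most d times the optimum, and the sum over k compensates the
  prefactor \<open>1 / d^2\<close>.\<close>

lemma average_fidelity_le:
  assumes "learning_instrument R"
  shows "average_fidelity \<mu> R \<le> optimal_value"
proof -
  define d where "d = real CARD('n)"
  have d: "d > 0"
    by (simp add: d_def)
  obtain \<rho> where \<rho>: "trace \<rho> = 1" "(\<Sum>i\<in>UNIV. \<Sum>j\<in>UNIV. R i j) = on_C \<rho>"
    and R: "\<And>i j. positive_semidefinite (R i j)"
    using assms by (auto simp: learning_instrument_def)
  have le: "Re (trace (outcome_op i j k ** D_block (R i j) k)) \<le> Re (trace (dual_op ** D_block (R i j) k))" for i j k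
  proof -
    obtain D where D: "trace_positive D" "outcome_op i j k + D = dual_op"
      using outcome_op_dominated by blast
    have "trace (D ** D_block (R i j) k) \<in> \<real>\<^sub>\<ge>\<^sub>0"
      by (rule trace_positiveD[OF D(1) positive_semidefinite_D_block[OF R]])
    then show ?thesis
      unfolding D(2)[symmetric] trace_add_mult by (simp add: complex_nonneg_Reals_iff)
  qed
  have "(\<Sum>i\<in>UNIV. \<Sum>j\<in>UNIV. Re (trace (outcome_op i j k ** D_block (R i j) k))) \<le> d * optimal_value" for k
  proof -
    have "(\<Sum>i\<in>UNIV. \<Sum>j\<in>UNIV. Re (trace (outcome_op i j k ** D_block (R i j) k)))
       \<le> (\<Sum>i\<in>UNIV. \<Sum>j\<in>UNIV. Re (trace (dual_op ** D_block (R i j) k)))"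
      by (intro sum_mono le)
    also have "\<dots> = Re (trace (dual_op ** D_block (\<Sum>i\<in>UNIV. \<Sum>j\<in>UNIV. R i j) k))"
      unfolding trace_mult_D_block_sum by simp
    also have "\<dots> = d * optimal_value"
      unfolding \<rho>(2) trace_dual_op \<rho>(1) by (simp add: d_def)
    finally show ?thesis .
  qed
  then have "(\<Sum>k\<in>UNIV. \<Sum>i\<in>UNIV. \<Sum>j\<in>UNIV. Re (trace (outcome_op i j k ** D_block (R i j) k)))
      \<le> (\<Sum>k\<in>(UNIV :: 'n set). d * optimal_value)"
    by (intro sum_mono)
  also have "\<dots> = d\<^sup>2 * optimal_value"
    by (simp add: d_def power2_eq_square)
  finally show ?thesis
    unfolding average_fidelity_eq d_def[symmetric] using d by (simp add: field_simps)
qed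

text \<open>The blocks are supported on the kernels of the differences between the dual operator and the
  outcome averages; for \<open>i = k \<noteq> j\<close> this is the span of the vectors \<open>2 e\<^sub>x - f\<^sub>x\<close>. For \<open>d = 2\<close> the last case
  does not occur, so its division by \<open>d - 2\<close> is harmless.\<close>

definition optimal_op :: "'n \<Rightarrow> 'n \<Rightarrow> 'n \<Rightarrow> ('n \<times> 'n \<times> 'n) operator" where
  "optimal_op i j k = (let d = real CARD('n);
       m = (4 * d - 5) / (9 * d * (d - 1) * (d + 1)); b = 1 / (2 * d * (d - 1) * (d + 1));
       g = 1 / (9 * d * (d - 1)\<^sup>2); e = 1 / (2 * d * (d - 1)\<^sup>2 * (d - 2)) in
     if i = j then
       if i = k then invariant_op 0 0 m m m m else invariant_op (b * (d + 1)) (b * (d + 1)) (- b) (- b) (- b) (- b)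
     else if i = k then invariant_op 0 0 (4 * g) g (- 2 * g) (- 2 * g)
     else if j = k then invariant_op 0 0 g (4 * g) (- 2 * g) (- 2 * g)
     else invariant_op (e * (d - 1)) (- (e * (d - 1))) (- e) (- e) e e)"

definition optimal_instrument :: "'n \<Rightarrow> 'n \<Rightarrow> ('n \<times> 'n \<times> 'n \<times> 'n) operator" where
  "optimal_instrument i j = D_diagonal (optimal_op i j)"

section \<open>Feasibility and fidelity of the optimal instrument\<close>

lemma positive_semidefinite_optimal_op: "positive_semidefinite (optimal_op i j k)"
proof -
  define d where "d = real CARD('n)"
  have d: "d \<ge> 2"
    using card_ge_2 by (simp add: d_def)
  note cone = trace_positive_imp_positive_semidefinite[OF trace_positive_cone[folded d_def]]
  consider "i = j" "j = k" | "i = j" "i \<noteq> k" | "i = k" "i \<noteq> j" | "j = k" "i \<noteq> j" "i \<noteq> k" | "i \<noteq> j" "i \<noteq> k" "j \<noteq> k"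
    by blast
  then show ?thesis
  proof cases
    case 1
    then show ?thesis
      unfolding optimal_op_def Let_def d_def[symmetric] using d
        cone[of 0 0 "(4 * d - 5) / (9 * d * (d - 1) * (d + 1))" 0 1 0 1 0] by simp
  next
    case 2
    then show ?thesis
      unfolding optimal_op_def Let_def d_def[symmetric] using d
        cone[of "1 / (2 * d * (d - 1) * (d + 1))" 0 0 0 0 0 0 0] by simp
  next
    case 3
    then show ?thesis
      unfolding optimal_op_def Let_def d_def[symmetric] using d
        cone[of 0 0 "1 / (9 * d * (d - 1)\<^sup>2)" 0 2 0 "-1" 0] by (simp add: mult.commute)
  next
    case 4
    then show ?thesis
      unfolding optimal_op_def Let_def d_def[symmetric] using d
        cone[of 0 0 "1 / (9 * d * (d - 1)\<^sup>2)" 0 "-1" 0 2 0] by (simp add: mult.commute)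
  next
    case 5
    then show ?thesis
      unfolding optimal_op_def Let_def d_def[symmetric] using d
        cone[of 0 "1 / (2 * d * (d - 1)\<^sup>2 * (d - 2))" 0 0 0 0 0 0] by simp
  qed
qed

text \<open>Every component must receive weight \<open>1 / d\<close>, and this fixes the constants.
  The traceless symmetric and antisymmetric parts each come from one pattern, giving
  \<open>b\<close> and \<open>e\<close>. In the block, the forms of \<open>2 e_x - f_x\<close> and
  \<open>2 f_x - e_x\<close> add up to 1/2 times that of \<open>e_x + f_x\<close> plus 9/2 times
  that of \<open>e_x - f_x\<close>: the latter alone determines \<open>g\<close>, and
  \<open>m\<close> fills up the former.\<close>

lemma sum_optimal_op:
  "(\<Sum>i\<in>UNIV. \<Sum>j\<in>UNIV. optimal_op i j k) = invariant_op (1 / real CARD('n)) 0 0 0 0 0"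
proof -
  define d where "d = real CARD('n)"
  have d: "d \<ge> 2"
    using card_ge_2 by (simp add: d_def)
  define m where "m = (4 * d - 5) / (9 * d * (d - 1) * (d + 1))"
  define b where "b = 1 / (2 * d * (d - 1) * (d + 1))"
  define g where "g = 1 / (9 * d * (d - 1)\<^sup>2)"
  define e where "e = 1 / (2 * d * (d - 1)\<^sup>2 * (d - 2))"
  \<comment> \<open>All patterns but the last sum to \<open>1 / (2 d)\<close> times identity plus
    swap, and \<open>z\<close> times the form of \<open>e_x - f_x\<close>. The last pattern supplies
    the other half of the identity and cancels the swap and that form.\<close>
  define z where "z = 1 / (2 * d * (d - 1))"
  have bz: "b * (d + 1) = z" and m: "m * (d - 1) = (4 * d - 5) * (2 * z) * (d - 1) / (9 * (d + 1))"
    and g: "(d - 1) * g = 2 * z / 9" and dz: "1 / d = 2 * (d - 1) * z"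
    using d by (simp_all add: z_def b_def m_def g_def power2_eq_square divide_simps)
  have S: "m + (d - 1) * (- b + 4 * g + g) = z" "m + (d - 1) * (- b + g + 4 * g) = z"
    "m + (d - 1) * (- b + - 2 * g + - 2 * g) = - z"
    using d unfolding m_def b_def g_def z_def
    by (simp_all add: power2_eq_square divide_simps) (simp_all add: algebra_simps)
  have "(\<Sum>i\<in>UNIV. \<Sum>j\<in>UNIV. optimal_op i j k) = invariant_op 0 0 m m m m
      + (d - 1) *\<^sub>R (invariant_op (b * (d + 1)) (b * (d + 1)) (- b) (- b) (- b) (- b)
         + invariant_op 0 0 (4 * g) g (- 2 * g) (- 2 * g) + invariant_op 0 0 g (4 * g) (- 2 * g) (- 2 * g))
      + ((d - 1) * (d - 2)) *\<^sub>R invariant_op (e * (d - 1)) (- (e * (d - 1))) (- e) (- e) e e"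
    unfolding optimal_op_def Let_def d_def[symmetric] m_def[symmetric] b_def[symmetric] g_def[symmetric] e_def[symmetric]
    unfolding d_def by (rule sum_pattern[OF card_ge_2])
  also have "invariant_op 0 0 m m m m
      + (d - 1) *\<^sub>R (invariant_op (b * (d + 1)) (b * (d + 1)) (- b) (- b) (- b) (- b)
         + invariant_op 0 0 (4 * g) g (- 2 * g) (- 2 * g) + invariant_op 0 0 g (4 * g) (- 2 * g) (- 2 * g))
      = (invariant_op ((d - 1) * z) ((d - 1) * z) z z (- z) (- z) :: ('n \<times> 'n \<times> 'n) operator)"
    unfolding invariant_op_scaleR invariant_op_add bz using S by (intro invariant_op_cong) simp_all
  also have "((d - 1) * (d - 2)) *\<^sub>R invariant_op (e * (d - 1)) (- (e * (d - 1))) (- e) (- e) e e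
      = z *\<^sub>R (invariant_op (d - 1) (- (d - 1)) (-1) (-1) 1 1 :: ('n \<times> 'n \<times> 'n) operator)"
  proof (cases "CARD('n) = 2")
    case True
    \<comment> \<open>The left side has the factor \<open>d - 2 = 0\<close>, and the operator on the
      right is zero in dimension 2.\<close>
    then have "d = 2" by (simp add: d_def)
    then show ?thesis
      using invariant_op_antisymmetric_eq_0[OF True] by simp
  next
    case False
    then have "d > 2"
      using card_ge_2 by (simp add: d_def)
    then have e: "(d - 1) * (d - 2) * e = z"
      by (simp add: e_def z_def power2_eq_square divide_simps)
    then have "(d - 1) * (d - 2) * (e * x) = z * x" for x
      by (simp only: mult.assoc[symmetric])
    then show ?thesis
      unfolding invariant_op_scaleR by (intro invariant_op_cong) (simp_all only: mult_minus_right e mult_1_right)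
  qed
  also have "invariant_op ((d - 1) * z) ((d - 1) * z) z z (- z) (- z) + z *\<^sub>R invariant_op (d - 1) (- (d - 1)) (-1) (-1) 1 1
      = (invariant_op (1 / d) 0 0 0 0 0 :: ('n \<times> 'n \<times> 'n) operator)"
    unfolding invariant_op_scaleR invariant_op_add dz by (rule invariant_op_cong) (simp_all add: algebra_simps)
  finally show ?thesis
    by (simp add: d_def)
qed

lemma learning_instrument_optimal: "learning_instrument optimal_instrument"
  unfolding learning_instrument_def
proof (intro conjI allI exI)
  show "positive_semidefinite (optimal_instrument i j)" for i j
    unfolding optimal_instrument_def by (intro positive_semidefinite_D_diagonal positive_semidefinite_optimal_op)
  let ?\<rho> = "mat (of_real (1 / real CARD('n))) :: 'n operator"
  have "cnj (v $ p) * ?\<rho> $ p $ q * v $ q = of_bool (p = q) * (of_real (1 / real CARD('n)) * of_real ((cmod (v $ p))\<^sup>2))"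
    for v p q
    unfolding complex_norm_square by (cases "p = q") (simp_all add: mat_def)
  then have "(\<Sum>p\<in>UNIV. \<Sum>q\<in>UNIV. cnj (v $ p) * ?\<rho> $ p $ q * v $ q) = (\<Sum>p\<in>UNIV. of_real (1 / real CARD('n)) * of_real ((cmod (v $ p))\<^sup>2))" for v
    by (simp only: sum_of_bool_mult)
  then show "positive_semidefinite ?\<rho>"
    unfolding positive_semidefinite_def by (auto intro!: nonneg_Reals_mult_I sum_nonneg_Reals)
  show "trace ?\<rho> = 1"
    by (simp add: trace_def mat_def)
  show "(\<Sum>i\<in>UNIV. \<Sum>j\<in>UNIV. optimal_instrument i j) = on_C ?\<rho>"
  proof -
    have "(\<Sum>i\<in>UNIV. \<Sum>j\<in>UNIV. optimal_instrument i j) $ (a, b, c, k) $ (a', b', c', k') = on_C ?\<rho> $ (a, b, c, k) $ (a', b', c', k')"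
      for a b c k a' b' c' k' :: 'n
    proof -
      have "(\<Sum>i\<in>UNIV. \<Sum>j\<in>UNIV. optimal_instrument i j) $ (a, b, c, k) $ (a', b', c', k')
         = of_bool (k = k') * (\<Sum>i\<in>UNIV. \<Sum>j\<in>UNIV. optimal_op i j k) $ (a, b, c) $ (a', b', c')"
        unfolding optimal_instrument_def sum_component D_diagonal_nth sum_distrib_left by (rule refl)
      also have "\<dots> = on_C ?\<rho> $ (a, b, c, k) $ (a', b', c', k')"
        unfolding sum_optimal_op invariant_op_nth on_C_nth mat_def vec_lambda_beta
        by (cases "a = a'"; cases "b = b'"; cases "c = c'") simp_all
      finally show ?thesis .
    qed
    then show ?thesis
      by (simp add: vec_eq_iff split_paired_all)
  qed
qed

text \<open>The value is evaluated directly, since the traces against the outcome averages depend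
  only on the coincidence pattern; its agreement with the bound reflects complementary
  slackness.\<close>

lemma average_fidelity_optimal: "average_fidelity \<mu> optimal_instrument = optimal_value"
proof -
  define d where "d = real CARD('n)"
  have d: "d \<ge> 2"
    using card_ge_2 by (simp add: d_def)
  define m where "m = (4 * d - 5) / (9 * d * (d - 1) * (d + 1))"
  define b where "b = 1 / (2 * d * (d - 1) * (d + 1))"
  define g where "g = 1 / (9 * d * (d - 1)\<^sup>2)"
  define e where "e = 1 / (2 * d * (d - 1)\<^sup>2 * (d - 2))"
  have c: "continuous_on UNIV (\<lambda>U. outcome_vector U i j k $ p)" for i j k :: 'n and p
    by (intro continuous_intros)
  have tr: "trace (outcome_op i j k ** invariant_op x1 x2 x3 x4 x5 x6) =
     of_real (x1 + of_bool (i = j) * x2 + of_bool (i = k) * x3 + of_bool (j = k) * x4 + of_bool (i = j \<and> j = k) * (x5 + x6))"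
    (is "_ = of_real ?r") for i j k x1 x2 x3 x4 x5 x6
  proof -
    have "trace (outcome_op i j k ** invariant_op x1 x2 x3 x4 x5 x6) = (LINT U|\<mu>. of_real ?r)"
      unfolding outcome_op_def trace_integral_outer(2)[OF c]
      by (intro Bochner_Integration.integral_cong refl trace_outcome_invariant_op) (simp add: special_unitary_iff)
    then show ?thesis
      using prob_space by simp
  qed
  have val: "Re (trace (outcome_op i j k ** optimal_op i j k)) =
     (if i = j then (if i = k then 4 * m else 2 * b * (d + 1)) else if i = k then 4 * g else if j = k then 4 * g else e * (d - 1))" for i j k
  proof -
    consider "i = j" "j = k" | "i = j" "i \<noteq> k" | "i = k" "i \<noteq> j" | "j = k" "i \<noteq> j" "i \<noteq> k" | "i \<noteq> j" "i \<noteq> k" "j \<noteq> k"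
      by blast
    then show ?thesis
      unfolding optimal_op_def Let_def d_def[symmetric] m_def[symmetric] b_def[symmetric] g_def[symmetric] e_def[symmetric]
      by cases (simp_all add: tr)
  qed
  have "average_fidelity \<mu> optimal_instrument = 1 / d\<^sup>2 * (\<Sum>k\<in>(UNIV :: 'n set).
     4 * m + (d - 1) * (2 * b * (d + 1) + 4 * g + 4 * g) + (d - 1) * (d - 2) * (e * (d - 1)))"
    unfolding average_fidelity_eq optimal_instrument_def D_block_D_diagonal val
      sum_pattern[OF card_ge_2] d_def by simp
  also have "\<dots> = (4 * m + (d - 1) * (2 * b * (d + 1) + 4 * g + 4 * g) + (d - 1) * (d - 2) * (e * (d - 1))) / d"
    using d by (simp add: d_def power2_eq_square)
  also have "\<dots> = optimal_value"
  proof (cases "CARD('n) = 2")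
    case True
    then have "d = 2" by (simp add: d_def)
    then show ?thesis
      using True by (simp add: optimal_value_def m_def b_def g_def)
  next
    case False
    then have d3: "d > 2"
      using card_ge_2 by (simp add: d_def)
    have sq: "d\<^sup>2 - 1 = (d - 1) * (d + 1)"
      by (simp add: algebra_simps power2_eq_square)
    have E: "(d - 1) * (d - 2) * (e * (d - 1)) = 1 / (2 * d)"
      using d3 by (simp add: e_def power2_eq_square divide_simps)
    have B: "(d - 1) * (2 * b * (d + 1) + 4 * g + 4 * g) = 1 / d + 8 / (9 * d * (d - 1))"
      using d3 by (simp add: b_def g_def power2_eq_square divide_simps)
    have "(4 * m + (1 / d + 8 / (9 * d * (d - 1))) + 1 / (2 * d)) / d = (9 * d\<^sup>2 + 16 * d - 17) / (6 * d\<^sup>2 * (d\<^sup>2 - 1))"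
      using d3 unfolding sq m_def by (simp add: power2_eq_square divide_simps) (simp add: algebra_simps)
    then show ?thesis
      using False unfolding E B by (simp add: optimal_value_def d_def Let_def)
  qed
  finally show ?thesis .
qed

end

theorem mainTheorem2:
  fixes \<mu> :: "'n::finite operator measure" and d :: real
  assumes "normalized_Haar_measure \<mu>"
    and "CARD('n) \<ge> 2"
    and "d = real CARD('n)"
  shows "(CARD('n) \<ge> 3 \<longrightarrow>
           is_maximum {average_fidelity \<mu> R | R. learning_instrument R}
             ((9 * d\<^sup>2 + 16 * d - 17) / (6 * d\<^sup>2 * (d\<^sup>2 - 1)))) \<and>
         (CARD('n) = 2 \<longrightarrow>
           is_maximum {average_fidelity \<mu> R | R. learning_instrument R} (7 / 12))"
proof -
  interpret haar_ge_2 \<mu>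
    using assms(1,2) by unfold_locales
  have "is_maximum {average_fidelity \<mu> R | R. learning_instrument R} optimal_value"
    unfolding is_maximum_def
    using average_fidelity_optimal[symmetric] learning_instrument_optimal average_fidelity_le by blast
  then show ?thesis
    unfolding optimal_value_def assms(3) by (auto simp: Let_def)
qed

end
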